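(* Let $n\ge 2$ be an integer. Then for all sufficiently large $Q>1$ there are $\gg Q^{\frac{n+1}{3}}$ real algebraic numbers $\alpha_1$ of degree $n$ with height $H(\alpha_1)\asymp Q$ such that $$|\alpha_1-\alpha_2|\asymp Q^{-\frac{n+1}{3}}\qquad\text{for some }\alpha_2\in\mathbb{R}\text{ conjugate to }\alpha_1.$$ Likewise, for all sufficiently large $Q>1$ there are $\gg Q^{\frac{n+1}{3}}$ real algebraic integers $\alpha_1$ of degree $n+1$ with height $H(\alpha_1)\asymp Q$ such that the same condition holds.
   Context: The height $H(\alpha)$ of an algebraic number $\alpha$ is the maximum of the absolute values of the coefficients of its minimal polynomial over $\mathbb{Z}$. Algebraic numbers are conjugate if they are roots of the same irreducible (over $\mathbb{Q}$) integer polynomial. $\ll$ and $\gg$ are the Vinogradov symbols with implicit positive constants depending on $n$ only, and $a\asymp b$ means that $a\ll b$ and $a\gg b$ hold simultaneously. *)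

theory Defs
  imports Complex_Main "HOL-Computational_Algebra.Computational_Algebra"
begin

text \<open>
  An irreducible element of \<open>int poly\<close> with a root in characteristic 0 is nonconstant and
  primitive, so the conditions below single out the primitive irreducible integer polynomial with
  positive leading coefficient. The value is meaningful for algebraic arguments only.
\<close>

definition min_int_poly :: "'a :: field_char_0 \<Rightarrow> int poly" where
  "min_int_poly x =
     (THE p. irreducible p \<and> lead_coeff p > 0 \<and> poly (map_poly of_int p) x = 0)"

definition alg_degree :: "'a :: field_char_0 \<Rightarrow> nat" where
  "alg_degree x = degree (min_int_poly x)"

definition alg_height :: "'a :: field_char_0 \<Rightarrow> int" where
  "alg_height x = Max ((\<lambda>i. \<bar>coeff (min_int_poly x) i\<bar>) ` {..alg_degree x})"

definition alg_conjugate :: "'a :: field_char_0 \<Rightarrow> 'a \<Rightarrow> bool" where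
  "alg_conjugate x y \<longleftrightarrow>
     (\<exists>p :: int poly. irreducible (map_poly of_int p :: rat poly) \<and>
        poly (map_poly of_int p) x = 0 \<and> poly (map_poly of_int p) y = 0)"

lemma map_poly_of_int_mult:
  "map_poly of_int (p * q) = (map_poly of_int p * map_poly of_int q :: 'a :: comm_ring_1 poly)"
  by (intro poly_eqI) (simp add: coeff_map_poly coeff_mult)

lemma map_poly_of_int_add:
  "map_poly of_int (p + q) = (map_poly of_int p + map_poly of_int q :: 'a :: comm_ring_1 poly)"
  by (intro poly_eqI) (simp add: coeff_map_poly)

lemma map_poly_of_int_smult:
  "map_poly of_int (smult c p) = (smult (of_int c) (map_poly of_int p) :: 'a :: comm_ring_1 poly)"
  by (intro poly_eqI) (simp add: coeff_map_poly)

lemma ex1_min_int_poly: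
  fixes x :: "'a :: field_char_0"
  assumes "algebraic x"
  shows "\<exists>!p. irreducible p \<and> lead_coeff p > 0 \<and> poly (map_poly of_int p) x = 0"
proof -
  define root where "root p \<longleftrightarrow> poly (map_poly of_int p) x = 0" for p :: "int poly"
  have root_mult: "root (p * q) \<longleftrightarrow> root p \<or> root q" for p q
    by (simp add: root_def map_poly_of_int_mult)
  have root_add: "root (p + q) \<longleftrightarrow> root q" if "root p" for p q
    using that by (simp add: root_def map_poly_of_int_add)
  have root_smult: "root (smult c p)" if "root p" for c p
    using that by (simp add: root_def map_poly_of_int_smult)
  have root_const: "\<not> root [:c:]" if "c \<noteq> 0" for c
    using that by (simp add: root_def map_poly_pCons)
  obtain q0 where q0: "q0 \<noteq> 0" "root q0"
    using assms unfolding root_def by (rule algebraicE')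
  define P where "P p \<longleftrightarrow> p \<noteq> 0 \<and> root p" for p
  have ex_irred: "\<exists>r. irreducible r \<and> root r \<and> r dvd q" if q: "q \<noteq> 0" "root q" for q :: "int poly"
  proof -
    obtain A where A: "\<And>p. p \<in># A \<Longrightarrow> prime p" "normalize (prod_mset A) = normalize q"
      using prime_factorization_exists'[OF q(1)] by blast
    then have "q dvd prod_mset A" by (simp add: associated_iff_dvd)
    then have "root (prod_mset A)" using q(2) root_mult by (metis dvdE)
    moreover have "root (prod_mset B) \<Longrightarrow> \<exists>r\<in>#B. root r" for B
    proof (induction B)
      case empty
      then show ?case using root_const[of 1] by (simp add: one_pCons)
    qed (auto simp: root_mult)
    ultimately obtain r where r: "r \<in># A" "root r" by blast
    have "irreducible r" using A(1)[OF r(1)] by (simp add: prime_elem_imp_irreducible)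
    moreover have "r dvd q"
      using r(1) A(2) by (metis dvd_normalize_iff dvd_prod_mset)
    ultimately show ?thesis using r(2) by blast
  qed
  obtain q where q: "P q" and qmin: "\<And>p. P p \<Longrightarrow> degree q \<le> degree p"
    using ex_has_least_nat[of P q0 degree] q0 unfolding P_def by blast
  obtain r where r: "irreducible r" "root r" "r dvd q"
    using ex_irred q unfolding P_def by blast
  have "r \<noteq> 0" using r(1) by auto
  have rmin: "degree r \<le> degree p" if "P p" for p
    using qmin[OF that] r(3) q dvd_imp_degree_le unfolding P_def by (metis le_trans)
  have r_dvd: "r dvd p" if "root p" for p
  proof -
    obtain a s where as: "a \<noteq> 0" "smult a p = r * s + pseudo_mod p r"
      using pseudo_mod(1)[OF \<open>r \<noteq> 0\<close>] by blast
    have "root (r * s)" using r(2) root_mult by blast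
    then have "root (pseudo_mod p r)"
      using root_add root_smult[OF that] as(2) by metis
    then have "pseudo_mod p r = 0"
      using pseudo_mod(2)[OF \<open>r \<noteq> 0\<close>, of p] rmin unfolding P_def by (meson leD)
    then have "r dvd [:a:] * p" using as by simp
    then have "r dvd [:a:] \<or> r dvd p"
      using r(1) by (meson irreducible_imp_prime_elem prime_elem_dvd_mult_iff)
    moreover have "\<not> r dvd [:a:]"
      using root_const[OF as(1)] r(2) root_mult by (metis dvdE)
    ultimately show ?thesis by blast
  qed
  define m where "m = (if lead_coeff r > 0 then r else - r)"
  have "lead_coeff r \<noteq> 0" using \<open>r \<noteq> 0\<close> by simp
  have "irreducible m" using r(1) irreducible_mult_unit_left[of "- 1" r] by (simp add: m_def)
  moreover have "root m"
    using r(2) root_smult[OF r(2), of "- 1"] by (simp add: m_def)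
  moreover have "lead_coeff m > 0"
    using \<open>lead_coeff r \<noteq> 0\<close> unfolding m_def lead_coeff_minus by (simp add: not_less order.order_iff_strict)
  moreover have "m dvd r" by (simp add: m_def)
  ultimately have m: "irreducible m" "root m" "lead_coeff m > 0" "m dvd r" by blast+
  show ?thesis
  proof (rule ex1I[of _ m])
    fix p assume p: "irreducible p \<and> lead_coeff p > 0 \<and> poly (map_poly of_int p) x = 0"
    then have "m dvd p" using r_dvd m(4) root_def dvd_trans by blast
    then obtain k where k: "p = m * k" by (elim dvdE)
    then have "k dvd 1" using p m(1) by (metis irreducibleD irreducible_not_unit)
    then obtain c where c: "k = [:c:]" "c dvd 1" by (auto simp: is_unit_poly_iff)
    have "lead_coeff p = lead_coeff m * c" using k c by (simp add: mult.commute)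
    then have "c > 0" using p m(3) by (metis zero_less_mult_pos)
    then have "c = 1" using c(2) by simp
    then show "p = m" using k c by simp
  qed (use m root_def in auto)
qed

end

theory Submission
  imports Defs "HOL-Analysis.Analysis" "Berlekamp_Zassenhaus.Factor_Bound"
begin

text \<open>
  Put \<open>\<delta> = Q powr (- (n + 1) / 3)\<close>. For a real \<open>x\<close> the polynomials \<open>P\<close> of degree at most \<open>n\<close>
  with \<open>\<bar>P(x)\<bar> \<le> Q \<delta>\<^sup>2\<close>, \<open>\<bar>P'(x)\<bar> \<le> Q \<delta>\<close> and coefficients of size at most \<open>Q\<close> form a convex body
  whose volume is of order \<open>Q ^ (n + 1) * \<delta> ^ 3 = 1\<close>, the covolume of the lattice of integer
  polynomials. The exponent \<open>(n + 1) / 3\<close> is the one at which these two volumes balance.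

  Call \<open>x\<close> good if no nonzero integer polynomial lies in a fixed small multiple of this body. At a
  good point the covering radius is bounded (\<open>covering_radius_bounded\<close>), so every real polynomial of
  degree at most \<open>n\<close> is matched by an integer polynomial up to a fixed multiple of the body. The
  polynomial \<open>M Q ((y - x)\<^sup>2 - \<delta>\<^sup>2)\<close> has the two roots \<open>x \<plusminus> \<delta>\<close>; if \<open>M\<close> is large enough, then an error
  in the body cannot destroy the sign changes, and the matching integer polynomial has roots on
  both sides of \<open>x\<close>, each at distance between \<open>\<delta> / 2\<close> and \<open>2 \<delta>\<close>. Matching only over the sublattice
  of multiples of 4 leaves the residues modulo 4 free to be prescribed, so Eisenstein's criterion at
  2 makes the polynomial irreducible; adding the monomial \<open>y ^ (n + 1)\<close> gives the algebraic integers
  (\<open>ex_polynomial_with_close_roots\<close>). Goodness also bounds the content, so the height of the root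
  is of order \<open>Q\<close>.

  The good points in \<open>[0, 1]\<close> have measure at least \<open>1/2\<close> (\<open>most_points_good\<close>), and each root found
  serves only points within \<open>2 \<delta>\<close> of it, so there are at least \<open>1 / (8 \<delta>)\<close> of them.

  That most points are good is the quantitative nondivergence theorem of Kleinbock and Margulis,
  proved here for functions on the line (\<open>nondivergence\<close>). To every primitive sublattice \<open>W\<close> of the
  lattice of integer polynomials belongs its covolume at \<open>x\<close>, measured in the norm of the body: a
  maximum of absolute values of polynomials in \<open>x\<close> of bounded degree. Such functions are small
  only on short sets relative to an interval on which they are not small throughout, and each is
  bounded below somewhere on \<open>[0, 1]\<close> because a Wronskian of two independent integer polynomials is
  a nonzero integer polynomial (\<open>covolume_basis_lower_bound\<close>). The nondivergence theorem then yields, for most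
  \<open>x\<close>, a flag of sublattices whose covolumes are neither too small nor too large and such that all
  sublattices compatible with the flag have covolume bounded below. A short vector
  \<open>v\<close> would, added to the largest member of the flag not containing it, produce a
  compatible sublattice of small covolume (\<open>marked_imp_no_small_vector\<close>).
\<close>

hide_const (open) UnivPoly.coeff UnivPoly.monom Module.smult Henstock_Kurzweil_Integration.content

section \<open>Sublevel sets of polynomials on an interval\<close>

text \<open>
  A root \<open>z\<close> at distance more than twice the length of the interval from \<open>x0\<close> is at least half as
  far from every point of the interval, so the set is empty. A nearer root confines the set to an
  interval around its real part.
\<close>

lemma sublevel_near_root:
  fixes z :: complex and a b x0 t :: real
  assumes ab: "a \<le> x0" "x0 \<le> b" and t: "0 \<le> t" "t \<le> 1/2"
  obtains l u where "l \<le> u" "u - l \<le> 4 * t * (b - a)"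
    "{x\<in>{a..b}. cmod (of_real x - z) < t * cmod (of_real x0 - z)} \<subseteq> {l..u}"
proof (cases "cmod (of_real x0 - z) \<le> 2 * (b - a)")
  case True
  define r where "r = 2 * t * (b - a)"
  have "r \<ge> 0" using ab t by (simp add: r_def)
  show ?thesis
  proof (rule that[of "Re z - r" "Re z + r"])
    show "{x\<in>{a..b}. cmod (of_real x - z) < t * cmod (of_real x0 - z)} \<subseteq> {Re z - r..Re z + r}"
    proof
      fix x assume "x \<in> {x\<in>{a..b}. cmod (of_real x - z) < t * cmod (of_real x0 - z)}"
      then have "cmod (of_real x - z) < t * cmod (of_real x0 - z)" by simp
      also have "\<dots> \<le> t * (2 * (b - a))" using True t by (intro mult_left_mono) auto
      finally have "cmod (of_real x - z) \<le> r" by (simp add: r_def algebra_simps)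
      moreover have "\<bar>x - Re z\<bar> \<le> cmod (of_real x - z)"
        using abs_Re_le_cmod[of "of_real x - z"] by simp
      ultimately show "x \<in> {Re z - r..Re z + r}" by (auto simp: abs_le_iff)
    qed
  qed (use \<open>r \<ge> 0\<close> in \<open>auto simp: r_def\<close>)
next
  case False
  have "{x\<in>{a..b}. cmod (of_real x - z) < t * cmod (of_real x0 - z)} = {}"
  proof (safe, goal_cases)
    case (1 x)
    have "t * cmod (of_real x0 - z) \<le> 1/2 * cmod (of_real x0 - z)"
      using t by (intro mult_right_mono) auto
    moreover have "cmod (of_real x0 - z) \<le> cmod (of_real x0 - of_real x) + cmod (of_real x - z)"
      using norm_triangle_ineq[of "of_real x0 - of_real x" "of_real x - z"] by simp
    moreover have "cmod (of_real x0 - of_real x) \<le> b - a"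
      using 1 ab unfolding of_real_diff[symmetric] norm_of_real by auto
    ultimately show ?case using 1 False by simp
  qed
  then show ?thesis using ab t by (intro that[of a a]) auto
qed

lemma prod_mset_cmod: "cmod (prod_mset A) = prod_mset (image_mset cmod A)"
  by (induction A) (auto simp: norm_mult)

lemma prod_mset_ge:
  fixes f g :: "'a \<Rightarrow> real"
  assumes "\<And>x. x \<in># A \<Longrightarrow> t * g x \<le> f x" "t \<ge> 0" "\<And>x. g x \<ge> 0"
  shows "t ^ size A * prod_mset (image_mset g A) \<le> prod_mset (image_mset f A)"
  using assms(1)
proof (induction A)
  case (add a A)
  have g0: "prod_mset (image_mset g A) \<ge> 0" by (induction A) (auto simp: assms)
  have "t ^ size (add_mset a A) * prod_mset (image_mset g (add_mset a A)) =
    (t * g a) * (t ^ size A * prod_mset (image_mset g A))" by (simp add: mult_ac)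
  also have "\<dots> \<le> f a * prod_mset (image_mset f A)"
    using add assms g0 by (intro mult_mono) (auto intro: order_trans[OF mult_nonneg_nonneg])
  finally show ?case by simp
qed auto

lemma UN_intervals_emeasure:
  assumes "finite A" "\<And>z. z \<in> A \<Longrightarrow> \<exists>l u. l \<le> u \<and> u - l \<le> e \<and> S z \<subseteq> {l..u::real}"
  shows "\<exists>U\<in>sets borel. (\<Union>z\<in>A. S z) \<subseteq> U \<and> emeasure lborel U \<le> ennreal (real (card A) * e)"
proof -
  from assms(2) obtain l u where lu: "\<And>z. z \<in> A \<Longrightarrow> l z \<le> u z \<and> u z - l z \<le> e \<and> S z \<subseteq> {l z..u z}"
    by metis
  show ?thesis
  proof (intro bexI[of _ "\<Union>z\<in>A. {l z..u z}"] conjI)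
    have "emeasure lborel (\<Union>z\<in>A. {l z..u z}) \<le> (\<Sum>z\<in>A. emeasure lborel {l z..u z})"
      using assms(1) by (intro emeasure_subadditive_finite) auto
    also have "\<dots> \<le> (\<Sum>z\<in>A. ennreal e)"
      using lu by (intro sum_mono) (auto intro!: ennreal_leI)
    also have "\<dots> = ennreal (real (card A) * e)"
      by (simp add: ennreal_mult' ennreal_of_nat_eq_real_of_nat)
    finally show "emeasure lborel (\<Union>z\<in>A. {l z..u z}) \<le> ennreal (real (card A) * e)" .
  qed (use lu assms(1) in \<open>auto intro!: sets.finite_UN\<close>)
qed

text \<open>
  Over the complex numbers \<open>\<bar>f x\<bar> / \<bar>f x0\<bar>\<close> is a product of at most \<open>D\<close> ratios \<open>\<bar>x - z\<bar> / \<bar>x0 - z\<bar>\<close>;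
  if the product is below \<open>t ^ D\<close>, then one of the ratios is below \<open>t\<close>.
\<close>

lemma poly_sublevel_small:
  fixes f :: "real poly" and a b x0 t r :: real
  assumes deg: "degree f \<le> D" and x0: "a \<le> x0" "x0 \<le> b" and f0: "\<bar>poly f x0\<bar> \<ge> r"
    and r: "r > 0" and t: "0 < t" "t \<le> 1/2"
  shows "\<exists>U\<in>sets borel. {x\<in>{a..b}. \<bar>poly f x\<bar> < r * t ^ D} \<subseteq> U \<and>
    emeasure lborel U \<le> ennreal (4 * real D * t * (b - a))"
proof -
  define F where "F = map_poly complex_of_real f"
  have F: "poly F (of_real x) = of_real (poly f x)" for x
    unfolding F_def by (induction f) (auto simp: map_poly_pCons)
  have "f \<noteq> 0" using f0 r by auto
  have degF: "degree F = degree f" unfolding F_def by (rule degree_map_poly) auto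
  have "F \<noteq> 0" using \<open>f \<noteq> 0\<close> unfolding F_def by (subst map_poly_eq_0_iff) auto
  then obtain A where A: "size A = degree F" "F = smult (lead_coeff F) (\<Prod>z\<in>#A. [:-z, 1:])"
    using alg_closed_imp_factorization by blast
  have pp: "poly (\<Prod>z\<in>#B. [:-z, 1:]) w = (\<Prod>z\<in>#B. w - z)" for B and w :: complex
    by (induction B) (auto simp: algebra_simps)
  have absf: "\<bar>poly f x\<bar> = cmod (lead_coeff F) * (\<Prod>z\<in>#A. cmod (of_real x - z))" for x
  proof -
    have "\<bar>poly f x\<bar> = cmod (poly F (of_real x))" by (simp add: F)
    also have "poly F (of_real x) = lead_coeff F * (\<Prod>z\<in>#A. of_real x - z)"
      by (subst A(2)) (simp only: poly_smult pp)
    finally show ?thesis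
      by (simp add: norm_mult prod_mset_cmod image_mset.compositionality o_def)
  qed
  have sub: "{x\<in>{a..b}. \<bar>poly f x\<bar> < r * t ^ D} \<subseteq>
     (\<Union>z\<in>set_mset A. {x\<in>{a..b}. cmod (of_real x - z) < t * cmod (of_real x0 - z)})"
  proof (rule ccontr)
    assume "\<not> ?thesis"
    then obtain x where x: "x \<in> {a..b}" "\<bar>poly f x\<bar> < r * t ^ D"
      "\<And>z. z \<in># A \<Longrightarrow> t * cmod (of_real x0 - z) \<le> cmod (of_real x - z)" by force
    have "t ^ size A * (\<Prod>z\<in>#A. cmod (of_real x0 - z)) \<le> (\<Prod>z\<in>#A. cmod (of_real x - z))"
      using x t by (intro prod_mset_ge) auto
    then have "t ^ size A * \<bar>poly f x0\<bar> \<le> \<bar>poly f x\<bar>"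
      unfolding absf by (metis mult.left_commute mult_left_mono norm_ge_zero)
    moreover have "t ^ D * r \<le> t ^ size A * \<bar>poly f x0\<bar>"
      using t deg degF A(1) f0 r by (intro mult_mono power_decreasing) auto
    ultimately show False using x by (simp add: mult.commute)
  qed
  have "\<exists>U\<in>sets borel. (\<Union>z\<in>set_mset A. {x\<in>{a..b}. cmod (of_real x - z) < t * cmod (of_real x0 - z)}) \<subseteq> U \<and>
     emeasure lborel U \<le> ennreal (real (card (set_mset A)) * (4 * t * (b - a)))"
  proof (rule UN_intervals_emeasure)
    fix z assume "z \<in> set_mset A"
    obtain l u where "l \<le> u" "u - l \<le> 4 * t * (b - a)"
      "{x\<in>{a..b}. cmod (of_real x - z) < t * cmod (of_real x0 - z)} \<subseteq> {l..u}"
      using sublevel_near_root[OF x0, of t z] t by auto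
    then show "\<exists>l u. l \<le> u \<and> u - l \<le> 4 * t * (b - a) \<and>
      {x\<in>{a..b}. cmod (of_real x - z) < t * cmod (of_real x0 - z)} \<subseteq> {l..u}" by blast
  qed simp
  moreover have "real (card (set_mset A)) * (4 * t * (b - a)) \<le> 4 * real D * t * (b - a)"
  proof -
    have "card (set_mset B) \<le> size B" for B :: "complex multiset"
      by (induction B) (auto simp: card_insert_if)
    then have "card (set_mset A) \<le> D" using A(1) degF deg by (metis le_trans)
    then have "real (card (set_mset A)) * (4 * t * (b - a)) \<le> real D * (4 * t * (b - a))"
      using t x0 by (intro mult_right_mono) auto
    then show ?thesis by (simp add: mult_ac)
  qed
  ultimately obtain U where U: "U \<in> sets borel"
    "emeasure lborel U \<le> ennreal (real (card (set_mset A)) * (4 * t * (b - a)))"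
    "(\<Union>z\<in>set_mset A. {x\<in>{a..b}. cmod (of_real x - z) < t * cmod (of_real x0 - z)}) \<subseteq> U"
    and le: "real (card (set_mset A)) * (4 * t * (b - a)) \<le> 4 * real D * t * (b - a)" by blast
  note le' = order_trans[OF U(2) ennreal_leI[OF le]] and sub' = order_trans[OF sub U(3)]
  from U(1) sub' le' show ?thesis by (intro bexI[of _ U] conjI)
qed

text \<open>
  A nonzero polynomial of degree at most \<open>D\<close> does not vanish at all of the \<open>D + 1\<close> points \<open>i / D\<close>,
  and there its value is an integer divided by \<open>D ^ D\<close>.
\<close>

lemma int_poly_lower_bound:
  fixes f :: "int poly"
  assumes "f \<noteq> 0" "degree f \<le> D" "D > 0"
  obtains x :: real where "x \<in> {0..1}" "\<bar>poly (of_int_poly f) x\<bar> \<ge> 1 / real D ^ D"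
proof -
  let ?g = "of_int_poly f :: real poly"
  have g0: "?g \<noteq> 0" using assms by auto
  have "\<exists>i\<le>D. poly ?g (real i / real D) \<noteq> 0"
  proof (rule ccontr)
    assume "\<not> ?thesis"
    then have "(\<lambda>i. real i / real D) ` {..D} \<subseteq> {x. poly ?g x = 0}" by auto
    then have "card ((\<lambda>i. real i / real D) ` {..D}) \<le> card {x. poly ?g x = 0}"
      using g0 by (intro card_mono poly_roots_finite) auto
    also have "\<dots> \<le> degree ?g" using g0 by (rule poly_roots_degree)
    also have "\<dots> \<le> D" using assms by simp
    finally show False using assms(3) by (subst (asm) card_image) (auto simp: inj_on_def)
  qed
  then obtain i where i: "i \<le> D" "poly ?g (real i / real D) \<noteq> 0" by blast
  have "poly ?g (real i / real D) * real D ^ D =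
      of_int (\<Sum>k\<le>degree f. coeff f k * int i ^ k * int D ^ (D - k))"
  proof -
    have *: "(of_int (coeff f k) * (real i / real D) ^ k) * real D ^ D =
       of_int (coeff f k * int i ^ k * int D ^ (D - k))" if "k \<in> {..degree f}" for k
    proof -
      have "real D ^ D = real D ^ k * real D ^ (D - k)"
        using that assms by (simp add: power_add[symmetric])
      then show ?thesis using assms(3) by (simp add: field_simps power_divide)
    qed
    have "poly ?g (real i / real D) * real D ^ D =
       (\<Sum>k\<le>degree f. (of_int (coeff f k) * (real i / real D) ^ k) * real D ^ D)"
      by (simp add: poly_altdef sum_distrib_right)
    also have "\<dots> = (\<Sum>k\<le>degree f. of_int (coeff f k * int i ^ k * int D ^ (D - k)))"
      by (intro sum.cong refl *)
    finally show ?thesis by simp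
  qed
  then obtain z :: int where z: "poly ?g (real i / real D) * real D ^ D = of_int z" by blast
  then have "z \<noteq> 0" using i assms by auto
  then have "\<bar>of_int z :: real\<bar> \<ge> 1" by linarith
  then have "\<bar>poly ?g (real i / real D) * real D ^ D\<bar> \<ge> 1" using z by simp
  then have "\<bar>poly ?g (real i / real D)\<bar> \<ge> 1 / real D ^ D"
    using assms(3) by (simp add: abs_mult field_simps)
  then show ?thesis using i assms by (intro that[of "real i / real D"]) auto
qed

section \<open>Quantitative nondivergence on the line\<close>

text \<open>
  This sums the local estimates over a countable family with disjoint cores, as it is provided by
  the Vitali covering lemma.
\<close>

lemma emeasure_UN_le_disjoint_UN:
  assumes C: "countable C" and dis: "disjoint_family_on D C"
    and D: "\<And>y. y \<in> C \<Longrightarrow> D y \<in> sets M" and U: "\<And>y. y \<in> C \<Longrightarrow> U y \<in> sets M"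
    and le: "\<And>y. y \<in> C \<Longrightarrow> emeasure M (U y) \<le> c * emeasure M (D y)"
  shows "emeasure M (\<Union>y\<in>C. U y) \<le> c * emeasure M (\<Union>y\<in>C. D y)"
proof -
  let ?t = "to_nat_on C"
  define pull where "pull X i = (if i \<in> ?t ` C then X (from_nat_into C i) else {})" for X :: "'a \<Rightarrow> 'b set" and i
  have pull_t: "pull X (?t y) = X y" if "y \<in> C" for X y
    using that C by (simp add: pull_def)
  have pull_UN: "(\<Union>i. pull X i) = (\<Union>y\<in>C. X y)" for X
  proof (intro equalityI subsetI)
    fix z assume "z \<in> (\<Union>i. pull X i)"
    then obtain i where "z \<in> pull X i" by blast
    then obtain y where "y \<in> C" "i = ?t y" "z \<in> pull X (?t y)"
      unfolding pull_def by (auto split: if_splits)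
    then show "z \<in> (\<Union>y\<in>C. X y)" using pull_t by auto
  next
    fix z assume "z \<in> (\<Union>y\<in>C. X y)"
    then obtain y where "y \<in> C" "z \<in> X y" by blast
    then have "z \<in> pull X (?t y)" using pull_t by auto
    then show "z \<in> (\<Union>i. pull X i)" by blast
  qed
  have cases: "pull X i = {} \<or> (\<exists>y\<in>C. i = ?t y)" for X i unfolding pull_def by auto
  have sets: "range (pull X) \<subseteq> sets M" if "\<And>y. y \<in> C \<Longrightarrow> X y \<in> sets M" for X
  proof (rule image_subsetI)
    fix i show "pull X i \<in> sets M"
    proof (cases "pull X i = {}")
      case False
      then obtain y where "y \<in> C" "i = ?t y" using cases[of X i] by blast
      then show ?thesis using that pull_t[of y X] by simp
    qed simp
  qed
  have disj: "disjoint_family (pull D)"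
    unfolding disjoint_family_on_def
  proof (intro ballI impI)
    fix i j :: nat assume ij: "i \<noteq> j"
    show "pull D i \<inter> pull D j = {}"
    proof (cases "pull D i = {} \<or> pull D j = {}")
      case False
      then obtain y z where "y \<in> C" "i = ?t y" "z \<in> C" "j = ?t z" using cases by metis
      then show ?thesis using dis ij pull_t unfolding disjoint_family_on_def by metis
    qed auto
  qed
  have le': "emeasure M (pull U i) \<le> c * emeasure M (pull D i)" for i
  proof (cases "pull U i = {}")
    case False
    then obtain y where "y \<in> C" "i = ?t y" using cases by metis
    then show ?thesis using le pull_t by simp
  qed simp
  have "emeasure M (\<Union>y\<in>C. U y) \<le> (\<Sum>i. emeasure M (pull U i))"
    unfolding pull_UN[symmetric] by (intro emeasure_subadditive_countably sets U)
  also have "\<dots> \<le> (\<Sum>i. c * emeasure M (pull D i))" using le' by (intro suminf_le) auto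
  also have "\<dots> = c * (\<Sum>i. emeasure M (pull D i))" by simp
  also have "(\<Sum>i. emeasure M (pull D i)) = emeasure M (\<Union>i. pull D i)"
    by (intro suminf_emeasure sets D disj)
  finally show ?thesis unfolding pull_UN .
qed

definition is_chain :: "'a set set \<Rightarrow> bool" where
  "is_chain F \<longleftrightarrow> (\<forall>U\<in>F. \<forall>V\<in>F. U \<subseteq> V \<or> V \<subseteq> U)"

text \<open>
  The chain \<open>F\<close> is the flag attached to \<open>x\<close>: all its members have moderate size at \<open>x\<close>, and
  everything compatible with the flag but outside it is large. In the application \<open>\<psi> W x\<close> is the
  covolume of the sublattice \<open>W\<close> at \<open>x\<close>.
\<close>

definition marked :: "real \<Rightarrow> real \<Rightarrow> ('a set \<Rightarrow> real \<Rightarrow> real) \<Rightarrow> 'a set set \<Rightarrow> real \<Rightarrow> bool" where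
  "marked e r \<psi> S x \<longleftrightarrow> (\<exists>F\<subseteq>S. is_chain F \<and> (\<forall>W\<in>F. e \<le> \<psi> W x \<and> \<psi> W x \<le> r) \<and>
     (\<forall>W\<in>S. W \<notin> F \<longrightarrow> (\<forall>U\<in>F. U \<subseteq> W \<or> W \<subseteq> U) \<longrightarrow> r \<le> \<psi> W x))"

lemma marked_insert:
  assumes s: "s \<in> S" "e \<le> \<psi> s x" "\<psi> s x \<le> r"
    and m: "marked e r \<psi> {W\<in>S. W \<noteq> s \<and> (W \<subseteq> s \<or> s \<subseteq> W)} x"
  shows "marked e r \<psi> S x"
proof -
  let ?S = "{W\<in>S. W \<noteq> s \<and> (W \<subseteq> s \<or> s \<subseteq> W)}"
  obtain F where F: "F \<subseteq> ?S" "is_chain F" "\<forall>W\<in>F. e \<le> \<psi> W x \<and> \<psi> W x \<le> r"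
    "\<forall>W\<in>?S. W \<notin> F \<longrightarrow> (\<forall>U\<in>F. U \<subseteq> W \<or> W \<subseteq> U) \<longrightarrow> r \<le> \<psi> W x"
    using m unfolding marked_def by blast
  show ?thesis unfolding marked_def
  proof (intro exI[of _ "insert s F"] conjI)
    show "is_chain (insert s F)" using F(1,2) unfolding is_chain_def by blast
    show "\<forall>W\<in>S. W \<notin> insert s F \<longrightarrow> (\<forall>U\<in>insert s F. U \<subseteq> W \<or> W \<subseteq> U) \<longrightarrow> r \<le> \<psi> W x"
      using F(4) by blast
  qed (use F s in auto)
qed

text \<open>
  The factor 20 in each step of the induction is the ratio between the length of the enlarged interval (at most four
  times the radius) and the part of the disjoint Vitali ball inside the interval (at least a fifth of the radius).
\<close>

primrec nondiv_const :: "real \<Rightarrow> nat \<Rightarrow> real" where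
  "nondiv_const k 0 = 0"
| "nondiv_const k (Suc d) = 20 * (k + nondiv_const k d)"

lemma nondiv_const_nonneg: "k \<ge> 0 \<Longrightarrow> nondiv_const k d \<ge> 0"
  by (induction d) auto

lemma nondiv_const_linear: "nondiv_const k d = k * nondiv_const 1 d"
  by (induction d) (auto simp: algebra_simps)

text \<open>
  Half of the ball may stick out at an end of the interval, but never more than half unless the
  ball covers the whole interval.
\<close>

lemma interval_ball_measure:
  fixes a b y r :: real
  assumes "a \<le> y" "y \<le> b" "0 \<le> r" "r \<le> b - a"
  shows "ennreal r \<le> emeasure lborel (cball y r \<inter> {a..b})"
proof -
  have eq: "cball y r \<inter> {a..b} = {max a (y - r)..min b (y + r)}"
    by (auto simp: cball_def dist_real_def)
  have "r \<le> min b (y + r) - max a (y - r)" using assms by (auto simp: min_def max_def)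
  then show ?thesis using assms unfolding eq by (simp add: ennreal_leI)
qed

text \<open>
  Induction on the length \<open>d\<close> of chains in \<open>S\<close>. Around a point \<open>y\<close> at which some \<open>\<psi> s\<close> is below \<open>r\<close>
  one takes an \<open>s\<close> that stays below \<open>r\<close> on a ball of more than half the largest possible radius.
  On the ball of twice that radius every \<open>\<psi> s'\<close> reaches \<open>r\<close>, so that the induction hypothesis applies
  there to the elements comparable with \<open>s\<close>, whose chains are shorter because \<open>s\<close> can be inserted
  in them. Outside the small set where \<open>\<psi> s < e\<close>, a flag for those elements extends by \<open>s\<close>. A
  Vitali covering by the balls bounds the sum of the exceptional sets.
\<close>

theorem nondivergence:
  fixes \<psi> :: "'a set \<Rightarrow> real \<Rightarrow> real" and S :: "'a set set"
  assumes good: "\<And>W a b x0. \<lbrakk>W \<in> S; a \<le> x0; x0 \<le> b; r \<le> \<psi> W x0\<rbrakk> \<Longrightarrow>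
      \<exists>U\<in>sets borel. {x\<in>{a..b}. \<psi> W x < e} \<subseteq> U \<and> emeasure lborel U \<le> ennreal (k * (b - a))"
    and cont: "\<And>W. W \<in> S \<Longrightarrow> open {x. \<psi> W x < r}"
    and chains: "\<And>F. F \<subseteq> S \<Longrightarrow> is_chain F \<Longrightarrow> finite F \<and> card F \<le> d"
    and sup: "\<And>W. W \<in> S \<Longrightarrow> \<exists>x\<in>{a..b}. r \<le> \<psi> W x"
    and ab: "a < b" and k: "k \<ge> 0"
  shows "\<exists>U\<in>sets borel. {x\<in>{a..b}. \<not> marked e r \<psi> S x} \<subseteq> U \<and>
      emeasure lborel U \<le> ennreal (nondiv_const k d * (b - a))"
  using good cont chains sup ab
proof (induction d arbitrary: S a b)
  case 0
  have "S = {}"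
  proof (rule ccontr)
    assume "S \<noteq> {}"
    then obtain W where "W \<in> S" by blast
    then show False using 0(3)[of "{W}"] by (auto simp: is_chain_def)
  qed
  then have "marked e r \<psi> S x" for x unfolding marked_def is_chain_def by blast
  then show ?case by (intro bexI[of _ "{}"]) auto
next
  case (Suc d)
  note good = Suc.prems(1) and cont = Suc.prems(2) and chains = Suc.prems(3)
    and sup = Suc.prems(4) and ab = Suc.prems(5)
  define low where "low s y R \<longleftrightarrow> (\<forall>x\<in>{a..b}. \<bar>x - y\<bar> \<le> R \<longrightarrow> \<psi> s x < r)" for s y R
  define E where "E = {y\<in>{a..b}. \<exists>s\<in>S. \<psi> s y < r}"
  have radius: "\<exists>R s. 0 < R \<and> R \<le> b - a \<and> s \<in> S \<and> low s y R \<and> (\<forall>s'\<in>S. \<not> low s' y (2 * R))"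
    if y: "y \<in> E" for y
  proof -
    define A where "A = {R. 0 < R \<and> (\<exists>s\<in>S. low s y R)}"
    have Ale: "R \<le> b - a" if "R \<in> A" for R
    proof (rule ccontr)
      assume R: "\<not> R \<le> b - a"
      obtain s where s: "s \<in> S" "low s y R" using \<open>R \<in> A\<close> unfolding A_def by blast
      obtain x where "x \<in> {a..b}" "r \<le> \<psi> s x" using sup[OF s(1)] by blast
      then show False using s(2) R y unfolding low_def E_def by fastforce
    qed
    have "\<exists>R. R \<in> A"
    proof -
      obtain s where s: "s \<in> S" "\<psi> s y < r" using y unfolding E_def by blast
      then obtain d where d: "d > 0" "\<And>x. dist x y < d \<Longrightarrow> \<psi> s x < r"
        using cont[OF s(1)] unfolding open_dist by auto
      have "low s y (d/2)" unfolding low_def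
      proof (intro ballI impI)
        fix x assume "\<bar>x - y\<bar> \<le> d/2"
        then show "\<psi> s x < r" using d by (auto simp: dist_real_def)
      qed
      then show ?thesis using d(1) s(1) unfolding A_def by (intro exI[of _ "d/2"]) auto
    qed
    then obtain R0 where R0: "R0 \<in> A" by blast
    have bdd: "bdd_above A" using Ale by (intro bdd_aboveI) auto
    \<comment> \<open>A radius above half the supremum: its double is too large for every element of \<open>S\<close>.\<close>
    have "Sup A \<ge> R0" using R0 bdd by (intro cSup_upper)
    then have "Sup A / 2 < Sup A" using R0 unfolding A_def by auto
    then obtain R where R: "R \<in> A" "Sup A / 2 < R" using R0 by (metis less_cSupE empty_iff)
    have "2 * R \<notin> A" using R(2) bdd cSup_upper[of "2 * R" A] by linarith
    then have "\<forall>s'\<in>S. \<not> low s' y (2 * R)" using R(1) unfolding A_def by auto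
    then show ?thesis using R(1) Ale[OF R(1)] unfolding A_def by blast
  qed
  then obtain R s where Rs: "\<And>y. y \<in> E \<Longrightarrow> 0 < R y \<and> R y \<le> b - a \<and> s y \<in> S \<and> low (s y) y (R y) \<and>
      (\<forall>s'\<in>S. \<not> low s' y (2 * R y))" by metis
  obtain C where C: "countable C" "C \<subseteq> E"
      "pairwise (\<lambda>i j. disjnt (cball i (R i / 5)) (cball j (R j / 5))) C"
      "E \<subseteq> (\<Union>i\<in>C. cball i (5 * (R i / 5)))"
  proof (rule Vitali_covering_lemma_cballs[where S = E and K = E and a = "\<lambda>y. y" and r = "\<lambda>y. R y / 5" and B = "b - a"])
    show "E \<subseteq> (\<Union>i\<in>E. cball i (R i / 5))" using Rs by fastforce
    show "0 < R i / 5 \<and> R i / 5 \<le> b - a" if "i \<in> E" for i using Rs[OF that] by linarith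
  qed blast
  define N where "N = nondiv_const k d"
  have N0: "N \<ge> 0" using nondiv_const_nonneg k unfolding N_def by auto
  let ?a = "\<lambda>y. max a (y - 2 * R y)" and ?b = "\<lambda>y. min b (y + 2 * R y)"
  let ?S = "\<lambda>y. {W\<in>S. W \<noteq> s y \<and> (W \<subseteq> s y \<or> s y \<subseteq> W)}"
  define P where "P y U \<longleftrightarrow> U \<in> sets borel \<and>
      {x\<in>{?a y..?b y}. \<psi> (s y) x < e \<or> \<not> marked e r \<psi> (?S y) x} \<subseteq> U \<and>
      emeasure lborel U \<le> ennreal (20 * (k + N)) * emeasure lborel (cball y (R y / 5) \<inter> {a..b})" for y U
  have "\<exists>U. P y U" if y: "y \<in> E" for y
  proof -
    have yab: "a \<le> y" "y \<le> b" using y unfolding E_def by auto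
    note Ry = Rs[OF y]
    have high: "\<exists>x\<in>{?a y..?b y}. r \<le> \<psi> s' x" if "s' \<in> S" for s'
    proof -
      have "\<not> low s' y (2 * R y)" using Ry that by blast
      then obtain x where x: "x \<in> {a..b}" "\<bar>x - y\<bar> \<le> 2 * R y" "r \<le> \<psi> s' x"
        unfolding low_def by (auto simp: not_less)
      have "x \<in> {?a y..?b y}" using x(1) abs_le_D1[OF x(2)] abs_le_D2[OF x(2)] by simp
      then show ?thesis using x(3) by blast
    qed
    obtain U1 where U1: "U1 \<in> sets borel" "{x\<in>{?a y..?b y}. \<psi> (s y) x < e} \<subseteq> U1"
      "emeasure lborel U1 \<le> ennreal (k * (?b y - ?a y))"
    proof -
      obtain x where "x \<in> {?a y..?b y}" "r \<le> \<psi> (s y) x" using high Ry by blast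
      then show ?thesis using good[of "s y" "?a y" x "?b y"] Ry that by auto
    qed
    have "\<exists>U\<in>sets borel. {x\<in>{?a y..?b y}. \<not> marked e r \<psi> (?S y) x} \<subseteq> U \<and>
      emeasure lborel U \<le> ennreal (nondiv_const k d * (?b y - ?a y))"
    proof (rule Suc.IH)
      fix F assume F: "F \<subseteq> ?S y" "is_chain F"
      have "is_chain (insert (s y) F)" using F unfolding is_chain_def by blast
      then have "finite (insert (s y) F) \<and> card (insert (s y) F) \<le> Suc d"
        using F Ry by (intro chains) auto
      moreover have "s y \<notin> F" using F by blast
      ultimately show "finite F \<and> card F \<le> d" by auto
    next
      show "?a y < ?b y" using Ry yab ab by auto
    qed (use good cont high in auto)
    then obtain U2 where U2: "U2 \<in> sets borel" "{x\<in>{?a y..?b y}. \<not> marked e r \<psi> (?S y) x} \<subseteq> U2"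
      "emeasure lborel U2 \<le> ennreal (N * (?b y - ?a y))"
      unfolding N_def by blast
    have "emeasure lborel (U1 \<union> U2) \<le> emeasure lborel U1 + emeasure lborel U2"
      using U1 U2 by (intro emeasure_subadditive) auto
    also have "\<dots> \<le> ennreal (k * (?b y - ?a y)) + ennreal (N * (?b y - ?a y))"
      using U1 U2 by (intro add_mono)
    also have "\<dots> = ennreal ((k + N) * (?b y - ?a y))"
      using k N0 Ry yab by (subst ennreal_plus[symmetric]) (auto simp: algebra_simps intro!: mult_left_mono)
    also have "\<dots> \<le> ennreal ((k + N) * (4 * R y))"
      using k N0 by (intro ennreal_leI mult_left_mono) auto
    also have "\<dots> = ennreal (20 * (k + N)) * ennreal (R y / 5)"
    proof -
      have eq: "(k + N) * (4 * R y) = (20 * (k + N)) * (R y / 5)" by simp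
      show ?thesis unfolding eq using k N0 Ry by (intro ennreal_mult) auto
    qed
    also have "\<dots> \<le> ennreal (20 * (k + N)) * emeasure lborel (cball y (R y / 5) \<inter> {a..b})"
      using yab Ry by (intro mult_left_mono interval_ball_measure) auto
    finally have le: "emeasure lborel (U1 \<union> U2) \<le>
      ennreal (20 * (k + N)) * emeasure lborel (cball y (R y / 5) \<inter> {a..b})" .
    have sub: "{x\<in>{?a y..?b y}. \<psi> (s y) x < e \<or> \<not> marked e r \<psi> (?S y) x} \<subseteq> U1 \<union> U2"
      using U1(2) U2(2) by blast
    show ?thesis unfolding P_def
      by (intro exI[of _ "U1 \<union> U2"] conjI sub le sets.Un U1(1) U2(1))
  qed
  then obtain U where PU: "\<And>y. y \<in> E \<Longrightarrow> P y (U y)" by metis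
  note U = PU[unfolded P_def, THEN conjunct1] PU[unfolded P_def, THEN conjunct2, THEN conjunct1]
    PU[unfolded P_def, THEN conjunct2, THEN conjunct2]
  show ?case
  proof (intro bexI[of _ "\<Union>y\<in>C. U y"] conjI subsetI)
    fix x assume x: "x \<in> {x\<in>{a..b}. \<not> marked e r \<psi> S x}"
    have "x \<in> E"
    proof (rule ccontr)
      assume "x \<notin> E"
      then have "\<forall>W\<in>S. r \<le> \<psi> W x" using x unfolding E_def by (auto simp: not_less)
      then have "marked e r \<psi> S x" unfolding marked_def is_chain_def by blast
      then show False using x by blast
    qed
    then obtain y where y: "y \<in> C" "x \<in> cball y (R y)" using C(4) by auto
    then have yE: "y \<in> E" using C(2) by blast
    note Ry = Rs[OF yE]
    have xy: "\<bar>x - y\<bar> \<le> R y" using y(2) by (simp add: dist_real_def abs_minus_commute)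
    then have "\<psi> (s y) x < r" using Ry x unfolding low_def by auto
    moreover have "x \<in> {?a y..?b y}" using x xy Ry by auto
    moreover have "\<psi> (s y) x < e \<or> \<not> marked e r \<psi> (?S y) x"
    proof (rule ccontr)
      assume "\<not> ?thesis"
      then have m: "e \<le> \<psi> (s y) x" "marked e r \<psi> (?S y) x" by (simp_all only: de_Morgan_disj not_less not_not)
      have "marked e r \<psi> S x"
        using Ry \<open>\<psi> (s y) x < r\<close> by (intro marked_insert[OF _ m(1) _ m(2)]) simp_all
      then show False using x by blast
    qed
    ultimately show "x \<in> (\<Union>y\<in>C. U y)" using U(2)[OF yE] y(1) by blast
  next
    have "emeasure lborel (\<Union>y\<in>C. U y) \<le>
      ennreal (20 * (k + N)) * emeasure lborel (\<Union>y\<in>C. cball y (R y / 5) \<inter> {a..b})"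
    proof (rule emeasure_UN_le_disjoint_UN)
      show "disjoint_family_on (\<lambda>y. cball y (R y / 5) \<inter> {a..b}) C"
        using C(3) unfolding disjoint_family_on_def pairwise_def disjnt_def by blast
    qed (use C U in auto)
    also have "emeasure lborel (\<Union>y\<in>C. cball y (R y / 5) \<inter> {a..b}) \<le> emeasure lborel {a..b}"
      using C(1) by (intro emeasure_mono) auto
    also have "emeasure lborel {a..b} = ennreal (b - a)" using ab by simp
    finally have "emeasure lborel (\<Union>y\<in>C. U y) \<le> ennreal (20 * (k + N)) * ennreal (b - a)"
      by (metis mult_left_mono order_trans zero_le)
    also have "\<dots> = ennreal (nondiv_const k (Suc d) * (b - a))"
      using k N0 ab by (subst ennreal_mult[symmetric]) (auto simp: N_def)
    finally show "emeasure lborel (\<Union>y\<in>C. U y) \<le> ennreal (nondiv_const k (Suc d) * (b - a))" .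
  next
    show "(\<Union>y\<in>C. U y) \<in> sets borel" using C U by (intro sets.countable_UN') auto
  qed
qed

section \<open>Minors of the observables\<close>

text \<open>
  The quantities that measure a polynomial \<open>P\<close> at a point \<open>x\<close>: the value, the derivative, and the
  coefficients. All are polynomials in \<open>x\<close>, the coefficients constant ones, so that determinants of them
  are again polynomials with integer coefficients.
\<close>

definition obs :: "nat \<Rightarrow> 'a :: idom poly \<Rightarrow> 'a poly" where
  "obs c P = (if c = 0 then P else if c = 1 then pderiv P else [:coeff P (c - 2):])"

lemma obs_0 [simp]: "obs 0 P = P" and obs_1 [simp]: "obs (Suc 0) P = pderiv P"
  and obs_2 [simp]: "obs (Suc (Suc i)) P = [:coeff P i:]" "obs (2 + i) P = [:coeff P i:]"
  by (simp_all add: obs_def)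

lemma obs_add: "obs c (P + R) = obs c P + obs c R" by (simp add: obs_def pderiv_add)
lemma obs_diff: "obs c (P - R) = obs c P - obs c R" by (simp add: obs_def pderiv_diff)
lemma obs_smult: "obs c (smult a P) = smult a (obs c P)" by (simp add: obs_def pderiv_smult)
lemma obs_zero [simp]: "obs c 0 = 0" by (simp add: obs_def pderiv_0)
lemma obs_sum: "obs c (\<Sum>i\<in>A. f i) = (\<Sum>i\<in>A. obs c (f i))"
  by (induction A rule: infinite_finite_induct) (auto simp: obs_add)
lemma degree_obs_le: "degree (obs c P) \<le> degree P"
  by (auto simp: obs_def degree_pderiv_le[THEN le_trans])

text \<open>
  A list \<open>I\<close> of column indices selects a square submatrix of the matrix of all observables of the
  polynomials in \<open>s\<close>. These minors are the coordinates of the wedge product of \<open>s\<close> at a variable point.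
\<close>

definition minor :: "nat list \<Rightarrow> int poly list \<Rightarrow> int poly" where
  "minor I s = Determinant.det (mat (length s) (length s) (\<lambda>(a, b). obs (I ! b) (s ! a)))"

lemma minor_change_of_basis:
  assumes A: "A \<in> carrier_mat r r" and s: "length s = r" "length t = r"
    and t: "\<And>a. a < r \<Longrightarrow> t ! a = (\<Sum>b<r. smult (A $$ (a, b)) (s ! b))"
  shows "minor I t = [:Determinant.det A:] * minor I s"
proof -
  have hom: "comm_ring_hom (\<lambda>c :: int. [:c:])" by unfold_locales auto
  let ?M = "\<lambda>s. mat r r (\<lambda>(a, b). obs (I ! b) (s ! a)) :: int poly mat"
  have "?M t = map_mat (\<lambda>c. [:c:]) A * ?M s"
  proof (rule eq_matI)
    fix i j assume ij: "i < dim_row (map_mat (\<lambda>c. [:c:]) A * ?M s)" "j < dim_col (map_mat (\<lambda>c. [:c:]) A * ?M s)"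
    then have i: "i < r" "j < r" using A by auto
    have "(map_mat (\<lambda>c. [:c:]) A * ?M s) $$ (i, j) = (\<Sum>b<r. [:A $$ (i, b):] * obs (I ! j) (s ! b))"
      using i A by (auto simp: scalar_prod_def atLeast0LessThan intro!: sum.cong)
    also have "\<dots> = ?M t $$ (i, j)"
      using i by (simp add: t obs_sum obs_smult)
    finally show "?M t $$ (i, j) = (map_mat (\<lambda>c. [:c:]) A * ?M s) $$ (i, j)" by simp
  qed (use A in auto)
  then have "minor I t = Determinant.det (map_mat (\<lambda>c. [:c:]) A * ?M s)"
    unfolding minor_def s by simp
  also have "\<dots> = Determinant.det (map_mat (\<lambda>c. [:c:]) A) * Determinant.det (?M s)"
    using A by (intro det_mult[of _ r]) auto
  also have "Determinant.det (map_mat (\<lambda>c. [:c:]) A) = [:Determinant.det A:]"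
    by (rule comm_ring_hom.hom_det[OF hom])
  finally show ?thesis unfolding minor_def s by simp
qed

text \<open>
  Laplace expansion along the row of the last polynomial.
\<close>

lemma minor_snoc:
  assumes I: "length I = Suc (length s)"
  shows "minor I (s @ [v]) =
    (\<Sum>b\<le>length s. obs (I ! b) v * ((- 1) ^ (length s + b) * minor (take b I @ drop (Suc b) I) s))"
proof -
  let ?j = "length s"
  let ?M = "mat (Suc ?j) (Suc ?j) (\<lambda>(a, b). obs (I ! b) ((s @ [v]) ! a)) :: int poly mat"
  have "minor I (s @ [v]) = Determinant.det ?M" unfolding minor_def by simp
  also have "\<dots> = (\<Sum>b<Suc ?j. ?M $$ (?j, b) * cofactor ?M ?j b)"
    by (intro laplace_expansion_row) auto
  also have "\<dots> = (\<Sum>b\<le>?j. obs (I ! b) v * ((- 1) ^ (?j + b) * minor (take b I @ drop (Suc b) I) s))"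
    unfolding lessThan_Suc_atMost
  proof (intro sum.cong refl)
    fix b assume b: "b \<in> {..?j}"
    have "mat_delete ?M ?j b = mat ?j ?j (\<lambda>(a, c). obs ((take b I @ drop (Suc b) I) ! c) (s ! a))"
      using b I by (intro eq_matI) (auto simp: mat_delete_def nth_append)
    then have "cofactor ?M ?j b = (- 1) ^ (?j + b) * minor (take b I @ drop (Suc b) I) s"
      unfolding cofactor_def minor_def by simp
    then show "?M $$ (?j, b) * cofactor ?M ?j b =
      obs (I ! b) v * ((- 1) ^ (?j + b) * minor (take b I @ drop (Suc b) I) s)" using b by simp
  qed
  finally show ?thesis .
qed

lemma minor_Nil [simp]: "minor [] [] = 1" by (simp add: minor_def)

lemma minor_single: "minor [c] [p] = obs c p"
  using minor_snoc[of "[c]" "[]" p] by simp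

lemma degree_minor_le:
  assumes "\<And>v. v \<in> set s \<Longrightarrow> degree v \<le> n" "length I = length s"
  shows "degree (minor I s) \<le> length s * n"
  using assms
proof (induction s arbitrary: I rule: rev_induct)
  case Nil
  then show ?case by (simp add: minor_def)
next
  case (snoc v s)
  have I: "length I = Suc (length s)" using snoc.prems by simp
  have "degree (obs (I ! b) v * ((- 1) ^ (length s + b) * minor (take b I @ drop (Suc b) I) s)) \<le> n + length s * n"
    if b: "b \<le> length s" for b
  proof -
    have "degree (obs (I ! b) v) \<le> n" by (rule le_trans[OF degree_obs_le]) (simp add: snoc.prems)
    moreover have "degree (minor (take b I @ drop (Suc b) I) s) \<le> length s * n"
      using snoc.prems I b by (intro snoc.IH) auto
    moreover have "degree ((- 1) ^ k * q) = degree q" for k and q :: "int poly"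
      by (cases "even k") auto
    ultimately show ?thesis using degree_mult_le
      by (metis (no_types, lifting) add_mono_thms_linordered_semiring(1) le_trans)
  qed
  then show ?case unfolding minor_snoc[OF I] by (intro degree_sum_le) auto
qed

definition col_lists :: "nat \<Rightarrow> nat \<Rightarrow> nat list set" where
  "col_lists m j = {I. set I \<subseteq> {..<m} \<and> length I = j}"

lemma col_lists_finite [simp]: "finite (col_lists m j)"
  unfolding col_lists_def by (rule finite_lists_length_eq) simp

lemma col_lists_nonempty: "m > 0 \<Longrightarrow> col_lists m j \<noteq> {}"
proof -
  assume "m > 0"
  then have "replicate j 0 \<in> col_lists m j" by (auto simp: col_lists_def set_replicate_conv_if)
  then show ?thesis by blast
qed

definition weighted_minor :: "(nat \<Rightarrow> real) \<Rightarrow> nat list \<Rightarrow> int poly list \<Rightarrow> real poly" where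
  "weighted_minor w I s = smult (prod_list (map w I)) (of_int_poly (minor I s))"

text \<open>
  The maximum norm of the wedge product of \<open>s\<close> at \<open>x\<close>, with the observable number \<open>c\<close> weighted by
  \<open>w c\<close>. Up to constants it is the covolume of the lattice spanned by \<open>s\<close>; the maximum, unlike the
  Euclidean norm, consists of absolute values of polynomials.
\<close>

definition covolume :: "nat \<Rightarrow> (nat \<Rightarrow> real) \<Rightarrow> int poly list \<Rightarrow> real \<Rightarrow> real" where
  "covolume m w s x = Max ((\<lambda>I. \<bar>poly (weighted_minor w I s) x\<bar>) ` col_lists m (length s))"

lemma covolume_ge: "I \<in> col_lists m (length s) \<Longrightarrow> \<bar>poly (weighted_minor w I s) x\<bar> \<le> covolume m w s x"
  unfolding covolume_def by (intro Max_ge) auto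

lemma covolume_attained:
  assumes "m > 0" obtains I where "I \<in> col_lists m (length s)" "covolume m w s x = \<bar>poly (weighted_minor w I s) x\<bar>"
proof -
  have "covolume m w s x \<in> (\<lambda>I. \<bar>poly (weighted_minor w I s) x\<bar>) ` col_lists m (length s)"
    unfolding covolume_def using col_lists_nonempty[OF assms] by (intro Max_in) auto
  then show ?thesis using that by auto
qed

lemma covolume_less_iff:
  "m > 0 \<Longrightarrow> covolume m w s x < r \<longleftrightarrow> (\<forall>I\<in>col_lists m (length s). \<bar>poly (weighted_minor w I s) x\<bar> < r)"
  unfolding covolume_def using col_lists_nonempty by (subst Max_less_iff) auto

lemma open_covolume_less: "m > 0 \<Longrightarrow> open {x. covolume m w s x < r}"
proof -
  assume m: "m > 0"
  have "{x. covolume m w s x < r} = (\<Inter>I\<in>col_lists m (length s). {x. \<bar>poly (weighted_minor w I s) x\<bar> < r})"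
    using covolume_less_iff[OF m] by auto
  then show ?thesis
    by (auto intro!: open_INT open_Collect_less continuous_intros)
qed

text \<open>
  Submultiplicativity: adding one vector multiplies the covolume by at most a constant times the
  norm \<open>N\<close> of this vector. The hypothesis on \<open>N\<close> says that the weighted observables of \<open>v\<close> are at most \<open>N\<close>.
\<close>

lemma covolume_snoc_le:
  assumes m: "m > 0" and w: "\<And>c. w c \<ge> 0"
    and N: "\<And>c. c < m \<Longrightarrow> w c * \<bar>poly (of_int_poly (obs c v)) x\<bar> \<le> N"
  shows "covolume m w (s @ [v]) x \<le> real (Suc (length s)) * N * covolume m w s x"
proof -
  obtain I where I: "I \<in> col_lists m (length (s @ [v]))" "covolume m w (s @ [v]) x = \<bar>poly (weighted_minor w I (s @ [v])) x\<bar>"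
    using covolume_attained[OF m] by blast
  have len: "length I = Suc (length s)" using I(1) by (simp add: col_lists_def)
  let ?I = "\<lambda>b. take b I @ drop (Suc b) I"
  let ?e = "\<lambda>p. poly (of_int_poly p :: real poly) x"
  have N0: "N \<ge> 0" using N[OF m] w[of 0] by (meson abs_ge_zero mult_nonneg_nonneg order_trans)
  have summand: "\<bar>prod_list (map w I) * (?e (obs (I ! b) v) * ((- 1) ^ (length s + b) * ?e (minor (?I b) s)))\<bar>
      \<le> N * covolume m w s x" if b: "b \<le> length s" for b
  proof -
    have bI: "b < length I" using b len by simp
    have "prod_list (map w I) = w (I ! b) * prod_list (map w (?I b))"
      by (subst id_take_nth_drop[OF bI]) (simp add: mult_ac)
    then have "\<bar>prod_list (map w I) * (?e (obs (I ! b) v) * ((- 1) ^ (length s + b) * ?e (minor (?I b) s)))\<bar>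
      = (w (I ! b) * \<bar>?e (obs (I ! b) v)\<bar>) * \<bar>poly (weighted_minor w (?I b) s) x\<bar>"
      using w[of "I ! b"] by (simp add: weighted_minor_def abs_mult power_abs)
    also have "\<dots> \<le> N * covolume m w s x"
    proof (intro mult_mono N0)
      show "w (I ! b) * \<bar>?e (obs (I ! b) v)\<bar> \<le> N"
        using I(1) nth_mem[OF bI] by (intro N) (auto simp: col_lists_def)
      show "\<bar>poly (weighted_minor w (?I b) s) x\<bar> \<le> covolume m w s x"
        using I(1) bI len by (intro covolume_ge)
          (auto simp: col_lists_def dest: in_set_takeD in_set_dropD)
    qed auto
    finally show ?thesis .
  qed
  have "poly (weighted_minor w I (s @ [v])) x =
     (\<Sum>b\<le>length s. prod_list (map w I) * (?e (obs (I ! b) v) * ((- 1) ^ (length s + b) * ?e (minor (?I b) s))))"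
    unfolding weighted_minor_def minor_snoc[OF len]
    by (simp add: of_int_poly_hom.hom_sum of_int_poly_hom.hom_mult of_int_poly_hom.hom_power
        of_int_poly_hom.hom_uminus poly_sum sum_distrib_left)
  then have "covolume m w (s @ [v]) x \<le>
     (\<Sum>b\<le>length s. \<bar>prod_list (map w I) * (?e (obs (I ! b) v) * ((- 1) ^ (length s + b) * ?e (minor (?I b) s)))\<bar>)"
    unfolding I(2) by (simp only: sum_abs)
  also have "\<dots> \<le> (\<Sum>b\<le>length s. N * covolume m w s x)" using summand by (intro sum_mono) auto
  also have "\<dots> = real (Suc (length s)) * N * covolume m w s x" by simp
  finally show ?thesis .
qed

text \<open>
  The minors of \<open>t\<close> are those of \<open>s\<close> times the determinant of \<open>A\<close>, a nonzero integer.
\<close>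

lemma covolume_change_of_basis:
  assumes m: "m > 0" and A: "A \<in> carrier_mat r r" and s: "length s = r" "length t = r"
    and t: "\<And>a. a < r \<Longrightarrow> t ! a = (\<Sum>b<r. smult (A $$ (a, b)) (s ! b))"
    and det: "Determinant.det A \<noteq> 0"
  shows "covolume m w s x \<le> covolume m w t x"
proof -
  obtain I where I: "I \<in> col_lists m (length s)" "covolume m w s x = \<bar>poly (weighted_minor w I s) x\<bar>"
    using covolume_attained[OF m] by blast
  have mt: "minor I t = [:Determinant.det A:] * minor I s" by (rule minor_change_of_basis[OF A s t])
  have "\<bar>poly (weighted_minor w I t) x\<bar> = \<bar>of_int (Determinant.det A)\<bar> * \<bar>poly (weighted_minor w I s) x\<bar>"
    unfolding weighted_minor_def mt
    by (simp add: abs_mult of_int_poly_hom.hom_mult of_int_hom.map_poly_hom_smult)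
  moreover have "\<bar>of_int (Determinant.det A) :: real\<bar> \<ge> 1" using det by linarith
  ultimately have "\<bar>poly (weighted_minor w I s) x\<bar> \<le> \<bar>poly (weighted_minor w I t) x\<bar>"
    by (metis abs_ge_zero mult_right_mono mult_1)
  also have "\<dots> \<le> covolume m w t x" using I(1) s by (intro covolume_ge) simp
  finally show ?thesis unfolding I(2) .
qed

text \<open>
  The leading terms of the two products do not cancel, because the degrees differ.
\<close>

lemma wronskian_nonzero:
  fixes p q :: "int poly"
  assumes "p \<noteq> 0" "q \<noteq> 0" "degree p < degree q"
  shows "p * pderiv q - q * pderiv p \<noteq> 0"
proof -
  obtain e where e: "degree q = Suc e" using assms by (cases "degree q") auto
  have dq: "degree (pderiv q) = e" using e by (simp add: degree_pderiv)
  have c1: "coeff (p * pderiv q) (degree p + e) = lead_coeff p * (int (degree q) * lead_coeff q)"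
    using coeff_mult_degree_sum[of p "pderiv q"] dq e by (simp add: coeff_pderiv)
  have c2: "coeff (q * pderiv p) (degree p + e) = lead_coeff q * (int (degree p) * lead_coeff p)"
  proof (cases "degree p")
    case 0
    then have "pderiv p = 0" by (simp add: pderiv_eq_0_iff)
    then show ?thesis using 0 by simp
  next
    case (Suc f)
    have "degree (pderiv p) = f" using Suc by (simp add: degree_pderiv)
    then show ?thesis using coeff_mult_degree_sum[of q "pderiv p"] Suc e by (simp add: coeff_pderiv add.commute)
  qed
  have "coeff (p * pderiv q - q * pderiv p) (degree p + e) =
      (int (degree q) - int (degree p)) * lead_coeff p * lead_coeff q"
    by (simp only: coeff_diff c1 c2) (simp add: algebra_simps)
  then have "coeff (p * pderiv q - q * pderiv p) (degree p + e) \<noteq> 0" using assms by simp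
  then show ?thesis by (metis coeff_0)
qed

definition echelon :: "int poly list \<Rightarrow> bool" where
  "echelon s \<longleftrightarrow> 0 \<notin> set s \<and> sorted_wrt (\<lambda>p q. degree p < degree q) s"

lemma echelon_snoc:
  "echelon (s @ [v]) \<longleftrightarrow> echelon s \<and> v \<noteq> 0 \<and> (\<forall>u\<in>set s. degree u < degree v)"
  unfolding echelon_def by (auto simp: sorted_wrt_append)

text \<open>
  For every polynomial after the first two, the column with the coefficient at its own degree is chosen.
  In such a column all earlier polynomials have the entry zero, so the determinant is the Wronskian of \<open>p\<close> and \<open>q\<close>
  times leading coefficients.
\<close>

lemma minor_echelon_nonzero:
  assumes "echelon (p # q # s)"
  shows "minor (0 # 1 # map (\<lambda>v. 2 + degree v) s) (p # q # s) \<noteq> 0"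
  using assms
proof (induction s rule: rev_induct)
  case Nil
  have "minor [0, 1] ([p] @ [q]) = pderiv q * p - q * pderiv p"
    by (subst minor_snoc) (auto simp: minor_single)
  then show ?case using wronskian_nonzero[of p q] Nil by (auto simp: echelon_def mult.commute)
next
  case (snoc v s)
  let ?s = "p # q # s" and ?I = "0 # 1 # map (\<lambda>v. 2 + degree v) s"
  have e: "echelon ?s" "v \<noteq> 0" "\<forall>u\<in>set ?s. degree u < degree v"
    using snoc.prems echelon_snoc[of ?s v] by auto
  have snoc_nth: "(xs @ [u]) ! a = (if a = length xs then u else xs ! a)" if "a < Suc (length xs)"
    for xs :: "'b list" and u a using that by (auto simp: nth_append)
  let ?j = "length ?s"
  let ?M = "mat (Suc ?j) (Suc ?j) (\<lambda>(a, b). obs ((?I @ [2 + degree v]) ! b) ((?s @ [v]) ! a)) :: int poly mat"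
  have col: "?M $$ (a, ?j) = (if a = ?j then [:lead_coeff v:] else 0)" if "a < Suc ?j" for a
  proof -
    have "(?I @ [2 + degree v]) ! ?j = 2 + degree v" by (subst nth_append) simp
    moreover have "(?s @ [v]) ! a = (if a = ?j then v else ?s ! a)" using that by (rule snoc_nth)
    moreover have "coeff (?s ! a) (degree v) = 0" if "a < ?j"
      using e(3) that by (intro coeff_eq_0) (metis nth_mem)
    ultimately show ?thesis using that by (cases "a = ?j") (simp_all only: index_mat split: if_splits, simp_all)
  qed
  have "minor (?I @ [2 + degree v]) (?s @ [v]) = Determinant.det ?M" unfolding minor_def by simp
  also have "\<dots> = (\<Sum>a<Suc ?j. ?M $$ (a, ?j) * cofactor ?M a ?j)"
    by (intro laplace_expansion_column) auto
  also have "\<dots> = (\<Sum>a<Suc ?j. if a = ?j then [:lead_coeff v:] * cofactor ?M a ?j else 0)"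
    by (intro sum.cong refl) (use col in auto)
  also have "\<dots> = [:lead_coeff v:] * cofactor ?M ?j ?j" by simp
  also have "mat_delete ?M ?j ?j = mat ?j ?j (\<lambda>(a, b). obs (?I ! b) (?s ! a))"
  proof (rule eq_matI)
    fix a b assume "a < dim_row (mat ?j ?j (\<lambda>(a, b). obs (?I ! b) (?s ! a)))"
      "b < dim_col (mat ?j ?j (\<lambda>(a, b). obs (?I ! b) (?s ! a)))"
    then have ab: "a < ?j" "b < ?j" by auto
    have "(?I @ [2 + degree v]) ! b = ?I ! b" "(?s @ [v]) ! a = ?s ! a"
      using ab snoc_nth[of b ?I] snoc_nth[of a ?s v] by (simp_all only: length_map length_Cons) auto
    then show "mat_delete ?M ?j ?j $$ (a, b) = mat ?j ?j (\<lambda>(a, b). obs (?I ! b) (?s ! a)) $$ (a, b)"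
      using ab by (simp add: mat_delete_def del: length_Cons append_Cons)
  qed auto
  then have "cofactor ?M ?j ?j = minor ?I ?s" unfolding cofactor_def minor_def by (simp add: mult_2[symmetric])
  finally show ?case using snoc.IH e by simp
qed

section \<open>Saturated lattices of integer polynomials\<close>

text \<open>
  The primitive sublattices of the integer polynomials of degree at most \<open>n\<close>, that is, their
  intersections with rational subspaces.
\<close>

definition saturated :: "nat \<Rightarrow> int poly set \<Rightarrow> bool" where
  "saturated n W \<longleftrightarrow> 0 \<in> W \<and> (\<forall>u\<in>W. \<forall>v\<in>W. u + v \<in> W) \<and> (\<forall>c. \<forall>v\<in>W. smult c v \<in> W) \<and>
     (\<forall>c v. c \<noteq> 0 \<longrightarrow> smult c v \<in> W \<longrightarrow> v \<in> W) \<and> (\<forall>v\<in>W. degree v \<le> n)"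

lemma saturatedD:
  assumes "saturated n W"
  shows "0 \<in> W" "u \<in> W \<Longrightarrow> v \<in> W \<Longrightarrow> u + v \<in> W" "v \<in> W \<Longrightarrow> smult c v \<in> W"
    "c \<noteq> 0 \<Longrightarrow> smult c v \<in> W \<Longrightarrow> v \<in> W" "v \<in> W \<Longrightarrow> degree v \<le> n"
  using assms unfolding saturated_def by blast+

lemma saturated_diff: "saturated n W \<Longrightarrow> u \<in> W \<Longrightarrow> v \<in> W \<Longrightarrow> u - v \<in> W"
  using saturatedD(2)[of n W u "smult (- 1) v"] saturatedD(3)[of n W v "- 1"] by simp

lemma saturated_sum: "saturated n W \<Longrightarrow> (\<And>i. i \<in> A \<Longrightarrow> f i \<in> W) \<Longrightarrow> (\<Sum>i\<in>A. f i) \<in> W"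
  by (induction A rule: infinite_finite_induct) (auto simp: saturatedD)

text \<open>
  The number of degrees that occur in a saturated lattice is its rank.
\<close>

definition degs :: "int poly set \<Rightarrow> nat set" where
  "degs W = degree ` (W - {0})"

lemma degs_subset: "saturated n W \<Longrightarrow> degs W \<subseteq> {..n}"
  unfolding degs_def using saturatedD(5) by auto

lemma finite_degs: "saturated n W \<Longrightarrow> finite (degs W)"
  using degs_subset finite_subset by blast

lemma degs_mono: "W \<subseteq> V \<Longrightarrow> degs W \<subseteq> degs V"
  unfolding degs_def by auto

lemma degree_diff_less:
  fixes p q :: "'a :: ab_group_add poly"
  assumes "degree p = degree q" "lead_coeff p = lead_coeff q"
  shows "p = q \<or> degree (p - q) < degree p"
proof (rule disjCI)
  assume "\<not> degree (p - q) < degree p"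
  moreover have "degree (p - q) \<le> degree p" using assms by (intro degree_diff_le) auto
  ultimately have "degree (p - q) = degree p" by simp
  moreover have "coeff (p - q) (degree p) = 0" using assms by simp
  ultimately have "lead_coeff (p - q) = 0" by simp
  then have "p - q = 0" using leading_coeff_0_iff by blast
  then show "p = q" by simp
qed

text \<open>
  Cancelling leading terms against an element of \<open>W\<close> of the same degree lowers the degree of a multiple of
  \<open>v\<close>, and saturation allows division by the multiplier.
\<close>

lemma saturated_eq:
  assumes W: "saturated n W" and V: "saturated n V" and sub: "W \<subseteq> V" and degs: "degs W = degs V"
  shows "W = V"
proof (rule antisym[OF sub], rule subsetI)
  fix v assume "v \<in> V"
  then show "v \<in> W"
  proof (induction "degree v" arbitrary: v rule: less_induct)
    case less
    show ?case
    proof (cases "v = 0")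
      case False
      then have "degree v \<in> degs W" using less(2) unfolding degs unfolding degs_def by blast
      then obtain w where w: "w \<in> W" "w \<noteq> 0" "degree w = degree v" unfolding degs_def by fastforce
      define k where "k = lead_coeff w"
      have k: "k \<noteq> 0" using w(2) by (simp add: k_def)
      let ?p = "smult k v" and ?q = "smult (lead_coeff v) w"
      have "?p = ?q \<or> degree (?p - ?q) < degree ?p"
        using w False k by (intro degree_diff_less) (auto simp: k_def)
      moreover have "?p - ?q \<in> V"
        using less(2) w sub by (intro saturated_diff[OF V] saturatedD(3)[OF V]) auto
      ultimately have "?p - ?q \<in> W"
        using less(1)[of "?p - ?q"] k saturatedD(1)[OF W] by auto
      then have "(?p - ?q) + ?q \<in> W" using w W by (intro saturatedD(2)[OF W] saturatedD(3)[OF W]) auto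
      then have "?p \<in> W" by simp
      then show ?thesis using saturatedD(4)[OF W k] by simp
    qed (use W saturatedD in auto)
  qed
qed

text \<open>
  Along a chain the rank determines the lattice, and the rank is at most \<open>n + 1\<close>.
\<close>

lemma saturated_chain:
  assumes F: "\<And>W. W \<in> F \<Longrightarrow> saturated n W" and ch: "is_chain F"
  shows "finite F \<and> card F \<le> n + 2"
proof -
  have inj: "inj_on (\<lambda>W. card (degs W)) F"
  proof (rule inj_onI)
    have *: "W = V" if "W \<in> F" "V \<in> F" "W \<subseteq> V" "card (degs W) = card (degs V)" for W V
      using that F finite_degs degs_mono by (intro saturated_eq[of n] card_subset_eq) auto
    fix W V assume "W \<in> F" "V \<in> F" "card (degs W) = card (degs V)"
    then show "W = V" using * ch unfolding is_chain_def by metis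
  qed
  have "(\<lambda>W. card (degs W)) ` F \<subseteq> {..n + 1}"
  proof (intro image_subsetI)
    fix W assume "W \<in> F"
    then have "card (degs W) \<le> card {..n}" using F degs_subset by (intro card_mono) auto
    then show "card (degs W) \<in> {..n + 1}" by simp
  qed
  then show ?thesis using inj card_inj_on_le[of _ F "{..n+1}"] inj_on_finite[of _ F "{..n+1}"] by auto
qed

text \<open>
  Elements with minimal leading coefficient in each degree form a basis over the integers, by
  division with remainder of the leading coefficients.
\<close>

definition min_elt :: "int poly set \<Rightarrow> nat \<Rightarrow> int poly" where
  "min_elt W d = (ARG_MIN (\<lambda>v. nat \<bar>lead_coeff v\<bar>) v. v \<in> W \<and> v \<noteq> 0 \<and> degree v = d)"

lemma min_elt:
  assumes "d \<in> degs W"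
  shows "min_elt W d \<in> W" "min_elt W d \<noteq> 0" "degree (min_elt W d) = d"
    "u \<in> W \<Longrightarrow> u \<noteq> 0 \<Longrightarrow> degree u = d \<Longrightarrow> \<bar>lead_coeff (min_elt W d)\<bar> \<le> \<bar>lead_coeff u\<bar>"
proof -
  obtain v where v: "v \<in> W \<and> v \<noteq> 0 \<and> degree v = d" using assms unfolding degs_def by auto
  note * = arg_min_nat_lemma[of "\<lambda>v. v \<in> W \<and> v \<noteq> 0 \<and> degree v = d" v "\<lambda>v. nat \<bar>lead_coeff v\<bar>",
      OF v, folded min_elt_def]
  show "min_elt W d \<in> W" "min_elt W d \<noteq> 0" "degree (min_elt W d) = d" using * by auto
  show "\<bar>lead_coeff (min_elt W d)\<bar> \<le> \<bar>lead_coeff u\<bar>" if "u \<in> W" "u \<noteq> 0" "degree u = d"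
    using * that by (auto simp: nat_le_eq_zle)
qed

lemma min_elt_spans:
  assumes W: "saturated n W" and v: "v \<in> W"
  shows "\<exists>c. v = (\<Sum>d\<in>degs W. smult (c d) (min_elt W d))"
  using v
proof (induction "degree v" arbitrary: v rule: less_induct)
  case less
  show ?case
  proof (cases "v = 0")
    case True
    then show ?thesis by (intro exI[of _ "\<lambda>_. 0"]) auto
  next
    case False
    define d where "d = degree v"
    have d: "d \<in> degs W" using False less(2) unfolding d_def degs_def by blast
    define b where "b = min_elt W d"
    note b = min_elt[OF d, folded b_def]
    define q where "q = lead_coeff v div lead_coeff b"
    define u where "u = v - smult q b"
    have uW: "u \<in> W" unfolding u_def using less(2) b(1) W by (intro saturated_diff[of n] saturatedD(3)[of n])
    have du: "degree u \<le> d" unfolding u_def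
      using b(3) by (intro degree_diff_le) (auto simp: d_def)
    have cu: "coeff u d = lead_coeff v mod lead_coeff b"
      unfolding u_def q_def using b(3) by (simp add: d_def minus_div_mult_eq_mod)
    have "u = 0 \<or> degree u < d"
    proof (rule ccontr)
      assume "\<not> ?thesis"
      then have u: "u \<noteq> 0" "degree u = d" using du by auto
      then have "\<bar>lead_coeff b\<bar> \<le> \<bar>lead_coeff v mod lead_coeff b\<bar>"
        using b(4)[OF uW] cu by simp
      moreover have "lead_coeff b \<noteq> 0" using b(2) by simp
      ultimately show False using abs_mod_less[of "lead_coeff b" "lead_coeff v"] by linarith
    qed
    then obtain c where c: "u = (\<Sum>d\<in>degs W. smult (c d) (min_elt W d))"
      using less(1)[of u] uW d_def by (cases "u = 0") (auto intro: that[of "\<lambda>_. 0"])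
    have "v = u + smult q b" unfolding u_def by simp
    also have "\<dots> = (\<Sum>e\<in>degs W. smult (c e) (min_elt W e)) + (\<Sum>e\<in>degs W. smult (if e = d then q else 0) (min_elt W e))"
      using d finite_degs[OF W] by (simp add: c b_def if_distrib[of "\<lambda>c. smult c _"] sum.delta cong: if_cong)
    also have "\<dots> = (\<Sum>e\<in>degs W. smult (c e + (if e = d then q else 0)) (min_elt W e))"
      by (simp add: sum.distrib[symmetric] smult_add_left)
    finally show ?thesis by (rule exI[of _ "\<lambda>e. c e + (if e = d then q else 0)"])
  qed
qed

definition basis :: "int poly set \<Rightarrow> int poly list" where
  "basis W = map (min_elt W) (sorted_list_of_set (degs W))"

lemma length_basis: "length (basis W) = card (degs W)"
  unfolding basis_def by simp

lemma set_basis: "saturated n W \<Longrightarrow> set (basis W) = min_elt W ` degs W"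
  unfolding basis_def using finite_degs by simp

lemma basis_in: "saturated n W \<Longrightarrow> v \<in> set (basis W) \<Longrightarrow> v \<in> W"
  using set_basis min_elt(1) by auto

lemma echelon_basis: "saturated n W \<Longrightarrow> echelon (basis W)"
proof -
  assume W: "saturated n W"
  have "sorted_wrt (<) (sorted_list_of_set (degs W))" by (rule strict_sorted_list_of_set)
  then have "sorted_wrt (\<lambda>d e. degree (min_elt W d) < degree (min_elt W e)) (sorted_list_of_set (degs W))"
    by (rule sorted_wrt_mono_rel[rotated]) (use W finite_degs min_elt(3) in auto)
  then show ?thesis unfolding echelon_def set_basis[OF W]
    using min_elt(2) by (auto simp: basis_def sorted_wrt_map)
qed

lemma basis_spans:
  assumes W: "saturated n W" and v: "v \<in> W"
  shows "\<exists>c. v = (\<Sum>b<length (basis W). smult (c b) (basis W ! b))"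
proof -
  obtain c where c: "v = (\<Sum>d\<in>degs W. smult (c d) (min_elt W d))" using min_elt_spans[OF W v] by blast
  let ?l = "sorted_list_of_set (degs W)"
  have "v = (\<Sum>d\<in>set ?l. smult (c d) (min_elt W d))" using c finite_degs[OF W] by simp
  also have "\<dots> = (\<Sum>d\<leftarrow>?l. smult (c d) (min_elt W d))"
    by (intro sum.distinct_set_conv_list) simp
  also have "\<dots> = (\<Sum>b<length (basis W). smult (c (?l ! b)) (basis W ! b))"
    by (simp add: sum_list_sum_nth basis_def atLeast0LessThan)
  finally show ?thesis by (intro exI[of _ "\<lambda>b. c (?l ! b)"])
qed

lemma echelon_independent:
  assumes "echelon s" "(\<Sum>a<length s. smult (c a) (s ! a)) = 0" "a < length s"
  shows "c a = 0"
  using assms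
proof (induction s arbitrary: a rule: rev_induct)
  case (snoc v s)
  have e: "echelon s" "v \<noteq> 0" "\<And>u. u \<in> set s \<Longrightarrow> degree u < degree v"
    using snoc.prems(1) unfolding echelon_snoc by auto
  have nth: "(s @ [v]) ! b = s ! b" if "b < length s" for b using that by (simp add: nth_append)
  have eq: "(\<Sum>a<length s. smult (c a) (s ! a)) + smult (c (length s)) v = 0"
    using snoc.prems(2) nth by simp
  have "coeff (\<Sum>a<length s. smult (c a) (s ! a)) (degree v) = 0"
    unfolding coeff_sum using e(3) by (intro sum.neutral) (auto intro: coeff_eq_0)
  then have "c (length s) * lead_coeff v = 0"
    using arg_cong[OF eq, of "\<lambda>p. coeff p (degree v)"] by simp
  then have c: "c (length s) = 0" using e(2) by simp
  then have "(\<Sum>a<length s. smult (c a) (s ! a)) = 0" using eq by simp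
  then show ?case using snoc.IH[OF e(1)] snoc.prems(3) c by (cases "a = length s") auto
qed simp

text \<open>
  The saturation of \<open>W + \<int> v\<close>.
\<close>

definition adjoin :: "int poly set \<Rightarrow> int poly \<Rightarrow> int poly set" where
  "adjoin W v = {u. \<exists>m l. m \<noteq> 0 \<and> smult m u - smult l v \<in> W}"

lemma adjoin_subset: "saturated n V \<Longrightarrow> W \<subseteq> V \<Longrightarrow> v \<in> V \<Longrightarrow> adjoin W v \<subseteq> V"
proof
  fix u assume V: "saturated n V" "W \<subseteq> V" "v \<in> V" and u: "u \<in> adjoin W v"
  obtain m l where ml: "m \<noteq> 0" "smult m u - smult l v \<in> W" using u unfolding adjoin_def by blast
  then have "(smult m u - smult l v) + smult l v \<in> V"
    using V by (intro saturatedD(2)[OF V(1)] saturatedD(3)[OF V(1)]) auto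
  then show "u \<in> V" using saturatedD(4)[OF V(1) ml(1)] by simp
qed

lemma subset_adjoin: "W \<subseteq> adjoin W v"
proof
  fix u assume "u \<in> W"
  then show "u \<in> adjoin W v" unfolding adjoin_def by (intro CollectI exI[of _ 1] exI[of _ 0]) auto
qed

lemma in_adjoin: "saturated n W \<Longrightarrow> v \<in> adjoin W v"
  unfolding adjoin_def using saturatedD(1) by (intro CollectI exI[of _ 1]) auto

lemma saturated_adjoin:
  assumes W: "saturated n W" and v: "degree v \<le> n"
  shows "saturated n (adjoin W v)"
  unfolding saturated_def
proof (intro conjI ballI allI impI)
  show "0 \<in> adjoin W v" using subset_adjoin saturatedD(1)[OF W] by blast
next
  fix u u' assume "u \<in> adjoin W v" "u' \<in> adjoin W v"
  then obtain m l m' l' where ml: "m \<noteq> 0" "smult m u - smult l v \<in> W" "m' \<noteq> 0" "smult m' u' - smult l' v \<in> W"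
    unfolding adjoin_def by blast
  have "smult m' (smult m u - smult l v) + smult m (smult m' u' - smult l' v) \<in> W"
    using ml W by (intro saturatedD(2)[OF W] saturatedD(3)[OF W])
  also have "smult m' (smult m u - smult l v) + smult m (smult m' u' - smult l' v) =
    smult (m * m') (u + u') - smult (m' * l + m * l') v"
    by (simp add: smult_diff_right smult_add_right smult_add_left mult_ac)
  finally show "u + u' \<in> adjoin W v" unfolding adjoin_def using ml by (intro CollectI exI[of _ "m * m'"] exI[of _ "m' * l + m * l'"]) auto
next
  fix c u assume "u \<in> adjoin W v"
  then obtain m l where ml: "m \<noteq> 0" "smult m u - smult l v \<in> W" unfolding adjoin_def by blast
  have "smult c (smult m u - smult l v) \<in> W" using ml W by (intro saturatedD(3)[OF W])
  also have "smult c (smult m u - smult l v) = smult m (smult c u) - smult (c * l) v"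
    by (simp add: smult_diff_right mult_ac)
  finally show "smult c u \<in> adjoin W v" unfolding adjoin_def using ml by blast
next
  fix c u assume c: "c \<noteq> 0" "smult c u \<in> adjoin W v"
  then obtain m l where ml: "m \<noteq> 0" "smult m (smult c u) - smult l v \<in> W" unfolding adjoin_def by blast
  then show "u \<in> adjoin W v" unfolding adjoin_def using c(1)
    by (intro CollectI exI[of _ "m * c"] exI[of _ l]) auto
next
  fix u assume "u \<in> adjoin W v"
  then obtain m l where ml: "m \<noteq> 0" "smult m u - smult l v \<in> W" unfolding adjoin_def by blast
  have "degree ((smult m u - smult l v) + smult l v) \<le> n"
    using saturatedD(5)[OF W ml(2)] v by (intro degree_add_le) (auto intro: order_trans[OF degree_smult_le])
  then show "degree u \<le> n" using ml(1) by simp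
qed

text \<open>
  Among all elements that involve \<open>v\<close>, take one, \<open>u\<close>, of least degree. No element of \<open>W\<close> has the
  degree of \<open>u\<close>, since cancelling leading terms would give an element of smaller degree. Up
  to multiples the new lattice consists of the sums of an element of \<open>W\<close> and a multiple of \<open>u\<close>.
\<close>

lemma card_degs_adjoin:
  assumes W: "saturated n W" and v: "degree v \<le> n" "v \<notin> W"
  shows "card (degs (adjoin W v)) = Suc (card (degs W))"
proof -
  define A where "A = {u. \<exists>m l. l \<noteq> 0 \<and> smult m u - smult l v \<in> W \<and> m \<noteq> 0}"
  have nW: "u \<notin> W" if uA: "u \<in> A" for u
  proof
    assume u: "u \<in> W"
    obtain m l where ml: "l \<noteq> 0" "smult m u - smult l v \<in> W" using uA unfolding A_def by blast
    have "smult m u - (smult m u - smult l v) \<in> W"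
      by (rule saturated_diff[OF W saturatedD(3)[OF W u] ml(2)])
    then show False using saturatedD(4)[OF W ml(1)] v by simp
  qed
  have "v \<in> A" unfolding A_def using saturatedD(1)[OF W] by (intro CollectI exI[of _ 1]) auto
  then obtain u where u: "u \<in> A" "\<And>u'. u' \<in> A \<Longrightarrow> degree u \<le> degree u'"
    using ex_has_least_nat[of "\<lambda>u. u \<in> A" v degree] by blast
  have u0: "u \<noteq> 0" using nW[OF u(1)] saturatedD(1)[OF W] by auto
  obtain m0 l0 where ml0: "l0 \<noteq> 0" "smult m0 u - smult l0 v \<in> W" "m0 \<noteq> 0" using u(1) unfolding A_def by auto
  have low: "degree u \<le> degree (smult m u - w)" if "w \<in> W" "m \<noteq> 0" for w m
  proof (rule u(2))
    have "smult m (smult m0 u - smult l0 v) - smult m0 w \<in> W"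
      by (rule saturated_diff[OF W saturatedD(3)[OF W ml0(2)] saturatedD(3)[OF W that(1)]])
    also have "smult m (smult m0 u - smult l0 v) - smult m0 w = smult m0 (smult m u - w) - smult (m * l0) v"
      by (simp add: smult_diff_right mult_ac)
    finally show "smult m u - w \<in> A" unfolding A_def using ml0 that by (intro CollectI exI[of _ m0] exI[of _ "m * l0"]) auto
  qed
  have e: "degree u \<notin> degs W"
  proof
    assume "degree u \<in> degs W"
    then obtain w where w: "w \<in> W" "w \<noteq> 0" "degree w = degree u" unfolding degs_def by fastforce
    define k where "k = lead_coeff w"
    have k: "k \<noteq> 0" using w(2) by (simp add: k_def)
    let ?p = "smult k u" and ?q = "smult (lead_coeff u) w"
    have "?p = ?q \<or> degree (?p - ?q) < degree ?p"
      using w u0 k by (intro degree_diff_less) (auto simp: k_def)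
    moreover have "degree u \<le> degree (?p - ?q)"
      by (rule low[OF saturatedD(3)[OF W w(1)] k])
    ultimately have "?p = ?q" using k by auto
    then have "?p \<in> W" using saturatedD(3)[OF W w(1)] by metis
    then have "u \<in> W" using saturatedD(4)[OF W k] by blast
    then show False using nW u by blast
  qed
  have "degs (adjoin W v) = insert (degree u) (degs W)"
  proof (intro equalityI subsetI)
    fix d assume "d \<in> degs (adjoin W v)"
    then obtain x where x: "x \<in> adjoin W v" "x \<noteq> 0" "d = degree x" unfolding degs_def by auto
    obtain m l where ml: "m \<noteq> 0" "smult m x - smult l v \<in> W" using x(1) unfolding adjoin_def by blast
    define y where "y = smult (l0 * m) x - smult (l * m0) u"
    have "smult l0 (smult m x - smult l v) - smult l (smult m0 u - smult l0 v) \<in> W"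
      by (rule saturated_diff[OF W saturatedD(3)[OF W ml(2)] saturatedD(3)[OF W ml0(2)]])
    also have "smult l0 (smult m x - smult l v) - smult l (smult m0 u - smult l0 v) = y"
      unfolding y_def by (simp add: smult_diff_right mult_ac)
    finally have y: "y \<in> W" .
    have xe: "smult (l0 * m) x = y + smult (l * m0) u" unfolding y_def by simp
    have dx: "d = degree (smult (l0 * m) x)" using x ml ml0 by simp
    show "d \<in> insert (degree u) (degs W)"
    proof (cases "l * m0 = 0 \<or> y = 0")
      case True
      then show ?thesis
      proof
        assume "l * m0 = 0"
        then have "smult (l0 * m) x = y" using xe by simp
        then have "d = degree y" "y \<noteq> 0" using dx x ml ml0 by auto
        then show ?thesis using y unfolding degs_def by blast
      next
        assume "y = 0"
        then have "smult (l0 * m) x = smult (l * m0) u" using xe by simp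
        moreover have "l * m0 \<noteq> 0" using calculation x ml ml0 by auto
        ultimately have "d = degree u" using dx by (metis degree_smult_eq)
        then show ?thesis by blast
      qed
    next
      case False
      then have "degree y \<in> degs W" using y unfolding degs_def by blast
      then have "degree y \<noteq> degree (smult (l * m0) u)" using e False by auto
      then have "degree (y + smult (l * m0) u) = degree y \<or> degree (y + smult (l * m0) u) = degree (smult (l * m0) u)"
        using degree_add_eq_left degree_add_eq_right by (metis linorder_neqE_nat)
      then show ?thesis using dx xe False \<open>degree y \<in> degs W\<close> by auto
    qed
  next
    fix d assume "d \<in> insert (degree u) (degs W)"
    moreover have "u \<in> adjoin W v" using ml0 unfolding adjoin_def by blast
    ultimately show "d \<in> degs (adjoin W v)" using degs_mono[OF subset_adjoin[of W v]] u0 unfolding degs_def by blast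
  qed
  then show ?thesis using e finite_degs[OF W] by simp
qed

text \<open>
  The basis of \<open>W\<close> together with \<open>v\<close> spans a sublattice of finite index of the new lattice. The
  determinant of the change of basis is nonzero because a linear relation would put a multiple of
  \<open>v\<close> into \<open>W\<close>.
\<close>

lemma covolume_adjoin_le:
  assumes W: "saturated n W" and v: "degree v \<le> n" "v \<notin> W" and m: "m > 0"
  shows "covolume m w (basis (adjoin W v)) x \<le> covolume m w (basis W @ [v]) x"
proof -
  let ?V = "adjoin W v" and ?t = "basis W @ [v]"
  define r where "r = length (basis ?V)"
  have V: "saturated n ?V" using saturated_adjoin[OF W v(1)] .
  have r: "r = Suc (length (basis W))" unfolding r_def length_basis using card_degs_adjoin[OF W v] .
  have tV: "u \<in> ?V" if "u \<in> set ?t" for u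
    using that basis_in[OF W] subset_adjoin[of W v] in_adjoin[OF W] by auto
  have "\<exists>c. ?t ! a = (\<Sum>b<r. smult (c b) (basis ?V ! b))" if "a < r" for a
    unfolding r_def using that r by (intro basis_spans[OF V] tV) (simp add: nth_append)
  then obtain c where c: "\<And>a. a < r \<Longrightarrow> ?t ! a = (\<Sum>b<r. smult (c a b) (basis ?V ! b))" by metis
  define A where "A = mat r r (\<lambda>(a, b). c a b)"
  have A: "A \<in> carrier_mat r r" unfolding A_def by simp
  have tA: "?t ! a = (\<Sum>b<r. smult (A $$ (a, b)) (basis ?V ! b))" if "a < r" for a
    unfolding c[OF that] using that by (simp add: A_def)
  \<comment> \<open>A vector in the kernel of the transposed matrix is a linear relation between the rows \<open>?t\<close>.\<close>
  have "Determinant.det A \<noteq> 0"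
  proof
    assume "Determinant.det A = 0"
    then have "Determinant.det (transpose_mat A) = 0" using det_transpose[OF A] by simp
    then obtain z where z: "z \<in> carrier_vec r" "z \<noteq> 0\<^sub>v r" "transpose_mat A *\<^sub>v z = 0\<^sub>v r"
      using det_0_iff_vec_prod_zero[of "transpose_mat A" r] A by auto
    have col: "(\<Sum>a<r. A $$ (a, b) * Matrix.vec_index z a) = 0" if "b < r" for b
    proof -
      have "Matrix.vec_index (transpose_mat A *\<^sub>v z) b = 0" using z(3) that by simp
      then show ?thesis using that A z(1) by (simp add: scalar_prod_def atLeast0LessThan)
    qed
    have "(\<Sum>a<r. smult (Matrix.vec_index z a) (?t ! a)) = (\<Sum>a<r. \<Sum>b<r. smult (A $$ (a, b) * Matrix.vec_index z a) (basis ?V ! b))"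
      by (intro sum.cong refl) (simp add: tA smult_sum2 mult.commute)
    also have "\<dots> = (\<Sum>b<r. smult (\<Sum>a<r. A $$ (a, b) * Matrix.vec_index z a) (basis ?V ! b))"
      by (subst sum.swap) (simp add: smult_sum)
    also have "\<dots> = 0" using col by simp
    finally have rel: "(\<Sum>a<length (basis W). smult (Matrix.vec_index z a) (basis W ! a)) + smult (Matrix.vec_index z (r - 1)) v = 0"
      unfolding r by (simp add: nth_append)
    let ?S = "\<Sum>a<length (basis W). smult (Matrix.vec_index z a) (basis W ! a)"
    have SW: "?S \<in> W" using W basis_in[OF W] by (intro saturated_sum[OF W] saturatedD(3)[OF W]) auto
    have last: "Matrix.vec_index z (r - 1) = 0"
    proof (rule ccontr)
      assume nz: "Matrix.vec_index z (r - 1) \<noteq> 0"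
      have "smult (Matrix.vec_index z (r - 1)) v = smult (- 1) ?S" using rel by (simp add: add_eq_0_iff2)
      then have "smult (Matrix.vec_index z (r - 1)) v \<in> W" using saturatedD(3)[OF W SW] by metis
      then show False using saturatedD(4)[OF W nz] v(2) by blast
    qed
    then have "?S = 0" using rel by simp
    then have "Matrix.vec_index z a = 0" if "a < length (basis W)" for a
      using echelon_independent[OF echelon_basis[OF W] _ that] by blast
    then have "Matrix.vec_index z a = 0" if "a < r" for a using that last r by (cases "a = r - 1") auto
    then have "z = 0\<^sub>v r" using z(1) by (intro eq_vecI) auto
    then show False using z(2) by blast
  qed
  then show ?thesis by (intro covolume_change_of_basis[OF m A _ _ tA]) (auto simp: r_def r[unfolded r_def])
qed

section \<open>Most points admit no small integer polynomial\<close>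

text \<open>
  The weights under which the minors that consist of the value column, or of the value, the derivative
  and fewer than \<open>n\<close> coefficient columns, are not scaled down. The last inequality with \<open>j = n - 1\<close> says that the
  convex body of the given weights has at most a volume of order 1.
\<close>

definition admissible :: "nat \<Rightarrow> (nat \<Rightarrow> real) \<Rightarrow> bool" where
  "admissible n w \<longleftrightarrow> (\<forall>c. w c \<ge> 0) \<and> w 0 \<ge> 1 \<and> (\<forall>i. w (2 + i) = w 2) \<and>
     (\<forall>j<n. w 0 * w 1 * w 2 ^ j \<ge> 1)"

lemma covolume_lower_bound:
  assumes I: "I \<in> col_lists m (length s)" and nz: "minor I s \<noteq> 0" and w: "prod_list (map w I) \<ge> 1"
    and D: "degree (minor I s) \<le> D" "D > 0"
  shows "\<exists>x\<in>{0..1}. 1 / real D ^ D \<le> covolume m w s x"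
proof -
  obtain x where x: "x \<in> {0..1}" "\<bar>poly (of_int_poly (minor I s)) x\<bar> \<ge> 1 / real D ^ D"
    using int_poly_lower_bound[OF nz D] by blast
  have "1 / real D ^ D \<le> 1 * \<bar>poly (of_int_poly (minor I s)) x\<bar>" using x by simp
  also have "\<dots> \<le> \<bar>prod_list (map w I)\<bar> * \<bar>poly (of_int_poly (minor I s)) x\<bar>"
    using w by (intro mult_right_mono) auto
  also have "\<dots> = \<bar>poly (weighted_minor w I s) x\<bar>" unfolding weighted_minor_def by (simp add: abs_mult)
  also have "\<dots> \<le> covolume m w s x" by (rule covolume_ge[OF I])
  finally show ?thesis using x(1) by blast
qed

text \<open>
  In ranks 0 and 1 the empty minor and the value column serve. In higher rank the
  minor with the Wronskian is a nonzero integer polynomial of weight at least 1.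
\<close>

lemma covolume_basis_lower_bound:
  assumes W: "saturated n W" and w: "admissible n w" and D: "(n + 1) * n \<le> D" "D > 0"
  shows "\<exists>x\<in>{0..1}. 1 / real D ^ D \<le> covolume (n + 3) w (basis W) x"
proof -
  have len: "length (basis W) \<le> n + 1"
    unfolding length_basis using card_mono[OF _ degs_subset[OF W]] by simp
  have deg: "degree v \<le> n" if "v \<in> set (basis W)" for v
    using basis_in[OF W that] saturatedD(5)[OF W] by blast
  have degm: "degree (minor I (basis W)) \<le> D" if "I \<in> col_lists (n + 3) (length (basis W))" for I
  proof -
    have "degree (minor I (basis W)) \<le> length (basis W) * n"
      using that deg by (intro degree_minor_le) (auto simp: col_lists_def)
    also have "\<dots> \<le> (n + 1) * n" using len by (intro mult_right_mono) auto
    finally show ?thesis using D by simp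
  qed
  have "\<exists>I\<in>col_lists (n + 3) (length (basis W)). minor I (basis W) \<noteq> 0 \<and> prod_list (map w I) \<ge> 1"
  proof (cases "basis W")
    case Nil
    then show ?thesis by (intro bexI[of _ "[]"]) (auto simp: col_lists_def)
  next
    case (Cons p s')
    show ?thesis
    proof (cases s')
      case Nil
      have "p \<noteq> 0" using echelon_basis[OF W] Cons unfolding echelon_def by auto
      then show ?thesis using Cons Nil w
        by (intro bexI[of _ "[0]"]) (auto simp: col_lists_def minor_single admissible_def)
    next
      case (Cons q s)
      let ?I = "0 # 1 # map (\<lambda>v. 2 + degree v) s"
      have b: "basis W = p # q # s" using \<open>basis W = p # s'\<close> Cons by simp
      have "map w (map (\<lambda>v. 2 + degree v) s) = map (\<lambda>_. w 2) s"
        using w by (simp add: admissible_def)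
      then have "prod_list (map w ?I) = w 0 * w 1 * w 2 ^ length s"
        by (simp add: map_replicate_const)
      moreover have "length s < n" using len b by simp
      ultimately have "prod_list (map w ?I) \<ge> 1" using w unfolding admissible_def by (simp only:)
      moreover have "minor ?I (basis W) \<noteq> 0"
        using minor_echelon_nonzero echelon_basis[OF W] unfolding b by blast
      moreover have "?I \<in> col_lists (n + 3) (length (basis W))"
        using deg unfolding b by (auto simp: col_lists_def le_imp_less_Suc)
      ultimately show ?thesis by blast
    qed
  qed
  then show ?thesis using covolume_lower_bound degm D(2) by blast
qed

text \<open>
  Let \<open>W\<close> be the largest member of the flag, or the zero lattice, that does not contain the short
  vector \<open>v\<close>. The saturation of \<open>W + \<int> v\<close> is comparable with all members of the flag, so its covolume
  is at least \<open>e\<close>; by submultiplicativity it is less than that.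
\<close>

lemma marked_imp_no_small_vector:
  assumes w: "admissible n w" and e: "0 < e" "e \<le> r" "r \<le> 1"
    and marked: "marked e r (\<lambda>W. covolume (n + 3) w (basis W)) {W. saturated n W} x"
    and v: "v \<noteq> 0" "degree v \<le> n"
  shows "\<exists>c<n + 3. e / (n + 2) \<le> w c * \<bar>poly (of_int_poly (obs c v)) x\<bar>"
proof (rule ccontr)
  assume "\<not> ?thesis"
  then have small: "w c * \<bar>poly (of_int_poly (obs c v)) x\<bar> \<le> e / (n + 2)" if "c < n + 3" for c
    using that by (auto simp: not_le intro: less_imp_le)
  let ?\<psi> = "\<lambda>W. covolume (n + 3) w (basis W) x"
  obtain F where F: "\<And>W. W \<in> F \<Longrightarrow> saturated n W" "is_chain F" "\<And>W. W \<in> F \<Longrightarrow> e \<le> ?\<psi> W"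
      "\<And>W. W \<in> F \<Longrightarrow> ?\<psi> W \<le> r"
      "\<And>W. saturated n W \<Longrightarrow> W \<notin> F \<Longrightarrow> (\<forall>U\<in>F. U \<subseteq> W \<or> W \<subseteq> U) \<Longrightarrow> r \<le> ?\<psi> W"
    using marked unfolding marked_def by auto
  have comp: "e \<le> ?\<psi> W" if "saturated n W" "\<forall>U\<in>F. U \<subseteq> W \<or> W \<subseteq> U" for W
    using F(3)[of W] F(5)[OF that(1) _ that(2)] e(2) by (cases "W \<in> F") auto
  have sat0: "saturated n {0}" unfolding saturated_def by auto
  \<comment> \<open>The zero lattice makes this set nonempty, so that it has a maximal element.\<close>
  define G where "G = insert {0} {W\<in>F. v \<notin> W}"
  have "finite G" unfolding G_def using saturated_chain[of F n] F(1,2) by auto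
  moreover have "G \<noteq> {}" unfolding G_def by auto
  ultimately obtain W where W: "W \<in> G" "\<And>U. U \<in> G \<Longrightarrow> W \<subseteq> U \<Longrightarrow> W = U"
    using finite_has_maximal[of G] by metis
  have satW: "saturated n W" using W(1) sat0 F(1) unfolding G_def by auto
  have vW: "v \<notin> W" using W(1) v(1) unfolding G_def by auto
  have Wle: "U \<subseteq> W" if "U \<in> F" "v \<notin> U" for U
  proof -
    have "U \<in> G" using that unfolding G_def by blast
    moreover have "U \<subseteq> W \<or> W \<subseteq> U"
    proof (cases "W = {0}")
      case True
      then show ?thesis using saturatedD(1)[OF F(1)[OF that(1)]] by auto
    next
      case False
      then have "W \<in> F" using W(1) unfolding G_def by blast
      then show ?thesis using F(2) that(1) unfolding is_chain_def by blast
    qed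
    ultimately show ?thesis using W(2) by blast
  qed
  have psiW: "?\<psi> W \<le> 1"
  proof (cases "W = {0}")
    case True
    have "basis {0} = []" unfolding basis_def degs_def by simp
    moreover have "col_lists (n + 3) 0 = {[]}" by (auto simp: col_lists_def)
    ultimately show ?thesis using True by (simp add: covolume_def weighted_minor_def)
  next
    case False
    then have "W \<in> F" using W(1) unfolding G_def by blast
    then show ?thesis using F(4) e(3) by force
  qed
  have "\<forall>U\<in>F. U \<subseteq> adjoin W v \<or> adjoin W v \<subseteq> U"
  proof
    fix U assume U: "U \<in> F"
    show "U \<subseteq> adjoin W v \<or> adjoin W v \<subseteq> U"
    proof (cases "v \<in> U")
      case False
      then show ?thesis using Wle[OF U] subset_adjoin[of W v] by blast
    next
      case True
      have "W \<subseteq> U"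
      proof (cases "W = {0}")
        case True
        then show ?thesis using saturatedD(1)[OF F(1)[OF U]] by auto
      next
        case False
        then have "W \<in> F" using W(1) unfolding G_def by blast
        then show ?thesis using F(2) U True vW unfolding is_chain_def by blast
      qed
      then show ?thesis using adjoin_subset[OF F(1)[OF U] _ True] by blast
    qed
  qed
  then have "e \<le> ?\<psi> (adjoin W v)" by (intro comp saturated_adjoin[OF satW v(2)])
  also have "\<dots> \<le> covolume (n + 3) w (basis W @ [v]) x" by (rule covolume_adjoin_le[OF satW v(2) vW]) simp
  also have "\<dots> \<le> real (Suc (length (basis W))) * (e / (n + 2)) * ?\<psi> W"
    using w small by (intro covolume_snoc_le) (auto simp: admissible_def)
  also have "\<dots> \<le> real (Suc (length (basis W))) * (e / (n + 2)) * 1"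
    using psiW e by (intro mult_left_mono) auto
  also have "\<dots> < e"
  proof -
    have "card (degs W) \<le> n"
    proof (rule ccontr)
      assume "\<not> ?thesis"
      then have "n + 1 \<le> card (degs W)" by simp
      moreover have "card (degs (adjoin W v)) \<le> card {..n}"
        using degs_subset[OF saturated_adjoin[OF satW v(2)]] by (intro card_mono) auto
      ultimately show False using card_degs_adjoin[OF satW v(2) vW] by simp
    qed
    then have "real (Suc (length (basis W))) < real n + 2" unfolding length_basis by simp
    then have "real (Suc (length (basis W))) * e < (real n + 2) * e" using e(1) by (rule mult_strict_right_mono)
    then show ?thesis by (simp add: field_simps)
  qed
  finally show False by simp
qed

definition good_point :: "nat \<Rightarrow> (nat \<Rightarrow> real) \<Rightarrow> real \<Rightarrow> real \<Rightarrow> bool" where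
  "good_point n w e x \<longleftrightarrow> (\<forall>v :: int poly. v \<noteq> 0 \<longrightarrow> degree v \<le> n \<longrightarrow>
     (\<exists>c<n + 3. e \<le> w c * \<bar>poly (of_int_poly (obs c v)) x\<bar>))"

text \<open>
  The constant \<open>e\<close> depends only on \<open>n\<close>, not on the weights: these enter only through \<open>admissible\<close>.
\<close>

theorem most_points_good:
  assumes n: "n > 0"
  shows "\<exists>e>0. \<forall>w. admissible n w \<longrightarrow> (\<exists>U\<in>sets borel. emeasure lborel U \<le> ennreal (1/2) \<and>
     (\<forall>x\<in>{0..1} - U. good_point n w e x))"
proof -
  define D where "D = (n + 1) * n"
  have D: "D > 0" using n unfolding D_def by simp
  define r where "r = 1 / real D ^ D"
  have r: "0 < r" "r \<le> 1" unfolding r_def using D by (auto simp: field_simps)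
  define N where "N = nondiv_const 1 (n + 2)"
  have N: "N \<ge> 0" unfolding N_def by (intro nondiv_const_nonneg) auto
  \<comment> \<open>The exceptional measure is linear in \<open>k\<close>; this choice makes it at most 1/2.\<close>
  define k where "k = 1 / (2 * (1 + N))"
  have k: "k > 0" "k * N \<le> 1/2" using N unfolding k_def by (auto simp: field_simps)
  \<comment> \<open>The sublevel set estimate \<open>poly_sublevel_small\<close> with this \<open>t\<close> has the constant \<open>k\<close>.\<close>
  define t where "t = min (1/2) (k / (4 * real D))"
  have t: "0 < t" "t \<le> 1/2" "4 * real D * t \<le> k" using k D unfolding t_def by (auto simp: min_def field_simps)
  define e where "e = r * t ^ D"
  have e: "0 < e" "e \<le> r" using r t unfolding e_def by (auto simp: mult_le_cancel_left2 power_le_one)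
  have "\<exists>U\<in>sets borel. emeasure lborel U \<le> ennreal (1/2) \<and> (\<forall>x\<in>{0..1} - U. good_point n w (e / (n + 2)) x)"
    if w: "admissible n w" for w
  proof -
    let ?\<psi> = "\<lambda>W. covolume (n + 3) w (basis W)"
    have "\<exists>U\<in>sets borel. {x\<in>{0..1}. \<not> marked e r ?\<psi> {W. saturated n W} x} \<subseteq> U \<and>
      emeasure lborel U \<le> ennreal (nondiv_const k (n + 2) * (1 - 0))"
    proof (rule nondivergence)
      fix W :: "int poly set" and a b x0 :: real
      assume W: "W \<in> {W. saturated n W}" and x0: "a \<le> x0" "x0 \<le> b" "r \<le> ?\<psi> W x0"
      then have W: "saturated n W" by simp
      obtain I where I: "I \<in> col_lists (n + 3) (length (basis W))" "?\<psi> W x0 = \<bar>poly (weighted_minor w I (basis W)) x0\<bar>"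
        by (rule covolume_attained[of "n + 3" "basis W" w x0]) auto
      have "degree (weighted_minor w I (basis W)) \<le> degree (minor I (basis W))"
        unfolding weighted_minor_def by (rule order_trans[OF degree_smult_le]) simp
      also have "\<dots> \<le> length (basis W) * n"
        using basis_in[OF W] saturatedD(5)[OF W] I by (intro degree_minor_le) (auto simp: col_lists_def)
      also have "\<dots> \<le> D" unfolding D_def length_basis
        using card_mono[OF _ degs_subset[OF W]] by (intro mult_right_mono) auto
      finally have deg: "degree (weighted_minor w I (basis W)) \<le> D" .
      obtain U where U: "U \<in> sets borel" "{x\<in>{a..b}. \<bar>poly (weighted_minor w I (basis W)) x\<bar> < r * t ^ D} \<subseteq> U"
        "emeasure lborel U \<le> ennreal (4 * real D * t * (b - a))"
        using poly_sublevel_small[OF deg x0(1,2) x0(3)[unfolded I(2)] r(1) t(1,2)] by blast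
      have sub: "{x\<in>{a..b}. ?\<psi> W x < e} \<subseteq> U"
      proof
        fix x assume x: "x \<in> {x\<in>{a..b}. ?\<psi> W x < e}"
        have "\<bar>poly (weighted_minor w I (basis W)) x\<bar> \<le> ?\<psi> W x" by (rule covolume_ge[OF I(1)])
        then show "x \<in> U" using x U(2) unfolding e_def by auto
      qed
      have "4 * real D * t * (b - a) \<le> k * (b - a)" using t(3) x0 by (intro mult_right_mono) auto
      then have "emeasure lborel U \<le> ennreal (k * (b - a))"
        using U(3) ennreal_leI order_trans by blast
      then show "\<exists>U\<in>sets borel. {x\<in>{a..b}. ?\<psi> W x < e} \<subseteq> U \<and> emeasure lborel U \<le> ennreal (k * (b - a))"
        using U(1) sub by blast
    next
      fix F :: "int poly set set" assume "F \<subseteq> {W. saturated n W}" "is_chain F"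
      then show "finite F \<and> card F \<le> n + 2" by (intro saturated_chain) auto
    next
      fix W :: "int poly set" assume "W \<in> {W. saturated n W}"
      then show "\<exists>x\<in>{0..1}. r \<le> ?\<psi> W x"
        unfolding r_def using w D by (intro covolume_basis_lower_bound) (auto simp: D_def)
    qed (use k open_covolume_less in auto)
    then obtain U where U: "U \<in> sets borel" "{x\<in>{0..1}. \<not> marked e r ?\<psi> {W. saturated n W} x} \<subseteq> U"
      "emeasure lborel U \<le> ennreal (nondiv_const k (n + 2))" by auto
    have "nondiv_const k (n + 2) \<le> 1/2" using k(2) nondiv_const_linear[of k "n + 2"] by (simp add: N_def)
    then have "emeasure lborel U \<le> ennreal (1/2)" using U(3) ennreal_leI order_trans by blast
    moreover have "good_point n w (e / (n + 2)) x" if "x \<in> {0..1} - U" for x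
    proof -
      have "marked e r ?\<psi> {W. saturated n W} x" using that U(2) by blast
      then show ?thesis unfolding good_point_def using marked_imp_no_small_vector[OF w e r(2)] by blast
    qed
    ultimately show ?thesis using U(1) by blast
  qed
  moreover have "e / (n + 2) > 0" using e by simp
  ultimately show ?thesis by blast
qed

section \<open>The covering radius at a good point\<close>

text \<open>
  The norm on real polynomials whose balls are the convex bodies of the argument.
\<close>

definition obs_norm :: "nat \<Rightarrow> (nat \<Rightarrow> real) \<Rightarrow> real \<Rightarrow> real poly \<Rightarrow> real" where
  "obs_norm n w x T = Max ((\<lambda>c. w c * \<bar>poly (obs c T) x\<bar>) ` {..<n + 3})"

lemma lessThan_nonempty: "{..<n + 3 :: nat} \<noteq> {}"
proof -
  have "0 \<in> {..<n + 3}" by simp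
  then show ?thesis by (rule ex_in_conv[THEN iffD1, OF exI])
qed

lemma obs_norm_ge: "c < n + 3 \<Longrightarrow> w c * \<bar>poly (obs c T) x\<bar> \<le> obs_norm n w x T"
  unfolding obs_norm_def by (intro Max_ge) auto

lemma obs_norm_le_iff: "obs_norm n w x T \<le> r \<longleftrightarrow> (\<forall>c<n + 3. w c * \<bar>poly (obs c T) x\<bar> \<le> r)"
  unfolding obs_norm_def by (subst Max_le_iff) (auto simp: lessThan_nonempty)

lemma obs_norm_less_iff: "obs_norm n w x T < r \<longleftrightarrow> (\<forall>c<n + 3. w c * \<bar>poly (obs c T) x\<bar> < r)"
  unfolding obs_norm_def by (subst Max_less_iff) (auto simp: lessThan_nonempty)

lemma obs_norm_nonneg:
  assumes "\<And>c. w c \<ge> 0"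
  shows "obs_norm n w x T \<ge> 0"
proof -
  have "0 \<le> w 0 * \<bar>poly (obs 0 T) x\<bar>" using assms by simp
  also have "\<dots> \<le> obs_norm n w x T" by (rule obs_norm_ge) simp
  finally show ?thesis .
qed

lemma obs_norm_add:
  assumes "\<And>c. w c \<ge> 0"
  shows "obs_norm n w x (S + T) \<le> obs_norm n w x S + obs_norm n w x T"
  unfolding obs_norm_le_iff
proof (intro allI impI)
  fix c assume c: "c < n + 3"
  have "w c * \<bar>poly (obs c (S + T)) x\<bar> \<le> w c * \<bar>poly (obs c S) x\<bar> + w c * \<bar>poly (obs c T) x\<bar>"
    unfolding obs_add poly_add distrib_left[symmetric] by (intro mult_left_mono abs_triangle_ineq assms)
  also have "\<dots> \<le> obs_norm n w x S + obs_norm n w x T" using c by (intro add_mono obs_norm_ge)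
  finally show "w c * \<bar>poly (obs c (S + T)) x\<bar> \<le> obs_norm n w x S + obs_norm n w x T" .
qed

lemma obs_norm_smult_le: "obs_norm n w x (smult a T) \<le> \<bar>a\<bar> * obs_norm n w x T"
  unfolding obs_norm_le_iff
proof (intro allI impI)
  fix c assume c: "c < n + 3"
  have "w c * \<bar>poly (obs c (smult a T)) x\<bar> = \<bar>a\<bar> * (w c * \<bar>poly (obs c T) x\<bar>)"
    by (simp add: obs_smult abs_mult)
  also have "\<dots> \<le> \<bar>a\<bar> * obs_norm n w x T" using c by (intro mult_left_mono obs_norm_ge) auto
  finally show "w c * \<bar>poly (obs c (smult a T)) x\<bar> \<le> \<bar>a\<bar> * obs_norm n w x T" .
qed

lemma obs_of_int_poly: "obs c (of_int_poly P :: real poly) = of_int_poly (obs c P)"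
proof -
  have "pderiv (of_int_poly P :: real poly) = of_int_poly (pderiv P)"
    by (intro poly_eqI) (simp add: coeff_pderiv)
  then show ?thesis by (auto simp: obs_def poly_eq_iff coeff_map_poly coeff_pCons split: nat.splits)
qed

text \<open>
  With these weights the unit ball at \<open>x\<close> is the set of polynomials \<open>P\<close> with \<open>\<bar>P(x)\<bar> \<le> Q \<delta>\<^sup>2\<close>,
  \<open>\<bar>P'(x)\<bar> \<le> Q \<delta>\<close> and coefficients bounded by \<open>Q\<close>.
\<close>

definition weight :: "real \<Rightarrow> real \<Rightarrow> nat \<Rightarrow> real" where
  "weight Q \<delta> c = (if c = 0 then 1 / (Q * \<delta>\<^sup>2) else if c = 1 then 1 / (Q * \<delta>) else 1 / Q)"

definition separation_bound :: "nat \<Rightarrow> real \<Rightarrow> real" where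
  "separation_bound n e = (4 * (real n + 1)^2 / e + 3) ^ (n + 3)"

lemma abs_poly_le:
  fixes T :: "real poly"
  assumes deg: "degree T \<le> n" and co: "\<And>i. \<bar>coeff T i\<bar> \<le> H" and x: "x \<in> {0..1}"
  shows "\<bar>poly T x\<bar> \<le> (real n + 1) * H"
proof -
  have H: "H \<ge> 0" using co[of 0] by linarith
  have "poly T x = (\<Sum>i\<le>n. coeff T i * x ^ i)"
    unfolding poly_altdef using deg by (intro sum.mono_neutral_left) (auto simp: coeff_eq_0)
  then have "\<bar>poly T x\<bar> \<le> (\<Sum>i\<le>n. \<bar>coeff T i * x ^ i\<bar>)" by simp
  also have "\<dots> \<le> (\<Sum>i\<le>n. H)"
  proof (intro sum_mono)
    fix i
    have "\<bar>coeff T i * x ^ i\<bar> = \<bar>coeff T i\<bar> * x ^ i" using x by (simp add: abs_mult)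
    also have "\<dots> \<le> H * 1" using x H co by (intro mult_mono power_le_one) auto
    finally show "\<bar>coeff T i * x ^ i\<bar> \<le> H" by simp
  qed
  also have "\<dots> = (real n + 1) * H" by simp
  finally show ?thesis .
qed

lemma abs_obs_le:
  fixes T :: "real poly"
  assumes deg: "degree T \<le> n" and co: "\<And>i. \<bar>coeff T i\<bar> \<le> H" and x: "x \<in> {0..1}"
  shows "\<bar>poly (obs c T) x\<bar> \<le> (real n + 1)^2 * H"
proof -
  have H: "H \<ge> 0" using co[of 0] by linarith
  have sq: "1 \<le> (real n + 1)^2" "real n + 1 \<le> (real n + 1)^2" by (auto simp: power2_eq_square algebra_simps)
  consider "c = 0" | "c = 1" | "c \<ge> 2" by linarith
  then show ?thesis
  proof cases
    case 1
    have "\<bar>poly (obs c T) x\<bar> \<le> (real n + 1) * H" using 1 abs_poly_le[OF deg co x] by simp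
    also have "\<dots> \<le> (real n + 1)^2 * H" using H sq by (intro mult_right_mono) auto
    finally show ?thesis .
  next
    case 2
    have "\<bar>coeff (pderiv T) i\<bar> \<le> (real n + 1) * H" for i
    proof (cases "i < degree T")
      case True
      have "\<bar>coeff (pderiv T) i\<bar> = real (Suc i) * \<bar>coeff T (Suc i)\<bar>" by (simp add: coeff_pderiv abs_mult)
      also have "\<dots> \<le> (real n + 1) * H" using True deg H co by (intro mult_mono) auto
      finally show ?thesis .
    next
      case False
      then have "coeff (pderiv T) i = 0" by (simp add: coeff_pderiv coeff_eq_0)
      then show ?thesis using H by simp
    qed
    moreover have "degree (pderiv T) \<le> n" using deg by (simp add: degree_pderiv)
    ultimately have "\<bar>poly (pderiv T) x\<bar> \<le> (real n + 1) * ((real n + 1) * H)" by (intro abs_poly_le[OF _ _ x])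
    then show ?thesis using 2 by (simp add: power2_eq_square mult.assoc)
  next
    case 3
    then have "\<bar>poly (obs c T) x\<bar> \<le> 1 * H" using co by (simp add: obs_def)
    also have "\<dots> \<le> (real n + 1)^2 * H" using H sq by (intro mult_right_mono) auto
    finally show ?thesis .
  qed
qed

text \<open>
  A packing bound by the pigeonhole principle, which takes the place of a comparison of volumes. After reduction of
  the \<open>T i\<close> modulo integer polynomials, add to them all integer polynomials with coefficients in
  \<open>{0..<q}\<close>, where \<open>q\<close> is about \<open>Q\<close>. The weighted observables, rounded in units of \<open>e\<close>, take only a
  constant times \<open>1 / \<delta> ^ 3 = Q ^ (n + 1)\<close> values on these \<open>M * q ^ (n + 1)\<close> polynomials, and they
  separate them: two polynomials with the same rounded observables would contradict the
  separation of the \<open>T i\<close> or the goodness of \<open>x\<close>.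
\<close>

lemma separated_translates_bounded:
  fixes T :: "nat \<Rightarrow> real poly"
  assumes Q: "Q \<ge> 1" and \<delta>: "0 < \<delta>" "\<delta> \<le> 1" "\<delta> ^ 3 * Q ^ (n + 1) = 1" and x: "x \<in> {0..1}" and e: "e > 0"
    and good: "good_point n (weight Q \<delta>) e x"
    and deg: "\<And>i. i < M \<Longrightarrow> degree (T i) \<le> n"
    and sep: "\<And>i j P. i < M \<Longrightarrow> j < M \<Longrightarrow> i \<noteq> j \<Longrightarrow> degree P \<le> n \<Longrightarrow>
      e \<le> obs_norm n (weight Q \<delta>) x (T i - T j - of_int_poly P)"
  shows "real M \<le> separation_bound n e"
proof -
  let ?w = "weight Q \<delta>"
  have w0: "?w c \<ge> 0" for c using Q \<delta> by (simp add: weight_def)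
  define q where "q = nat \<lceil>Q\<rceil>"
  have q: "Q \<le> real q" "real q \<le> 2 * Q" using Q unfolding q_def by linarith+
  define I where "I i = Poly (map (\<lambda>k. \<lfloor>coeff (T i) k\<rfloor>) [0..<n + 1])" for i
  define R where "R f = Poly (map f [0..<n + 1])" for f :: "nat \<Rightarrow> int"
  have coI: "coeff (I i) k = (if k \<le> n then \<lfloor>coeff (T i) k\<rfloor> else 0)" for i k
    unfolding I_def by (simp add: nth_default_def del: upt_Suc)
  have coR: "coeff (R f) k = (if k \<le> n then f k else 0)" for f k
    unfolding R_def by (simp add: nth_default_def del: upt_Suc)
  have degIR: "degree (I i) \<le> n" "degree (R f) \<le> n" for i f
    by (intro degree_le; simp add: coI coR)+
  define V where "V = (\<lambda>(i, f). T i - of_int_poly (I i) + of_int_poly (R f))"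
  define dom where "dom = {..<M} \<times> ({..n} \<rightarrow>\<^sub>E {0..<int q})"
  have degV: "degree (V p) \<le> n" if "p \<in> dom" for p
    using that deg degIR unfolding V_def dom_def
    by (auto intro!: degree_add_le degree_diff_le order_trans[OF degree_map_poly_le])
  have coV: "\<bar>coeff (V p) k\<bar> \<le> 2 * Q" if p: "p \<in> dom" for p k
  proof (cases "k \<le> n")
    case True
    obtain i f where pf: "p = (i, f)" "f \<in> {..n} \<rightarrow>\<^sub>E {0..<int q}" using p unfolding dom_def by auto
    have "coeff (V p) k = frac (coeff (T i) k) + real_of_int (f k)"
      using True by (simp add: pf V_def coI coR frac_def)
    moreover have "f k \<in> {0..<int q}" using pf(2) True by auto
    then have "0 \<le> f k" "f k \<le> int q - 1" by auto
    then have "0 \<le> real_of_int (f k)" "real_of_int (f k) \<le> real q - 1" by linarith+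
    ultimately show ?thesis using q frac_ge_0[of "coeff (T i) k"] frac_lt_1[of "coeff (T i) k"] by linarith
  next
    case False
    then show ?thesis using degV[OF p] Q by (simp add: coeff_eq_0)
  qed
  define A where "A = 2 * (real n + 1)^2 / e"
  have A: "A > 0" using e by (simp add: A_def)
  \<comment> \<open>Bounds for the weighted observables in units of \<open>e\<close>.\<close>
  define L where "L c = (if c = 0 then A / \<delta>\<^sup>2 else if c = 1 then A / \<delta> else A)" for c :: nat
  have L: "?w c * \<bar>poly (obs c (V p)) x\<bar> / e \<le> L c" if "p \<in> dom" for c p
  proof -
    have "?w c * \<bar>poly (obs c (V p)) x\<bar> / e \<le> ?w c * ((real n + 1)^2 * (2 * Q)) / e"
      using e w0 by (intro divide_right_mono mult_left_mono abs_obs_le degV coV x that) auto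
    also have "\<dots> = L c" using Q \<delta> e by (auto simp: weight_def L_def A_def field_simps)
    finally show ?thesis .
  qed
  define key where "key p = restrict (\<lambda>c. \<lfloor>?w c * poly (obs c (V p)) x / e\<rfloor>) {..<n + 3}" for p
  define cod where "cod = Pi\<^sub>E {..<n + 3} (\<lambda>c. {- \<lceil>L c\<rceil>..\<lceil>L c\<rceil>})"
  have "key ` dom \<subseteq> cod"
  proof (intro image_subsetI)
    fix p assume p: "p \<in> dom"
    have "\<lfloor>?w c * poly (obs c (V p)) x / e\<rfloor> \<in> {- \<lceil>L c\<rceil>..\<lceil>L c\<rceil>}" for c
    proof -
      have "\<bar>?w c * poly (obs c (V p)) x / e\<bar> \<le> L c"
        using L[OF p, of c] e w0[of c] by (simp add: abs_mult)
      then have "- L c \<le> ?w c * poly (obs c (V p)) x / e" "?w c * poly (obs c (V p)) x / e \<le> L c" by linarith+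
      then show ?thesis by (auto intro: floor_mono[THEN order_trans] simp: le_floor_iff ceiling_def) linarith+
    qed
    then show "key p \<in> cod" unfolding key_def cod_def by auto
  qed
  moreover have "inj_on key dom"
  proof (rule inj_onI)
    fix p p' assume p: "p \<in> dom" "p' \<in> dom" "key p = key p'"
    obtain i f j g where pf: "p = (i, f)" "i < M" "f \<in> {..n} \<rightarrow>\<^sub>E {0..<int q}"
        "p' = (j, g)" "j < M" "g \<in> {..n} \<rightarrow>\<^sub>E {0..<int q}" using p(1,2) unfolding dom_def by auto
    have close: "obs_norm n ?w x (V p - V p') < e"
      unfolding obs_norm_less_iff
    proof (intro allI impI)
      fix c assume c: "c < n + 3"
      have "\<lfloor>?w c * poly (obs c (V p)) x / e\<rfloor> = \<lfloor>?w c * poly (obs c (V p')) x / e\<rfloor>"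
        using fun_cong[OF p(3), of c] c by (simp add: key_def)
      then have "\<bar>?w c * poly (obs c (V p)) x / e - ?w c * poly (obs c (V p')) x / e\<bar> < 1" by linarith
      then have "\<bar>?w c * poly (obs c (V p)) x - ?w c * poly (obs c (V p')) x\<bar> < e"
        using e unfolding diff_divide_distrib[symmetric] by simp
      then show "?w c * \<bar>poly (obs c (V p - V p')) x\<bar> < e"
        using w0[of c] unfolding right_diff_distrib[symmetric] by (simp add: obs_diff abs_mult)
    qed
    have Vdiff: "V p - V p' = T i - T j - of_int_poly (I i - R f - I j + R g)"
      unfolding pf V_def by (simp add: of_int_poly_hom.hom_minus of_int_poly_hom.hom_add)
    have degP: "degree (I i - R f - I j + R g) \<le> n" by (intro degree_add_le degree_diff_le degIR)
    have ij: "i = j"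
      using sep[OF pf(2) pf(5) _ degP] close unfolding Vdiff by fastforce
    have "R f = R g"
    proof (rule ccontr)
      assume "R f \<noteq> R g"
      moreover have "degree (R f - R g) \<le> n" by (intro degree_diff_le degIR)
      ultimately obtain c where c: "c < n + 3" "e \<le> ?w c * \<bar>poly (of_int_poly (obs c (R f - R g))) x\<bar>"
        using good unfolding good_point_def by (metis right_minus_eq)
      have "V p - V p' = of_int_poly (R f - R g)"
        unfolding Vdiff using ij by (simp add: of_int_poly_hom.hom_minus of_int_poly_hom.hom_add)
      then have "e \<le> obs_norm n ?w x (V p - V p')"
        using c obs_norm_ge[OF c(1), of ?w "V p - V p'" x] by (simp add: obs_of_int_poly)
      then show False using close by simp
    qed
    then have "f k = g k" if "k \<le> n" for k using coR[of f k] coR[of g k] that by simp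
    then have "f = g" using pf(3,6) by (intro PiE_ext[of f _ _ g]) auto
    then show "p = p'" using pf ij by simp
  qed
  moreover have "finite cod" unfolding cod_def by (intro finite_PiE) auto
  ultimately have le: "card dom \<le> card cod" by (intro card_inj_on_le)
  have dom: "card dom = M * q ^ (n + 1)" unfolding dom_def by (simp add: card_cartesian_product card_PiE)
  have cod: "real (card cod) \<le> separation_bound n e * Q ^ (n + 1)"
  proof -
    define B where "B = 2 * A + 3"
    define d where "d c = (if c = 0 then 1 / \<delta>\<^sup>2 else if c = 1 then 1 / \<delta> else 1)" for c :: nat
    have d1: "d c \<ge> 1" for c using \<delta> by (auto simp: d_def power_le_one)
    have "real (card {- \<lceil>L c\<rceil>..\<lceil>L c\<rceil>}) \<le> B * d c" for c
    proof -
      have Ld: "L c = A * d c" by (simp add: L_def d_def)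
      then have "L c \<ge> 0" using A d1[of c] by simp
      then have "real (card {- \<lceil>L c\<rceil>..\<lceil>L c\<rceil>}) = 2 * real_of_int \<lceil>L c\<rceil> + 1" by simp
      also have "\<dots> \<le> 2 * (A * d c) + 3 * 1" using Ld by linarith
      also have "\<dots> \<le> B * d c" using d1[of c] unfolding B_def by (simp add: distrib_right)
      finally show ?thesis .
    qed
    then have "real (card cod) \<le> (\<Prod>c<n + 3. B * d c)"
      unfolding cod_def by (simp add: card_PiE prod_mono)
    also have "\<dots> = B ^ (n + 3) * (\<Prod>c<n + 3. d c)" by (simp add: prod.distrib)
    also have "(\<Prod>c<n + 3. d c) = 1 / \<delta> ^ 3"
    proof -
      have "(\<Prod>c<n + 3. d c) = (\<Prod>c\<in>{0,1::nat}. d c)"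
        by (intro prod.mono_neutral_right) (auto simp: d_def)
      also have "\<dots> = 1 / \<delta> ^ 3" by (simp add: d_def power2_eq_square power3_eq_cube)
      finally show ?thesis .
    qed
    also have "1 / \<delta> ^ 3 = Q ^ (n + 1)" using \<delta> by (simp add: field_simps)
    also have "B ^ (n + 3) = separation_bound n e" unfolding B_def A_def separation_bound_def by simp
    finally show ?thesis .
  qed
  have "real M * real q ^ (n + 1) = real (card dom)" unfolding dom by simp
  also have "\<dots> \<le> real (card cod)" using le by simp
  finally have "real M * real q ^ (n + 1) \<le> separation_bound n e * Q ^ (n + 1)" using cod by linarith
  moreover have "real M * Q ^ (n + 1) \<le> real M * real q ^ (n + 1)"
    using q(1) Q by (intro mult_left_mono power_mono) auto
  ultimately have "real M * Q ^ (n + 1) \<le> separation_bound n e * Q ^ (n + 1)" by linarith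
  then show ?thesis using Q by (simp add: mult_le_cancel_right)
qed

text \<open>
  The distance to the lattice is continuous along the segment from 0 to \<open>T\<close> and vanishes at 0. If it
  were large at \<open>T\<close>, it would take each of the values \<open>0, e, 2 e, \<dots>\<close> on the way, and points with these distances are
  pairwise separated modulo the lattice: too many for the packing bound.
\<close>

theorem covering_radius_bounded:
  assumes Q: "Q \<ge> 1" and \<delta>: "0 < \<delta>" "\<delta> \<le> 1" "\<delta> ^ 3 * Q ^ (n + 1) = 1" and x: "x \<in> {0..1}" and e: "e > 0"
    and good: "good_point n (weight Q \<delta>) e x" and T: "degree (T :: real poly) \<le> n"
  shows "\<exists>P. degree P \<le> n \<and> obs_norm n (weight Q \<delta>) x (T - of_int_poly P) \<le> (separation_bound n e + 2) * e"
proof (rule ccontr)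
  assume far: "\<not> ?thesis"
  let ?N = "obs_norm n (weight Q \<delta>) x"
  have w0: "weight Q \<delta> c \<ge> 0" for c using Q \<delta> by (simp add: weight_def)
  have N0: "?N S \<ge> 0" for S using w0 by (rule obs_norm_nonneg)
  define A where "A S = {?N (S - of_int_poly P) | P. degree P \<le> n}" for S
  define d where "d S = Inf (A S)" for S
  have ne: "A S \<noteq> {}" for S unfolding A_def by (auto intro!: exI[of _ 0])
  have bdd: "bdd_below (A S)" for S unfolding A_def using N0 by (intro bdd_belowI[of _ 0]) auto
  have dle: "d S \<le> ?N (S - of_int_poly P)" if "degree P \<le> n" for S P
    unfolding d_def using bdd that by (intro cInf_lower) (auto simp: A_def)
  have dlip: "d S \<le> d S' + ?N (S - S' - of_int_poly P)" if P: "degree P \<le> n" for S S' P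
  proof -
    have "d S - ?N (S - S' - of_int_poly P) \<le> d S'" unfolding d_def[of S']
    proof (rule cInf_greatest[OF ne])
      fix a assume "a \<in> A S'"
      then obtain P' where P': "degree P' \<le> n" "a = ?N (S' - of_int_poly P')" unfolding A_def by blast
      have "d S \<le> ?N (S - of_int_poly (P + P'))" using P P' by (intro dle degree_add_le)
      also have "S - of_int_poly (P + P') = (S - S' - of_int_poly P) + (S' - of_int_poly P')"
        by (simp add: of_int_poly_hom.hom_add)
      also have "?N \<dots> \<le> ?N (S - S' - of_int_poly P) + a" unfolding P'(2) by (rule obs_norm_add[OF w0])
      finally show "d S - ?N (S - S' - of_int_poly P) \<le> a" by simp
    qed
    then show ?thesis by simp
  qed
  define g where "g t = d (smult t T)" for t
  have cont: "continuous_on {0..1} g"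
  proof -
    have lip: "g s \<le> g t + \<bar>s - t\<bar> * ?N T" for s t
    proof -
      have "g s \<le> g t + ?N (smult (s - t) T)"
        using dlip[of 0 "smult s T" "smult t T"] by (simp add: g_def smult_diff_left)
      then show ?thesis using obs_norm_smult_le[of n "weight Q \<delta>" x "s - t" T] by linarith
    qed
    have "(?N T)-lipschitz_on {0..1} g"
    proof (rule lipschitz_onI)
      fix s t show "dist (g s) (g t) \<le> ?N T * dist s t"
        using lip[of s t] lip[of t s] by (simp add: dist_real_def abs_minus_commute mult.commute abs_le_iff)
    qed (rule N0)
    then show ?thesis by (rule lipschitz_on_continuous_on)
  qed
  have g0: "g 0 \<le> 0"
  proof -
    have "?N 0 \<le> 0" unfolding obs_norm_le_iff by simp
    then show ?thesis using dle[of 0 0] by (simp add: g_def)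
  qed
  have g1: "(separation_bound n e + 2) * e \<le> g 1"
    unfolding g_def d_def
  proof (rule cInf_greatest[OF ne])
    fix a assume "a \<in> A (smult 1 T)"
    then obtain P where "degree P \<le> n" "a = ?N (T - of_int_poly P)" unfolding A_def by auto
    then show "(separation_bound n e + 2) * e \<le> a" using far by force
  qed
  define M where "M = nat \<lfloor>separation_bound n e\<rfloor> + 1"
  have pb: "separation_bound n e \<ge> 0" unfolding separation_bound_def using e by simp
  have M: "separation_bound n e < real M" "real M \<le> separation_bound n e + 1" using pb unfolding M_def by linarith+
  have "\<exists>t\<in>{0..1}. g t = real i * e" if "i < M" for i
  proof -
    have "real i * e \<le> (separation_bound n e + 2) * e" using that M e by (intro mult_right_mono) auto
    then have "real i * e \<le> g 1" using g1 by linarith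
    moreover have "g 0 \<le> real i * e" by (rule order_trans[OF g0]) (use e in simp)
    ultimately have "\<exists>t\<ge>0. t \<le> 1 \<and> g t = real i * e" by (intro IVT' cont) simp_all
    then show ?thesis by auto
  qed
  then obtain t where t: "\<And>i. i < M \<Longrightarrow> g (t i) = real i * e" by metis
  have sep: "e \<le> ?N (smult (t i) T - smult (t j) T - of_int_poly P)"
    if "i < M" "j < M" "j < i" "degree P \<le> n" for i j P
  proof -
    have "real i * e \<le> real j * e + ?N (smult (t i) T - smult (t j) T - of_int_poly P)"
      using dlip[OF that(4), of "smult (t i) T" "smult (t j) T"] t that by (simp add: g_def)
    moreover have "real j * e + 1 * e \<le> real i * e"
      unfolding distrib_right[symmetric] using that e by (intro mult_right_mono) auto
    ultimately show ?thesis by simp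
  qed
  have "real M \<le> separation_bound n e"
  proof (rule separated_translates_bounded[OF Q \<delta> x e good])
    show "degree (smult (t i) T) \<le> n" for i using T degree_smult_le order_trans by blast
    fix i j :: nat and P :: "int poly" assume ij: "i < M" "j < M" "i \<noteq> j" "degree P \<le> n"
    show "e \<le> ?N (smult (t i) T - smult (t j) T - of_int_poly P)"
    proof (cases "j < i")
      case False
      then have "e \<le> ?N (smult (t j) T - smult (t i) T - of_int_poly (- P))" using ij by (intro sep) auto
      also have "smult (t j) T - smult (t i) T - of_int_poly (- P) =
        smult (- 1) (smult (t i) T - smult (t j) T - of_int_poly P)"
        by (simp add: of_int_poly_hom.hom_uminus smult_diff_right)
      also have "?N \<dots> \<le> \<bar>- 1\<bar> * ?N (smult (t i) T - smult (t j) T - of_int_poly P)"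
        by (rule obs_norm_smult_le)
      finally show ?thesis by simp
    qed (use ij sep in auto)
  qed
  then show False using M by simp
qed

section \<open>Irreducibility, minimal polynomials and Taylor remainders\<close>

text \<open>
  Eisenstein's criterion at the prime 2. One of the two factors has an even constant term, the other
  an odd one; the first odd coefficient of the former produces an odd coefficient of \<open>G\<close> below the
  leading one.
\<close>

lemma eisenstein_2:
  fixes G :: "int poly"
  assumes deg: "degree G > 0" and lc: "odd (lead_coeff G)"
    and ev: "\<And>i. i < degree G \<Longrightarrow> even (coeff G i)" and c0: "\<not> 4 dvd coeff G 0"
  shows "irreducible\<^sub>d G"
proof (rule irreducible\<^sub>dI[OF deg])
  fix A B :: "int poly"
  assume AB: "degree A > 0" "degree A < degree G" "degree B > 0" "degree B < degree G" "G = A * B"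
  have key: False if AB: "degree A < degree G" "G = A * B" and even: "even (coeff A 0)" for A B :: "int poly"
  proof -
    have oddB: "odd (coeff B 0)"
    proof
      assume "even (coeff B 0)"
      then have "2 * 2 dvd coeff A 0 * coeff B 0" using even by (intro mult_dvd_mono)
      then show False using c0 AB(2) by (simp add: coeff_mult)
    qed
    have "odd (lead_coeff A)" using lc AB(2) by (simp add: lead_coeff_mult)
    then have ex: "\<exists>i. odd (coeff A i)" by blast
    define i where "i = (LEAST i. odd (coeff A i))"
    have i1: "odd (coeff A i)" unfolding i_def using ex by (rule LeastI_ex)
    have i2: "even (coeff A j)" if "j < i" for j
      using not_less_Least[OF that[unfolded i_def]] by simp
    note i = i1 i2
    have "i \<le> degree A" by (rule le_degree) (use i(1) in auto)
    then have "even (coeff G i)" using AB(1) by (intro ev) simp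
    moreover have "coeff G i = (\<Sum>j<i. coeff A j * coeff B (i - j)) + coeff A i * coeff B 0"
      unfolding AB(2) coeff_mult by (simp add: lessThan_Suc_atMost[symmetric])
    moreover have "even (\<Sum>j<i. coeff A j * coeff B (i - j))" using i(2) by (intro dvd_sum) auto
    ultimately show False using i(1) oddB by simp
  qed
  have "coeff G 0 = coeff A 0 * coeff B 0" using AB by (simp add: coeff_mult)
  then have "even (coeff A 0) \<or> even (coeff B 0)" using ev[OF deg] by auto
  then show False using key[of A B] key[of B A] AB by (auto simp: mult.commute)
qed

text \<open>
  The predicate \<open>irreducible\<^sub>d\<close> excludes only factors of smaller degree, so \<open>G\<close> may still have a content; up to sign
  it is the factor \<open>c\<close>.
\<close>

lemma irreducible_imp_smult_min_int_poly:
  assumes irr: "irreducible\<^sub>d G" and root: "poly (map_poly of_int G) (\<alpha> :: 'a :: field_char_0) = 0"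
  obtains c where "c \<noteq> 0" "G = smult c (min_int_poly \<alpha>)"
proof -
  have G0: "G \<noteq> 0" using irr by auto
  let ?p = "primitive_part G"
  have G: "G = smult (content G) ?p" by simp
  have cG: "content G \<noteq> 0" using G0 by simp
  have p: "irreducible ?p" using irr irreducible\<^sub>d_as_irreducible by blast
  have rp: "poly (map_poly of_int ?p) \<alpha> = 0"
  proof -
    have "poly (map_poly of_int (smult (content G) ?p)) \<alpha> = 0" using root G by simp
    then show ?thesis using cG unfolding map_poly_of_int_smult by simp
  qed
  define m where "m = (if lead_coeff ?p > 0 then ?p else - ?p)"
  have "?p \<noteq> 0" using cG G0 by simp
  then have "lead_coeff ?p \<noteq> 0" using leading_coeff_0_iff by blast
  then have "lead_coeff m > 0" unfolding m_def lead_coeff_minus by (simp add: not_less order.order_iff_strict)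
  moreover have "irreducible m" using p irreducible_mult_unit_left[of "- 1" ?p] by (simp add: m_def)
  moreover have "poly (map_poly of_int m) \<alpha> = 0"
    using rp map_poly_of_int_smult[of "- 1" ?p, where 'a = 'a] by (simp add: m_def)
  ultimately have m: "irreducible m \<and> lead_coeff m > 0 \<and> poly (map_poly of_int m) \<alpha> = 0" by blast
  have "algebraic \<alpha>" using G0 root by (intro algebraicI[of "map_poly of_int G"]) auto
  then have "min_int_poly \<alpha> = m"
    unfolding min_int_poly_def by (rule the1_equality[OF ex1_min_int_poly m])
  moreover have "G = smult (if lead_coeff ?p > 0 then content G else - content G) m"
    unfolding m_def using G by simp
  ultimately show ?thesis using cG by (intro that[of "if lead_coeff ?p > 0 then content G else - content G"]) auto
qed

lemma irreducible_imp_conjugate: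
  assumes "irreducible\<^sub>d G" "poly (map_poly of_int G) (\<alpha> :: 'a :: field_char_0) = 0" "poly (map_poly of_int G) \<beta> = 0"
  shows "alg_conjugate \<alpha> \<beta>"
proof -
  have "irreducible\<^sub>d (map_poly rat_of_int G)" by (rule irreducible\<^sub>d_int_rat[OF assms(1)])
  then have "irreducible (map_poly rat_of_int G)" by simp
  then show ?thesis unfolding alg_conjugate_def using assms by blast
qed

lemma coeff_min_int_poly_le: "\<bar>coeff (min_int_poly \<alpha>) i\<bar> \<le> alg_height \<alpha>"
proof (cases "i \<le> alg_degree \<alpha>")
  case True
  then show ?thesis unfolding alg_height_def by (intro Max_ge) auto
next
  case False
  have "\<bar>coeff (min_int_poly \<alpha>) 0\<bar> \<le> alg_height \<alpha>" unfolding alg_height_def by (intro Max_ge) auto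
  then show ?thesis using False by (simp add: alg_degree_def coeff_eq_0)
qed

lemma alg_height_attained: obtains i where "alg_height \<alpha> = \<bar>coeff (min_int_poly \<alpha>) i\<bar>"
proof -
  have "alg_height \<alpha> \<in> (\<lambda>i. \<bar>coeff (min_int_poly \<alpha>) i\<bar>) ` {..alg_degree \<alpha>}"
    unfolding alg_height_def by (intro Max_in) auto
  then show ?thesis using that by blast
qed

lemma min_int_poly_root:
  assumes "algebraic \<alpha>"
  shows "min_int_poly \<alpha> \<noteq> 0" "poly (map_poly of_int (min_int_poly \<alpha>)) \<alpha> = 0"
  using theI'[OF ex1_min_int_poly[OF assms]] unfolding min_int_poly_def[symmetric] by auto

lemma finite_bounded_height:
  "finite {\<alpha> :: 'a :: field_char_0. algebraic \<alpha> \<and> alg_degree \<alpha> \<le> N \<and> alg_height \<alpha> \<le> H}"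
proof -
  define P where "P = (\<lambda>f. Poly (map f [0..<N + 1])) ` ({..N} \<rightarrow>\<^sub>E {- H..H})"
  have finP: "finite P" unfolding P_def by (intro finite_imageI finite_PiE) auto
  have "{\<alpha> :: 'a. algebraic \<alpha> \<and> alg_degree \<alpha> \<le> N \<and> alg_height \<alpha> \<le> H} \<subseteq>
     (\<Union>p\<in>P - {0}. {\<alpha>. poly (map_poly of_int p) \<alpha> = 0})"
  proof safe
    fix \<alpha> :: 'a assume a: "algebraic \<alpha>" "alg_degree \<alpha> \<le> N" "alg_height \<alpha> \<le> H"
    define p where "p = min_int_poly \<alpha>"
    have "p = Poly (map (restrict (coeff p) {..N}) [0..<N + 1])"
      using a(2) by (intro poly_eqI)
        (auto simp: nth_default_def p_def alg_degree_def coeff_eq_0 simp del: upt_Suc)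
    moreover have "restrict (coeff p) {..N} \<in> {..N} \<rightarrow>\<^sub>E {- H..H}"
    proof (rule restrict_PiE_iff[THEN iffD2], intro ballI)
      fix i
      have "\<bar>coeff p i\<bar> \<le> H" unfolding p_def using coeff_min_int_poly_le[of \<alpha> i] a(3) by linarith
      then show "coeff p i \<in> {- H..H}" by auto
    qed
    ultimately have "p \<in> P" unfolding P_def by blast
    then show "\<alpha> \<in> (\<Union>p\<in>P - {0}. {\<alpha>. poly (map_poly of_int p) \<alpha> = 0})"
      using min_int_poly_root[OF a(1)] unfolding p_def by blast
  qed
  moreover have "finite (\<Union>p\<in>P - {0}. {\<alpha> :: 'a. poly (map_poly of_int p) \<alpha> = 0})"
    using finP by (intro finite_UN_I poly_roots_finite) auto
  ultimately show ?thesis by (rule finite_subset)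
qed

text \<open>
  The remainders satisfy \<open>r (k + 1) = y * r k + k * x ^ (k - 1) * (y - x)\<^sup>2\<close>. The bounds 3 and 1 cover the
  points at distance at most \<open>2 \<delta> \<le> 2\<close> from the unit interval.
\<close>

lemma power_taylor2:
  fixes x y :: real
  assumes "\<bar>y\<bar> \<le> 3" "\<bar>x\<bar> \<le> 1"
  shows "\<bar>y ^ k - x ^ k - real k * x ^ (k - 1) * (y - x)\<bar> \<le> 4 ^ k * (y - x)\<^sup>2"
proof (induction k)
  case (Suc k)
  let ?r = "\<lambda>k. y ^ k - x ^ k - real k * x ^ (k - 1) * (y - x)"
  have eq: "?r (Suc k) = y * ?r k + real k * x ^ (k - 1) * (y - x)\<^sup>2"
    by (cases k) (simp_all add: algebra_simps power2_eq_square)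
  have "\<bar>y * ?r k\<bar> \<le> 3 * (4 ^ k * (y - x)\<^sup>2)"
    unfolding abs_mult using assms Suc by (intro mult_mono) auto
  moreover have "\<bar>real k * x ^ (k - 1) * (y - x)\<^sup>2\<bar> \<le> 4 ^ k * 1 * (y - x)\<^sup>2"
  proof -
    have "k < 2 ^ k" by (rule less_exp)
    also have "(2 :: nat) ^ k \<le> 4 ^ k" by (intro power_mono) auto
    finally have "k \<le> 4 ^ k" by simp
    then have "real k \<le> real (4 ^ k)" by (simp only: of_nat_le_iff)
    then have "real k \<le> 4 ^ k" by simp
    moreover have "\<bar>x ^ (k - 1)\<bar> \<le> 1" using assms by (simp add: power_abs power_le_one)
    ultimately show ?thesis unfolding abs_mult by (intro mult_mono) auto
  qed
  ultimately have "\<bar>?r (Suc k)\<bar> \<le> 3 * (4 ^ k * (y - x)\<^sup>2) + 4 ^ k * 1 * (y - x)\<^sup>2"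
    unfolding eq by linarith
  then show ?case by simp
qed simp

definition taylor2_const :: "nat \<Rightarrow> real" where
  "taylor2_const n = (real n + 2) * 4 ^ (n + 1)"

lemma poly_taylor2:
  fixes p :: "real poly"
  assumes deg: "degree p \<le> n + 1" and H: "\<And>i. \<bar>coeff p i\<bar> \<le> H" and xy: "\<bar>y\<bar> \<le> 3" "\<bar>x\<bar> \<le> 1"
  shows "\<bar>poly p y - poly p x - poly (pderiv p) x * (y - x)\<bar> \<le> taylor2_const n * H * (y - x)\<^sup>2"
proof -
  have H0: "H \<ge> 0" using H[of 0] by linarith
  have val: "poly p z = (\<Sum>k\<le>n + 1. coeff p k * z ^ k)" for z
    unfolding poly_altdef using deg by (intro sum.mono_neutral_left) (auto simp: coeff_eq_0)
  have der: "poly (pderiv p) x = (\<Sum>k\<le>n + 1. coeff p k * (real k * x ^ (k - 1)))"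
  proof -
    have "((\<lambda>z. \<Sum>k\<le>n + 1. coeff p k * z ^ k) has_real_derivative (\<Sum>k\<le>n + 1. coeff p k * (real k * x ^ (k - 1)))) (at x)"
      by (intro DERIV_sum DERIV_cmult) (use DERIV_pow in simp)
    moreover have "((\<lambda>z. \<Sum>k\<le>n + 1. coeff p k * z ^ k) has_real_derivative poly (pderiv p) x) (at x)"
      using poly_DERIV[of p x] unfolding val[abs_def] .
    ultimately show ?thesis using DERIV_unique by blast
  qed
  have "poly p y - poly p x - poly (pderiv p) x * (y - x) =
     (\<Sum>k\<le>n + 1. coeff p k * (y ^ k - x ^ k - real k * x ^ (k - 1) * (y - x)))"
    unfolding val der by (simp only: sum_distrib_right sum_subtractf[symmetric] right_diff_distrib mult.assoc)
  also have "\<bar>\<dots>\<bar> \<le> (\<Sum>k\<le>n + 1. H * (4 ^ (n + 1) * (y - x)\<^sup>2))"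
  proof (rule order_trans[OF sum_abs sum_mono])
    fix k assume k: "k \<in> {..n + 1}"
    have "\<bar>y ^ k - x ^ k - real k * x ^ (k - 1) * (y - x)\<bar> \<le> 4 ^ k * (y - x)\<^sup>2"
      by (rule power_taylor2[OF xy])
    also have "\<dots> \<le> 4 ^ (n + 1) * (y - x)\<^sup>2" using k by (intro mult_right_mono power_increasing) auto
    finally show "\<bar>coeff p k * (y ^ k - x ^ k - real k * x ^ (k - 1) * (y - x))\<bar> \<le> H * (4 ^ (n + 1) * (y - x)\<^sup>2)"
      unfolding abs_mult using H H0 by (intro mult_mono) auto
  qed
  also have "\<dots> = taylor2_const n * H * (y - x)\<^sup>2" by (simp add: taylor2_const_def algebra_simps)
  finally show ?thesis .
qed

section \<open>Polynomials with two close roots\<close>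

text \<open>
  Four times the bound for the covering radius, since the matching is done over the multiples of 4.
\<close>

definition err_const :: "nat \<Rightarrow> real \<Rightarrow> real" where
  "err_const n e = 4 * ((separation_bound n e + 2) * e)"

text \<open>
  The factor \<open>M\<close> of the target \<open>M Q ((y - x)\<^sup>2 - \<delta>\<^sup>2)\<close>. It dominates the error terms at the distances
  \<open>\<delta> / 2\<close> and \<open>2 \<delta>\<close> from \<open>x\<close>, and the second order terms that a polynomial with coefficients
  below \<open>Q\<close> can have.
\<close>

definition curvature_const :: "nat \<Rightarrow> real \<Rightarrow> real" where
  "curvature_const n e = 4 * taylor2_const n + 6 * err_const n e + 4 * taylor2_const n * err_const n e + 1"

definition height_const :: "nat \<Rightarrow> real \<Rightarrow> real" where
  "height_const n e = 2 * curvature_const n e + real n + 4 + err_const n e"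

lemma consts_pos:
  assumes "e > 0"
  shows "err_const n e > 0" "taylor2_const n > 0" "curvature_const n e > 0" "height_const n e > 0"
proof -
  have "separation_bound n e \<ge> 0" unfolding separation_bound_def using assms by simp
  then show K: "err_const n e > 0" unfolding err_const_def using assms by simp
  show B: "taylor2_const n > 0" unfolding taylor2_const_def by (simp add: add_nonneg_pos)
  show M: "curvature_const n e > 0" unfolding curvature_const_def using K B by (simp add: add_pos_pos)
  show "height_const n e > 0" unfolding height_const_def using K M by (simp add: add_pos_pos)
qed

text \<open>
  The integer polynomial is \<open>y ^ N + 2 + 4 R\<close>, which satisfies Eisenstein's criterion whatever \<open>R\<close> of
  degree at most \<open>n\<close> is. The freedom in \<open>R\<close> is used to match the target \<open>L\<close>; the monomial \<open>y ^ N\<close>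
  is part of what is matched if \<open>N = n\<close>, and it is kept apart if \<open>N = n + 1\<close>.
\<close>

lemma ex_polynomial_near_target:
  assumes n: "n \<ge> 2" and N: "N = n \<or> N = n + 1" and Q: "Q \<ge> 1"
    and \<delta>: "0 < \<delta>" "\<delta> \<le> 1" "\<delta> ^ 3 * Q ^ (n + 1) = 1"
    and x: "x \<in> {0..1}" and e: "e > 0" and good: "good_point n (weight Q \<delta>) e x"
    and L: "degree (L :: real poly) \<le> n"
  obtains G :: "int poly" and E :: "real poly" where
    "degree G = N" "lead_coeff G = 1 \<or> N = n" "irreducible\<^sub>d G" "degree E \<le> n"
    "of_int_poly G = (if N = n then 0 else monom 1 N) + L + E"
    "obs_norm n (weight Q \<delta>) x E \<le> err_const n e"
proof -
  define P0 :: "int poly" where "P0 = (if N = n then monom 1 n else 0) + [:2:]"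
  define T where "T = smult (1/4) (L - of_int_poly P0)"
  have degP0: "degree P0 \<le> n" unfolding P0_def by (auto intro!: degree_add_le simp: degree_monom_eq)
  have "degree T \<le> n" unfolding T_def
    using L degP0 by (auto intro!: degree_diff_le order_trans[OF degree_map_poly_le])
  then obtain R where R: "degree R \<le> n" "obs_norm n (weight Q \<delta>) x (T - of_int_poly R) \<le> (separation_bound n e + 2) * e"
    using covering_radius_bounded[OF Q \<delta> x e good] by blast
  define G :: "int poly" where "G = monom 1 N + [:2:] + smult 4 R"
  define E where "E = smult (- 4) (T - of_int_poly R)"
  have "N > 0" using n N by auto
  have G_lt: "coeff G i = (if i = 0 then 2 else 0) + 4 * coeff R i" if "i < N" for i
    using that by (auto simp: G_def coeff_pCons split: nat.splits)
  have G_N: "coeff G N = 1 + 4 * coeff R N"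
    using \<open>N > 0\<close> by (auto simp: G_def coeff_pCons split: nat.splits)
  have "degree G \<le> N" unfolding G_def using N R(1) by (auto intro!: degree_add_le simp: degree_monom_eq)
  moreover have "coeff G N \<noteq> 0" unfolding G_N by presburger
  ultimately have degG: "degree G = N" using le_degree[of G N] by auto
  show ?thesis
  proof (rule that[of G E])
    show "degree G = N" by (rule degG)
    show "lead_coeff G = 1 \<or> N = n"
      using N R(1) unfolding degG G_N by (auto simp: coeff_eq_0)
    show "irreducible\<^sub>d G"
    proof (rule eisenstein_2)
      show "degree G > 0" using degG \<open>N > 0\<close> by simp
      show "odd (lead_coeff G)" unfolding degG G_N by simp
      show "even (coeff G i)" if "i < degree G" for i using that G_lt[of i] unfolding degG by simp
      have "coeff G 0 = 2 + 4 * coeff R 0" using G_lt[of 0] \<open>N > 0\<close> by simp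
      then show "\<not> 4 dvd coeff G 0" by presburger
    qed
    show "degree E \<le> n" unfolding E_def using \<open>degree T \<le> n\<close> R(1)
      by (auto intro!: degree_diff_le order_trans[OF degree_map_poly_le])
    show "of_int_poly G = (if N = n then 0 else monom 1 N) + L + E"
      unfolding G_def E_def T_def P0_def using N
      by (auto simp: of_int_poly_hom.hom_add of_int_hom.map_poly_hom_smult of_int_hom.map_poly_hom_monom
          smult_diff_right smult_add_right map_poly_pCons)
    have "obs_norm n (weight Q \<delta>) x E \<le> \<bar>- 4\<bar> * obs_norm n (weight Q \<delta>) x (T - of_int_poly R)"
      unfolding E_def by (rule obs_norm_smult_le)
    then show "obs_norm n (weight Q \<delta>) x E \<le> err_const n e" unfolding err_const_def using R(2) by simp
  qed
qed

text \<open>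
  With the target \<open>M Q ((y - x)\<^sup>2 - \<delta>\<^sup>2)\<close> the matching polynomial is negative at distance \<open>\<delta> / 2\<close> from \<open>x\<close>
  and positive at distance \<open>2 \<delta>\<close>, on both sides. If \<open>N = n + 1\<close>, the value and the derivative of the extra monomial \<open>F\<close> at \<open>x\<close> are compensated in the target;
  its second order part is bounded independently of \<open>Q\<close>.
\<close>

lemma ex_polynomial_with_close_roots:
  assumes n: "n \<ge> 2" and N: "N = n \<or> N = n + 1" and Q: "Q \<ge> 1"
    and \<delta>: "0 < \<delta>" "\<delta> \<le> 1" "\<delta> ^ 3 * Q ^ (n + 1) = 1"
    and x: "x \<in> {0..1}" and e: "e > 0" and good: "good_point n (weight Q \<delta>) e x"
  obtains G :: "int poly" and \<alpha> \<beta> :: real where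
    "degree G = N" "lead_coeff G = 1 \<or> N = n" "irreducible\<^sub>d G"
    "poly (of_int_poly G) \<alpha> = 0" "poly (of_int_poly G) \<beta> = 0"
    "\<bar>\<alpha> - x\<bar> \<le> 2 * \<delta>" "\<delta> \<le> \<bar>\<alpha> - \<beta>\<bar>" "\<bar>\<alpha> - \<beta>\<bar> \<le> 4 * \<delta>"
    "\<And>i. \<bar>real_of_int (coeff G i)\<bar> \<le> height_const n e * Q" "\<exists>i. Q \<le> \<bar>real_of_int (coeff G i)\<bar>"
    "obs_norm n (weight Q \<delta>) x (of_int_poly G) \<le> height_const n e"
proof -
  let ?w = "weight Q \<delta>"
  define K where "K = err_const n e"
  define B where "B = taylor2_const n"
  define M where "M = curvature_const n e"
  define H where "H = height_const n e"
  have pos: "K > 0" "B > 0" "M > 0" "H > 0" unfolding K_def B_def M_def H_def using consts_pos[OF e] by auto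
  have M: "M = 4 * B + 6 * K + 4 * (B * K) + 1" unfolding M_def curvature_const_def B_def K_def by simp
  have H: "H = 2 * M + real n + 4 + K" unfolding H_def height_const_def M_def K_def by simp
  define F :: "real poly" where "F = (if N = n then 0 else monom 1 N)"
  have F: "degree F \<le> n + 1" "\<bar>coeff F i\<bar> \<le> 1" for i
    unfolding F_def using N by (auto simp: degree_monom_eq)
  define a b where "a = poly F x" and "b = poly (pderiv F) x"
  have ab: "\<bar>a\<bar> \<le> 1" "\<bar>b\<bar> \<le> real n + 1"
  proof -
    have "\<bar>x ^ k\<bar> \<le> 1" for k using x by (simp add: power_abs power_le_one)
    then show "\<bar>a\<bar> \<le> 1" unfolding a_def F_def by (auto simp: poly_monom)
    have "\<bar>real (n + 1) * x ^ n\<bar> \<le> (real n + 1) * 1"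
      using \<open>\<And>k. \<bar>x ^ k\<bar> \<le> 1\<close>[of n] unfolding abs_mult by (intro mult_mono) auto
    then show "\<bar>b\<bar> \<le> real n + 1" unfolding b_def F_def using N
      by (auto simp: pderiv_monom poly_monom)
  qed
  \<comment> \<open>The linear part cancels the tangent of \<open>F\<close> at \<open>x\<close>.\<close>
  define L where "L = [:- a + b * x + M * Q * (x\<^sup>2 - \<delta>\<^sup>2), - b - 2 * (M * Q * x), M * Q:]"
  have L: "poly L y = M * Q * ((y - x)\<^sup>2 - \<delta>\<^sup>2) - a - b * (y - x)"
    "poly (pderiv L) x = - b" for y
    unfolding L_def by (simp_all add: pderiv_pCons algebra_simps power2_eq_square)
  have degL: "degree L \<le> n" using n unfolding L_def by (auto intro: degree_pCons_le order_trans)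
  obtain G :: "int poly" and E where G: "degree G = N" "lead_coeff G = 1 \<or> N = n" "irreducible\<^sub>d G"
    and E: "degree E \<le> n" "of_int_poly G = F + L + E" "obs_norm n ?w x E \<le> K"
    using ex_polynomial_near_target[OF n N Q \<delta> x e good degL] unfolding F_def K_def by metis
  let ?G = "of_int_poly G :: real poly"
  have Ec: "?w c * \<bar>poly (obs c E) x\<bar> \<le> K" if "c < n + 3" for c
    using E(3) that unfolding obs_norm_le_iff by blast
  have E0: "\<bar>poly E x\<bar> \<le> K * (Q * \<delta>\<^sup>2)" using Ec[of 0] Q \<delta> by (simp add: weight_def field_simps)
  have E1: "\<bar>poly (pderiv E) x\<bar> \<le> K * (Q * \<delta>)" using Ec[of 1] Q \<delta> by (simp add: weight_def field_simps)
  have Ei: "\<bar>coeff E i\<bar> \<le> K * Q" for i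
  proof (cases "i \<le> n")
    case True
    then show ?thesis using Ec[of "2 + i"] Q by (simp add: weight_def field_simps)
  next
    case False
    then show ?thesis using E(1) pos Q by (simp add: coeff_eq_0)
  qed
  have quad: "\<bar>poly ?G (x + h) - M * Q * (h\<^sup>2 - \<delta>\<^sup>2) - poly E x - poly (pderiv E) x * h\<bar> \<le> (B + B * K) * Q * h\<^sup>2"
    if h: "\<bar>h\<bar> \<le> 2 * \<delta>" for h
  proof -
    have y: "\<bar>x + h\<bar> \<le> 3" "\<bar>x\<bar> \<le> 1" using x h \<delta> by auto
    have "\<bar>poly F (x + h) - a - b * h\<bar> \<le> B * 1 * h\<^sup>2"
      using poly_taylor2[OF F(1) F(2) y] unfolding a_def b_def B_def by simp
    also have "\<dots> \<le> B * Q * h\<^sup>2" using pos Q by (intro mult_right_mono mult_left_mono) auto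
    finally have 1: "\<bar>poly F (x + h) - a - b * h\<bar> \<le> B * Q * h\<^sup>2" .
    have 2: "\<bar>poly E (x + h) - poly E x - poly (pderiv E) x * h\<bar> \<le> B * (K * Q) * h\<^sup>2"
      using poly_taylor2[OF _ Ei y, of n] E(1) unfolding B_def by simp
    have "poly ?G (x + h) - M * Q * (h\<^sup>2 - \<delta>\<^sup>2) - poly E x - poly (pderiv E) x * h =
      (poly F (x + h) - a - b * h) + (poly E (x + h) - poly E x - poly (pderiv E) x * h)"
      unfolding E(2) by (simp add: L)
    then have "\<bar>poly ?G (x + h) - M * Q * (h\<^sup>2 - \<delta>\<^sup>2) - poly E x - poly (pderiv E) x * h\<bar> \<le>
       B * Q * h\<^sup>2 + B * (K * Q) * h\<^sup>2" using 1 2 by linarith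
    then show ?thesis by (simp add: algebra_simps)
  qed
  have Gx: "poly ?G x = poly E x - M * Q * \<delta>\<^sup>2" and G'x: "poly (pderiv ?G) x = poly (pderiv E) x"
    unfolding E(2) by (simp_all add: L pderiv_add a_def b_def algebra_simps)
  have near: "\<bar>poly ?G (x + s * \<delta>) - M * (s\<^sup>2 - 1) * (Q * \<delta>\<^sup>2)\<bar> \<le> ((B + B * K) * s\<^sup>2 + K + K * \<bar>s\<bar>) * (Q * \<delta>\<^sup>2)"
    if s: "\<bar>s\<bar> \<le> 2" for s
  proof -
    have "\<bar>s * \<delta>\<bar> \<le> 2 * \<delta>" using s \<delta> by (simp add: abs_mult)
    note q = quad[OF this]
    have "\<bar>poly (pderiv E) x * (s * \<delta>)\<bar> \<le> (K * (Q * \<delta>)) * (\<bar>s\<bar> * \<delta>)"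
      unfolding abs_mult using E1 \<delta> by (intro mult_mono) auto
    also have "\<dots> = K * \<bar>s\<bar> * (Q * \<delta>\<^sup>2)" by (simp add: power2_eq_square)
    finally have e1: "\<bar>poly (pderiv E) x * (s * \<delta>)\<bar> \<le> K * \<bar>s\<bar> * (Q * \<delta>\<^sup>2)" .
    have q': "(B + B * K) * Q * (s * \<delta>)\<^sup>2 = (B + B * K) * s\<^sup>2 * (Q * \<delta>\<^sup>2)"
      "M * Q * ((s * \<delta>)\<^sup>2 - \<delta>\<^sup>2) = M * (s\<^sup>2 - 1) * (Q * \<delta>\<^sup>2)"
      by (simp_all add: power_mult_distrib algebra_simps)
    have "\<bar>poly ?G (x + s * \<delta>) - M * (s\<^sup>2 - 1) * (Q * \<delta>\<^sup>2)\<bar> \<le>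
       (B + B * K) * s\<^sup>2 * (Q * \<delta>\<^sup>2) + K * (Q * \<delta>\<^sup>2) + K * \<bar>s\<bar> * (Q * \<delta>\<^sup>2)"
      using q[unfolded q'] E0 e1 by linarith
    then show ?thesis by (simp add: distrib_right)
  qed
  have qd: "Q * \<delta>\<^sup>2 > 0" using Q \<delta> by simp
  have BK: "B * K > 0" using pos by simp
  have MZ: "M = 4 * (B + B * K) + 6 * K + 1" "0 < B + B * K"
    using M add_pos_pos[OF pos(2) BK] by simp_all
  have outer: "poly ?G (x + s * \<delta>) > 0" if s: "\<bar>s\<bar> = 2" for s
  proof -
    have s2: "s\<^sup>2 = 4" using s power2_abs[of s] by simp
    have "0 < 3 * M - (4 * z + 3 * K)" if "M = 4 * z + 6 * K + 1" "0 < z" for z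
      using that pos by linarith
    then have "0 < 3 * M - (4 * (B + B * K) + 3 * K)" using MZ by blast
    then have "0 < (3 * M - (4 * (B + B * K) + 3 * K)) * (Q * \<delta>\<^sup>2)" using qd by (rule mult_pos_pos)
    moreover have "\<bar>poly ?G (x + s * \<delta>) - 3 * M * (Q * \<delta>\<^sup>2)\<bar> \<le> (4 * (B + B * K) + 3 * K) * (Q * \<delta>\<^sup>2)"
      using near[of s] s by (simp add: s2 algebra_simps)
    ultimately show ?thesis unfolding left_diff_distrib by linarith
  qed
  have inner: "poly ?G (x + s * \<delta>) < 0" if s: "\<bar>s\<bar> = 1/2" for s
  proof -
    have "s\<^sup>2 = (1/2)\<^sup>2" unfolding s[symmetric] by simp
    then have s2: "s\<^sup>2 = 1/4" by (simp add: power_divide)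
    have "0 < 3/4 * M - (z / 4 + 3/2 * K)" if "M = 4 * z + 6 * K + 1" "0 < z" for z
      using that pos by linarith
    then have "0 < 3/4 * M - ((B + B * K) / 4 + 3/2 * K)" using MZ by blast
    then have "0 < (3/4 * M - ((B + B * K) / 4 + 3/2 * K)) * (Q * \<delta>\<^sup>2)" using qd by (rule mult_pos_pos)
    moreover have "\<bar>poly ?G (x + s * \<delta>) + 3/4 * M * (Q * \<delta>\<^sup>2)\<bar> \<le> ((B + B * K) / 4 + 3/2 * K) * (Q * \<delta>\<^sup>2)"
      using near[of s] s by (simp add: s2 algebra_simps)
    ultimately show ?thesis unfolding left_diff_distrib by linarith
  qed
  obtain \<alpha> where \<alpha>: "x + - 2 * \<delta> < \<alpha>" "\<alpha> < x + - (1/2) * \<delta>" "poly ?G \<alpha> = 0"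
    using poly_IVT_neg[of "x + - 2 * \<delta>" "x + - (1/2) * \<delta>" ?G] outer[of "- 2"] inner[of "- (1/2)"] \<delta> by auto
  obtain \<beta> where \<beta>: "x + (1/2) * \<delta> < \<beta>" "\<beta> < x + 2 * \<delta>" "poly ?G \<beta> = 0"
    using poly_IVT_pos[of "x + (1/2) * \<delta>" "x + 2 * \<delta>" ?G] outer[of 2] inner[of "1/2"] \<delta> by auto
  have Gi: "\<bar>real_of_int (coeff G i)\<bar> \<le> H * Q" for i
  proof -
    have MQ: "M * Q > 0" using pos Q by simp
    have tri: "\<bar>- a + u + v\<bar> \<le> real n + 2 + 2 * z"
      if "\<bar>u\<bar> \<le> (real n + 1) * 1" "\<bar>v\<bar> \<le> z * 1" "z > 0" for u v z :: real
      using that ab(1) by (simp add: abs_le_iff)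
    have tri': "\<bar>- b - 2 * u\<bar> \<le> real n + 2 + 2 * z" if "\<bar>u\<bar> \<le> z * 1" for u z :: real
      using that ab(2) by (simp add: abs_le_iff)
    have "\<bar>b * x\<bar> \<le> (real n + 1) * 1" unfolding abs_mult using ab x by (intro mult_mono) auto
    moreover have "\<bar>M * Q * (x\<^sup>2 - \<delta>\<^sup>2)\<bar> \<le> (M * Q) * 1"
    proof -
      have "0 \<le> x\<^sup>2" "x\<^sup>2 \<le> 1" "0 \<le> \<delta>\<^sup>2" "\<delta>\<^sup>2 \<le> 1" using x \<delta> by (auto simp: power_le_one)
      then have "\<bar>x\<^sup>2 - \<delta>\<^sup>2\<bar> \<le> 1" by linarith
      then show ?thesis using MQ unfolding abs_mult[of "M * Q"] by (intro mult_mono) auto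
    qed
    ultimately have 0: "\<bar>- a + b * x + M * Q * (x\<^sup>2 - \<delta>\<^sup>2)\<bar> \<le> real n + 2 + 2 * (M * Q)"
      using MQ by (rule tri)
    have "\<bar>M * Q * x\<bar> \<le> M * Q * 1" using MQ x unfolding abs_mult[of "M * Q"] by (intro mult_mono) auto
    then have 1: "\<bar>- b - 2 * (M * Q * x)\<bar> \<le> real n + 2 + 2 * (M * Q)" by (rule tri')
    have "\<bar>coeff L i\<bar> \<le> real n + 2 + 2 * (M * Q)"
      unfolding L_def using 0 1 MQ by (auto simp: coeff_pCons split: nat.split)
    moreover have "real_of_int (coeff G i) = coeff F i + coeff L i + coeff E i"
      using arg_cong[OF E(2), of "\<lambda>p. coeff p i"] by simp
    ultimately have "\<bar>real_of_int (coeff G i)\<bar> \<le> 1 + (real n + 2 + 2 * (M * Q)) + K * Q"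
      using F(2)[of i] Ei[of i] by linarith
    also have "\<dots> = (real n + 3) * 1 + (2 * M + K) * Q" by (simp add: algebra_simps)
    also have "\<dots> \<le> (real n + 4) * Q + (2 * M + K) * Q" using Q by (intro add_right_mono mult_mono) auto
    also have "\<dots> = H * Q" by (simp add: H algebra_simps)
    finally show ?thesis .
  qed
  \<comment> \<open>Otherwise the second order remainder of the polynomial at \<open>x\<close> would be too small for its curvature.\<close>
  have Gbig: "\<exists>i. Q \<le> \<bar>real_of_int (coeff G i)\<bar>"
  proof (rule ccontr)
    assume "\<not> ?thesis"
    then have small: "\<bar>coeff ?G i\<bar> \<le> Q" for i by (auto simp: not_le intro: less_imp_le)
    have y: "\<bar>x + 2 * \<delta>\<bar> \<le> 3" "\<bar>x\<bar> \<le> 1" using x \<delta> by auto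
    have "degree ?G \<le> n + 1" using G(1) N by auto
    from poly_taylor2[OF this small y]
    have 1: "\<bar>poly ?G (x + 2 * \<delta>) - poly ?G x - poly (pderiv ?G) x * (2 * \<delta>)\<bar> \<le> B * Q * (2 * \<delta>)\<^sup>2"
      unfolding B_def by simp
    have 2: "\<bar>poly ?G (x + 2 * \<delta>) - M * Q * ((2 * \<delta>)\<^sup>2 - \<delta>\<^sup>2) - poly E x - poly (pderiv E) x * (2 * \<delta>)\<bar>
      \<le> (B + B * K) * Q * (2 * \<delta>)\<^sup>2" using \<delta> by (intro quad) auto
    have "M * Q * (2 * \<delta>)\<^sup>2 = M * Q * ((2 * \<delta>)\<^sup>2 - \<delta>\<^sup>2) + M * Q * \<delta>\<^sup>2" by (simp add: algebra_simps)
    then have "M * Q * (2 * \<delta>)\<^sup>2 \<le> B * Q * (2 * \<delta>)\<^sup>2 + (B + B * K) * Q * (2 * \<delta>)\<^sup>2"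
      using 1[unfolded Gx G'x] 2 by linarith
    also have "\<dots> = (2 * B + B * K) * (Q * (2 * \<delta>)\<^sup>2)" by (simp add: algebra_simps)
    finally have "M * (Q * (2 * \<delta>)\<^sup>2) \<le> (2 * B + B * K) * (Q * (2 * \<delta>)\<^sup>2)" by (simp add: mult.assoc)
    moreover have "Q * (2 * \<delta>)\<^sup>2 > 0" using Q \<delta> by simp
    ultimately have "M \<le> 2 * B + B * K" using mult_le_cancel_right_pos by blast
    then show False using M pos BK by linarith
  qed
  have "obs_norm n ?w x ?G \<le> H"
    unfolding obs_norm_le_iff
  proof (intro allI impI)
    fix c assume c: "c < n + 3"
    consider "c = 0" | "c = 1" | i where "c = 2 + i" by (metis One_nat_def add_2_eq_Suc not0_implies_Suc)
    then show "?w c * \<bar>poly (obs c ?G) x\<bar> \<le> H"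
    proof cases
      case 1
      have "\<bar>poly ?G x\<bar> \<le> (M + K) * (Q * \<delta>\<^sup>2)"
      proof -
        have "\<bar>u - v\<bar> \<le> v + z" if "\<bar>u\<bar> \<le> z" "0 < v" for u v z :: real using that by linarith
        from this[OF E0 mult_pos_pos[OF pos(3) qd]]
        show ?thesis unfolding Gx by (simp add: distrib_right mult.assoc)
      qed
      also have "\<dots> \<le> H * (Q * \<delta>\<^sup>2)" using qd pos by (intro mult_right_mono) (auto simp: H)
      finally show ?thesis using 1 qd by (simp add: weight_def field_simps)
    next
      case 2
      have "\<bar>poly (pderiv ?G) x\<bar> \<le> K * (Q * \<delta>)" unfolding G'x by (rule E1)
      also have "\<dots> \<le> H * (Q * \<delta>)" using Q \<delta> pos by (intro mult_right_mono) (auto simp: H)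
      finally show ?thesis using 2 Q \<delta> by (simp add: weight_def field_simps)
    next
      case 3
      then show ?thesis using Gi[of i] Q by (simp add: weight_def field_simps)
    qed
  qed
  then show ?thesis
    using that[of G \<alpha> \<beta>] G \<alpha> \<beta> Gi Gbig \<delta> unfolding H_def by auto
qed

text \<open>
  For the lower bound of the height the content \<open>k\<close> has to be bounded. In the monic case it is 1. In the other case
  \<open>G / k\<close> is an integer polynomial of degree \<open>n\<close>, and its norm at the good point \<open>x\<close> is at least \<open>e\<close>.
\<close>

lemma ex_algebraic_number_near_good_point:
  assumes n: "n \<ge> 2" and N: "N = n \<or> N = n + 1" and Q: "Q \<ge> 1"
    and \<delta>: "0 < \<delta>" "\<delta> \<le> 1" "\<delta> ^ 3 * Q ^ (n + 1) = 1"
    and x: "x \<in> {0..1}" and e: "e > 0" and good: "good_point n (weight Q \<delta>) e x"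
  obtains \<alpha> \<beta> :: real where
    "algebraic \<alpha>" "N = n + 1 \<Longrightarrow> algebraic_int \<alpha>" "alg_degree \<alpha> = N" "alg_conjugate \<alpha> \<beta>"
    "Q / max 1 (height_const n e / e) \<le> real_of_int (alg_height \<alpha>)"
    "real_of_int (alg_height \<alpha>) \<le> height_const n e * Q"
    "\<bar>\<alpha> - x\<bar> \<le> 2 * \<delta>" "\<delta> \<le> \<bar>\<alpha> - \<beta>\<bar>" "\<bar>\<alpha> - \<beta>\<bar> \<le> 4 * \<delta>"
proof -
  let ?w = "weight Q \<delta>" and ?H = "height_const n e"
  obtain G :: "int poly" and \<alpha> \<beta> :: real where G:
    "degree G = N" "lead_coeff G = 1 \<or> N = n" "irreducible\<^sub>d G"
    "poly (of_int_poly G) \<alpha> = 0" "poly (of_int_poly G) \<beta> = 0"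
    and ab: "\<bar>\<alpha> - x\<bar> \<le> 2 * \<delta>" "\<delta> \<le> \<bar>\<alpha> - \<beta>\<bar>" "\<bar>\<alpha> - \<beta>\<bar> \<le> 4 * \<delta>"
    and Gi: "\<And>i. \<bar>real_of_int (coeff G i)\<bar> \<le> ?H * Q" and Gbig: "\<exists>i. Q \<le> \<bar>real_of_int (coeff G i)\<bar>"
    and GN: "obs_norm n ?w x (of_int_poly G) \<le> ?H"
    using ex_polynomial_with_close_roots[OF n N Q \<delta> x e good] by metis
  define m where "m = min_int_poly \<alpha>"
  obtain k where k: "k \<noteq> 0" "G = smult k m"
    using irreducible_imp_smult_min_int_poly[OF G(3,4)] unfolding m_def by blast
  have G0: "G \<noteq> 0" using G(1) n N by auto
  have k1: "1 \<le> \<bar>real_of_int k\<bar>" using k(1) by linarith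
  have kG: "\<bar>real_of_int (coeff G i)\<bar> = \<bar>real_of_int k\<bar> * \<bar>real_of_int (coeff m i)\<bar>" for i
    unfolding k(2) by (simp add: abs_mult)
  have alg: "algebraic \<alpha>" using G0 G(4) by (intro algebraicI[of "of_int_poly G"]) auto
  have degm: "degree m = N" using k G(1) by simp
  have kle: "\<bar>real_of_int k\<bar> \<le> max 1 (?H / e)"
    using G(2)
  proof
    assume "lead_coeff G = 1"
    then have "k * lead_coeff m = 1" using k by simp
    then have "\<bar>k * lead_coeff m\<bar> = 1" by simp
    then have "\<bar>k\<bar> = 1" by (rule abs_zmult_eq_1)
    then have "\<bar>real_of_int k\<bar> = 1" by linarith
    then show ?thesis by simp
  next
    assume "N = n"
    moreover have "m \<noteq> 0" using G0 k by auto
    ultimately obtain c where c: "c < n + 3" "e \<le> ?w c * \<bar>poly (of_int_poly (obs c m)) x\<bar>"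
      using good degm unfolding good_point_def by blast
    have "\<bar>real_of_int k\<bar> * e \<le> \<bar>real_of_int k\<bar> * (?w c * \<bar>poly (of_int_poly (obs c m)) x\<bar>)"
      using c(2) by (intro mult_left_mono) auto
    also have "\<dots> = ?w c * \<bar>poly (obs c (of_int_poly G)) x\<bar>"
      unfolding obs_of_int_poly k(2) obs_smult of_int_hom.map_poly_hom_smult by (simp add: abs_mult)
    also have "\<dots> \<le> ?H" using GN c(1) unfolding obs_norm_le_iff by blast
    finally show ?thesis using e by (simp add: field_simps le_max_iff_disj)
  qed
  show ?thesis
  proof (rule that[of \<alpha> \<beta>])
    show "algebraic_int \<alpha>" if "N = n + 1"
    proof -
      have "lead_coeff G = 1" using G(2) that by simp
      then show ?thesis using G(4) by (intro algebraic_int.intros[of "of_int_poly G"]) auto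
    qed
    show "alg_degree \<alpha> = N" using degm unfolding m_def alg_degree_def .
    show "alg_conjugate \<alpha> \<beta>" by (rule irreducible_imp_conjugate[OF G(3-5)])
    show "real_of_int (alg_height \<alpha>) \<le> ?H * Q"
    proof -
      obtain i where i: "alg_height \<alpha> = \<bar>coeff m i\<bar>" using alg_height_attained unfolding m_def by blast
      have "1 * \<bar>real_of_int (coeff m i)\<bar> \<le> \<bar>real_of_int k\<bar> * \<bar>real_of_int (coeff m i)\<bar>"
        using k1 by (intro mult_right_mono) auto
      then show ?thesis using Gi[of i] unfolding kG i by simp
    qed
    show "Q / max 1 (?H / e) \<le> real_of_int (alg_height \<alpha>)"
    proof -
      obtain i where "Q \<le> \<bar>real_of_int (coeff G i)\<bar>" using Gbig by blast
      also have "\<dots> \<le> max 1 (?H / e) * \<bar>real_of_int (coeff m i)\<bar>"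
        unfolding kG using kle by (intro mult_right_mono) auto
      also have "\<bar>real_of_int (coeff m i)\<bar> \<le> real_of_int (alg_height \<alpha>)"
        using coeff_min_int_poly_le[of \<alpha> i] unfolding m_def by linarith
      finally have "Q \<le> max 1 (?H / e) * real_of_int (alg_height \<alpha>)"
        by (simp add: mult_left_mono)
      then show ?thesis by (simp add: field_simps)
    qed
  qed (fact alg ab)+
qed

text \<open>
  The intervals of length \<open>4 \<delta>\<close> around the points of \<open>S\<close> cover a set of measure at least \<open>1/2\<close>.
\<close>

lemma card_ge_by_covering:
  fixes S :: "real set"
  assumes S: "finite S" and \<delta>: "\<delta> > 0" and U: "U \<in> sets borel" "emeasure lborel U \<le> ennreal (1/2)"
    and near: "\<And>x. x \<in> {0..1} - U \<Longrightarrow> \<exists>\<alpha>\<in>S. \<bar>\<alpha> - x\<bar> \<le> 2 * \<delta>"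
  shows "1 / (8 * \<delta>) \<le> real (card S)"
proof -
  let ?C = "\<Union>\<alpha>\<in>S. {\<alpha> - 2 * \<delta>..\<alpha> + 2 * \<delta>}"
  have C: "?C \<in> sets borel" using S by (intro sets.finite_UN) auto
  have "{0..1} \<subseteq> U \<union> ?C"
  proof
    fix x :: real assume "x \<in> {0..1}"
    show "x \<in> U \<union> ?C"
    proof (cases "x \<in> U")
      case False
      then obtain \<alpha> where "\<alpha> \<in> S" "\<bar>\<alpha> - x\<bar> \<le> 2 * \<delta>" using near[of x] \<open>x \<in> {0..1}\<close> by blast
      then have "x \<in> {\<alpha> - 2 * \<delta>..\<alpha> + 2 * \<delta>}" by (auto simp: abs_le_iff)
      then show ?thesis using \<open>\<alpha> \<in> S\<close> by blast
    qed simp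
  qed
  then have "emeasure lborel {0..1::real} \<le> emeasure lborel (U \<union> ?C)"
    using U(1) C by (intro emeasure_mono) auto
  also have "\<dots> \<le> emeasure lborel U + emeasure lborel ?C"
    using U(1) C by (intro emeasure_subadditive) auto
  also have "emeasure lborel ?C \<le> (\<Sum>\<alpha>\<in>S. emeasure lborel {\<alpha> - 2 * \<delta>..\<alpha> + 2 * \<delta>})"
    using S by (intro emeasure_subadditive_finite) auto
  also have "\<dots> = ennreal (real (card S) * (4 * \<delta>))"
    using \<delta> by (simp add: ennreal_mult' ennreal_of_nat_eq_real_of_nat)
  finally have "1 \<le> emeasure lborel U + ennreal (real (card S) * (4 * \<delta>))"
    by (simp add: add_left_mono)
  also have "\<dots> \<le> ennreal (1/2) + ennreal (real (card S) * (4 * \<delta>))" using U(2) by (intro add_right_mono)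
  also have "\<dots> = ennreal (1/2 + real (card S) * (4 * \<delta>))" using \<delta> by (subst ennreal_plus) auto
  finally have "1 \<le> 1/2 + real (card S) * (4 * \<delta>)" by simp
  then show ?thesis using \<delta> by (simp add: field_simps)
qed

text \<open>
  The product of the weights of the value, the derivative and \<open>j\<close> coefficients is \<open>Q ^ (n - 1 - j)\<close>.
\<close>

lemma admissible_weight:
  assumes n: "n \<ge> 1" and Q: "Q \<ge> 1" and \<delta>: "\<delta> > 0" "\<delta> ^ 3 * Q ^ (n + 1) = 1" "Q * \<delta>\<^sup>2 \<le> 1"
  shows "admissible n (weight Q \<delta>)"
  unfolding admissible_def
proof (intro conjI allI impI)
  show "weight Q \<delta> c \<ge> 0" for c using Q \<delta> by (simp add: weight_def)
  show "1 \<le> weight Q \<delta> 0" using Q \<delta> by (simp add: weight_def)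
  show "weight Q \<delta> (2 + i) = weight Q \<delta> 2" for i by (simp add: weight_def)
  fix j assume j: "j < n"
  have "weight Q \<delta> 0 * weight Q \<delta> 1 * weight Q \<delta> 2 ^ j = 1 / (\<delta> ^ 3 * Q ^ (j + 2))"
    by (simp add: weight_def power2_eq_square power3_eq_cube power_one_over power_add field_simps)
  also have "1 \<le> 1 / (\<delta> ^ 3 * Q ^ (j + 2))"
  proof -
    have "\<delta> ^ 3 * Q ^ (j + 2) \<le> \<delta> ^ 3 * Q ^ (n + 1)"
      using j Q \<delta> by (intro mult_left_mono power_increasing) auto
    then have "\<delta> ^ 3 * Q ^ (j + 2) \<le> 1" unfolding \<delta>(2) .
    moreover have "0 < \<delta> ^ 3 * Q ^ (j + 2)" using Q \<delta> by simp
    ultimately show ?thesis by (simp only: le_divide_eq_1_pos)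
  qed
  finally show "1 \<le> weight Q \<delta> 0 * weight Q \<delta> 1 * weight Q \<delta> 2 ^ j" .
qed

text \<open>
  The two assertions of the corollary differ only in the degree \<open>N\<close> and in the predicate \<open>A\<close>.
\<close>

theorem many_close_conjugates:
  assumes n: "n \<ge> 2" and N: "N = n \<or> N = n + 1"
    and A: "\<And>\<alpha>. A \<alpha> \<longleftrightarrow> (if N = n then algebraic \<alpha> else algebraic_int \<alpha>)"
  shows "\<exists>c h H d D :: real. c > 0 \<and> h > 0 \<and> H > 0 \<and> d > 0 \<and> D > 0 \<and>
      (\<exists>Q\<^sub>0 > 1. \<forall>Q \<ge> Q\<^sub>0.
         real (card {\<alpha>\<^sub>1 :: real. A \<alpha>\<^sub>1 \<and> alg_degree \<alpha>\<^sub>1 = N \<and>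
           h * Q \<le> real_of_int (alg_height \<alpha>\<^sub>1) \<and> real_of_int (alg_height \<alpha>\<^sub>1) \<le> H * Q \<and>
           (\<exists>\<alpha>\<^sub>2 :: real. alg_conjugate \<alpha>\<^sub>1 \<alpha>\<^sub>2 \<and>
              d * Q powr (- (real n + 1) / 3) \<le> \<bar>\<alpha>\<^sub>1 - \<alpha>\<^sub>2\<bar> \<and>
              \<bar>\<alpha>\<^sub>1 - \<alpha>\<^sub>2\<bar> \<le> D * Q powr (- (real n + 1) / 3))})
         \<ge> c * Q powr ((real n + 1) / 3))"
proof -
  obtain e where e: "e > 0" and most: "\<And>w. admissible n w \<Longrightarrow>
      \<exists>U\<in>sets borel. emeasure lborel U \<le> ennreal (1/2) \<and> (\<forall>x\<in>{0..1} - U. good_point n w e x)"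
    using most_points_good[of n] n by auto
  define H where "H = height_const n e"
  define h where "h = 1 / max 1 (H / e)"
  have Hpos: "H > 0" and hpos: "h > 0" unfolding H_def h_def using consts_pos[OF e] by auto
  define S where "S Q = {\<alpha>\<^sub>1 :: real. A \<alpha>\<^sub>1 \<and> alg_degree \<alpha>\<^sub>1 = N \<and>
           h * Q \<le> real_of_int (alg_height \<alpha>\<^sub>1) \<and> real_of_int (alg_height \<alpha>\<^sub>1) \<le> H * Q \<and>
           (\<exists>\<alpha>\<^sub>2 :: real. alg_conjugate \<alpha>\<^sub>1 \<alpha>\<^sub>2 \<and>
              1 * Q powr (- (real n + 1) / 3) \<le> \<bar>\<alpha>\<^sub>1 - \<alpha>\<^sub>2\<bar> \<and>
              \<bar>\<alpha>\<^sub>1 - \<alpha>\<^sub>2\<bar> \<le> 4 * Q powr (- (real n + 1) / 3))}" for Q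
  have main: "1/8 * Q powr ((real n + 1) / 3) \<le> real (card (S Q))" if Q: "Q \<ge> 1" for Q
  proof -
    define \<delta> where "\<delta> = Q powr (- (real n + 1) / 3)"
    have \<delta>0: "0 < \<delta>" using Q unfolding \<delta>_def by simp
    have \<delta>1: "\<delta> \<le> 1" using Q powr_mono[of "- (real n + 1) / 3" 0 Q] unfolding \<delta>_def by simp
    have \<delta>3: "\<delta> ^ 3 * Q ^ (n + 1) = 1"
    proof -
      have "\<delta> ^ 3 = Q powr (- (real n + 1))" unfolding \<delta>_def using Q by (simp add: powr_power)
      moreover have "Q ^ (n + 1) = Q powr (real n + 1)" using Q powr_realpow[of Q "n + 1"] by (simp add: add.commute)
      ultimately show ?thesis using Q by (simp add: powr_add[symmetric])
    qed
    have \<delta>2: "Q * \<delta>\<^sup>2 \<le> 1"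
    proof -
      have "Q * \<delta>\<^sup>2 = Q powr 1 * Q powr (2 * (- (real n + 1) / 3))"
        unfolding \<delta>_def using Q by (simp add: powr_power)
      also have "\<dots> = Q powr (1 + 2 * (- (real n + 1) / 3))" by (simp add: powr_add)
      also have "\<dots> \<le> Q powr 0"
      proof (rule powr_mono[OF _ Q])
        have "2 \<le> real n" using n by simp
        then show "1 + 2 * (- (real n + 1) / 3) \<le> 0" by (simp add: field_simps)
      qed
      finally show ?thesis using Q by simp
    qed
    have "admissible n (weight Q \<delta>)" using n Q \<delta>0 \<delta>3 \<delta>2 by (intro admissible_weight) auto
    then obtain U where U: "U \<in> sets borel" "emeasure lborel U \<le> ennreal (1/2)"
      "\<And>x. x \<in> {0..1} - U \<Longrightarrow> good_point n (weight Q \<delta>) e x" using most by blast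
    have "finite (S Q)"
    proof (rule finite_subset)
      show "S Q \<subseteq> {\<alpha>. algebraic \<alpha> \<and> alg_degree \<alpha> \<le> N \<and> alg_height \<alpha> \<le> \<lfloor>H * Q\<rfloor>}"
        unfolding S_def using A by (auto simp: le_floor_iff split: if_splits)
    qed (rule finite_bounded_height)
    moreover have "\<exists>\<alpha>\<in>S Q. \<bar>\<alpha> - x\<bar> \<le> 2 * \<delta>" if x: "x \<in> {0..1} - U" for x
    proof -
      obtain \<alpha> \<beta> where \<alpha>:
        "algebraic \<alpha>" "N = n + 1 \<Longrightarrow> algebraic_int \<alpha>" "alg_degree \<alpha> = N" "alg_conjugate \<alpha> \<beta>"
        "Q / max 1 (height_const n e / e) \<le> real_of_int (alg_height \<alpha>)"
        "real_of_int (alg_height \<alpha>) \<le> height_const n e * Q"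
        "\<bar>\<alpha> - x\<bar> \<le> 2 * \<delta>" "\<delta> \<le> \<bar>\<alpha> - \<beta>\<bar>" "\<bar>\<alpha> - \<beta>\<bar> \<le> 4 * \<delta>"
        using ex_algebraic_number_near_good_point[OF n N Q \<delta>0 \<delta>1 \<delta>3 _ e U(3)[OF x]] x by blast
      have "A \<alpha>" unfolding A using \<alpha>(1,2) N by auto
      moreover have "h * Q \<le> real_of_int (alg_height \<alpha>)" using \<alpha>(5) unfolding h_def H_def by simp
      ultimately have "\<alpha> \<in> S Q" using \<alpha> unfolding S_def H_def \<delta>_def[symmetric] by auto
      then show ?thesis using \<alpha>(7) by blast
    qed
    ultimately have "1 / (8 * \<delta>) \<le> real (card (S Q))" using card_ge_by_covering[OF _ \<delta>0 U(1,2)] by blast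
    moreover have "1 / (8 * \<delta>) = 1/8 * Q powr ((real n + 1) / 3)"
    proof -
      have eq: "- (real n + 1) / 3 = - ((real n + 1) / 3)" by simp
      show ?thesis unfolding \<delta>_def eq powr_minus_divide by simp
    qed
    ultimately show ?thesis by simp
  qed
  show ?thesis
    by (rule exI[of _ "1/8"], rule exI[of _ h], rule exI[of _ H], rule exI[of _ 1], rule exI[of _ 4])
      (use main hpos Hpos in \<open>auto simp: S_def intro!: exI[of _ 2]\<close>)
qed

theorem corollary2:
  fixes n :: nat
  assumes "n \<ge> 2"
  shows "(\<exists>c h H d D :: real. c > 0 \<and> h > 0 \<and> H > 0 \<and> d > 0 \<and> D > 0 \<and>
            (\<exists>Q\<^sub>0 > 1. \<forall>Q \<ge> Q\<^sub>0.
               real (card {\<alpha>\<^sub>1 :: real. algebraic \<alpha>\<^sub>1 \<and> alg_degree \<alpha>\<^sub>1 = n \<and>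
                 h * Q \<le> real_of_int (alg_height \<alpha>\<^sub>1) \<and> real_of_int (alg_height \<alpha>\<^sub>1) \<le> H * Q \<and>
                 (\<exists>\<alpha>\<^sub>2 :: real. alg_conjugate \<alpha>\<^sub>1 \<alpha>\<^sub>2 \<and>
                    d * Q powr (- (real n + 1) / 3) \<le> \<bar>\<alpha>\<^sub>1 - \<alpha>\<^sub>2\<bar> \<and>
                    \<bar>\<alpha>\<^sub>1 - \<alpha>\<^sub>2\<bar> \<le> D * Q powr (- (real n + 1) / 3))})
               \<ge> c * Q powr ((real n + 1) / 3)))
       \<and> (\<exists>c h H d D :: real. c > 0 \<and> h > 0 \<and> H > 0 \<and> d > 0 \<and> D > 0 \<and>
            (\<exists>Q\<^sub>0 > 1. \<forall>Q \<ge> Q\<^sub>0.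
               real (card {\<alpha>\<^sub>1 :: real. algebraic_int \<alpha>\<^sub>1 \<and> alg_degree \<alpha>\<^sub>1 = n + 1 \<and>
                 h * Q \<le> real_of_int (alg_height \<alpha>\<^sub>1) \<and> real_of_int (alg_height \<alpha>\<^sub>1) \<le> H * Q \<and>
                 (\<exists>\<alpha>\<^sub>2 :: real. alg_conjugate \<alpha>\<^sub>1 \<alpha>\<^sub>2 \<and>
                    d * Q powr (- (real n + 1) / 3) \<le> \<bar>\<alpha>\<^sub>1 - \<alpha>\<^sub>2\<bar> \<and>
                    \<bar>\<alpha>\<^sub>1 - \<alpha>\<^sub>2\<bar> \<le> D * Q powr (- (real n + 1) / 3))})
               \<ge> c * Q powr ((real n + 1) / 3)))"
  using many_close_conjugates[OF assms, of n algebraic]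
    many_close_conjugates[OF assms, of "n + 1" algebraic_int]
  by simp

end
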